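(* Let $n,d\ge1$ and let $\mathcal B_\alpha$, $\alpha\in\{\mathrm D,\mathrm N,\mathrm R\}$, be the bilinear forms of the second-order system defined in the context. There is a constant $C_B>0$ such that for all $\boldsymbol v,\boldsymbol w\in(H^2(\Omega))^n$ and all $\alpha\in\{\mathrm D,\mathrm N,\mathrm R\}$, $$\mathcal B_\alpha(\boldsymbol v,\boldsymbol w)\le C_B\|\boldsymbol v\|_{H^2(\Omega)}\|\boldsymbol w\|_{H^2(\Omega)}.$$ Moreover, for $\alpha=\mathrm N,\mathrm R$ there is a constant $C>0$ such that for all $\boldsymbol v=(\varphi_0,\dots,\varphi_{n-1})\in(H^2(\Omega))^n$, $$\mathcal B_\alpha(\boldsymbol v,\boldsymbol v)\ge C\sum_{k=0}^{n-1}\Big(\|\varphi_k\|_{H^1(\Omega)}^2+\|\nabla\varphi_k\|_{H(\mathrm{div};\Omega)}^2\Big).$$ In addition, for every $E>0$ there is a constant $C_E>0$ such that for all $\boldsymbol v=(\varphi_0,\dots,\varphi_{n-1})\in(H^2(\Omega))^n$ with $\|\boldsymbol v\|_{H^2(\Omega)}\le E$, $$\sqrt{\mathcal B_{\mathrm D}(\boldsymbol v,\boldsymbol v)}\ge C_E\sum_{k=0}^{n-1}\Big(\|\varphi_k\|_{H^1(\Omega)}^2+\|\nabla\varphi_k\|_{H(\mathrm{div};\Omega)}^2\Big).$$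
   Context: $\Omega=[0,1]^d$, $\boldsymbol n$ is the outer unit normal of $\partial\Omega$, and $\lambda,\mu>0$ are fixed constants. Write $\boldsymbol v=(\varphi_0,\dots,\varphi_{n-1})$, $\boldsymbol w=(\rho_0,\dots,\rho_{n-1})$. $\|\boldsymbol v\|_{H^2(\Omega)}$ denotes $\sum_k\|\varphi_k\|_{H^2(\Omega)}$, and $\|\boldsymbol q\|_{H(\mathrm{div};\Omega)}=(\|\boldsymbol q\|_{L^2(\Omega)}^2+\|\mathrm{div}\,\boldsymbol q\|_{L^2(\Omega)}^2)^{1/2}$. $\mathcal P^*\boldsymbol v=(\Delta\varphi_0-\varphi_1,\dots,\Delta\varphi_{n-2}-\varphi_{n-1},\ \Delta\varphi_{n-1})$. On $\partial\Omega$: $S^*_{\mathrm D}\boldsymbol v=(\varphi_0,\dots,\varphi_{n-1})$, $S^*_{\mathrm N}\boldsymbol v=(\partial_{\boldsymbol n}\varphi_0,\dots,\partial_{\boldsymbol n}\varphi_{n-1})$, $S^*_{\mathrm R}=S^*_{\mathrm D}+S^*_{\mathrm N}$ (traces). For $\alpha=\mathrm D,\mathrm R$: $\mathcal B_\alpha(\boldsymbol v,\boldsymbol w)=(\mathcal P^*\boldsymbol v,\mathcal P^*\boldsymbol w)_{L^2(\Omega)}+\lambda(S^*_\alpha\boldsymbol v,S^*_\alpha\boldsymbol w)_{L^2(\partial\Omega)}$. For $\alpha=\mathrm N$: $\mathcal B_{\mathrm N}(\boldsymbol v,\boldsymbol w)=(\mathcal P^*\boldsymbol v,\mathcal P^*\boldsymbol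 w)_{L^2(\Omega)}+\lambda(S^*_{\mathrm N}\boldsymbol v,S^*_{\mathrm N}\boldsymbol w)_{L^2(\partial\Omega)}+\mu\int_\Omega\varphi_0\,\mathrm dx\int_\Omega\rho_0\,\mathrm dx$. *)

theory Defs
  imports "HOL-Analysis.Analysis"
begin

text \<open>The domain is the unit cube \<open>[0,1]^d\<close> in a Euclidean space of arbitrary dimension
  \<open>d = DIM('a)\<close>, with coordinates \<open>x \<bullet> i\<close> for \<open>i \<in> Basis\<close>. Elements of
  the function spaces are represented by functions, identified up to null sets only through the
  integrals they enter.\<close>

definition unit_cube :: "'a::euclidean_space set" where
  "unit_cube = cbox 0 One"

abbreviation cube_measure :: "'a::euclidean_space measure" where
  "cube_measure \<equiv> lebesgue_on unit_cube"

section \<open>Square integrable functions\<close>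

definition L2 :: "'a measure \<Rightarrow> ('a \<Rightarrow> real) \<Rightarrow> bool" where
  "L2 M f \<longleftrightarrow> f \<in> borel_measurable M \<and> integrable M (\<lambda>x. (f x)\<^sup>2)"

definition L2_inner :: "'a measure \<Rightarrow> ('a \<Rightarrow> real) \<Rightarrow> ('a \<Rightarrow> real) \<Rightarrow> real" where
  "L2_inner M f g = (LINT x|M. f x * g x)"

definition L2_norm :: "'a measure \<Rightarrow> ('a \<Rightarrow> 'b::real_normed_vector) \<Rightarrow> real" where
  "L2_norm M f = sqrt (LINT x|M. (norm (f x))\<^sup>2)"

section \<open>Smooth functions and test functions\<close>

definition pderiv_at :: "'a::euclidean_space \<Rightarrow> ('a \<Rightarrow> real) \<Rightarrow> 'a \<Rightarrow> real" where
  "pderiv_at i f x = frechet_derivative f (at x) i"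

primrec C_k :: "nat \<Rightarrow> ('a::euclidean_space \<Rightarrow> real) \<Rightarrow> bool" where
  "C_k 0 f \<longleftrightarrow> continuous_on UNIV f"
| "C_k (Suc k) f \<longleftrightarrow> (\<forall>x. f differentiable (at x)) \<and> (\<forall>i\<in>Basis. C_k k (pderiv_at i f))"

definition smooth :: "('a::euclidean_space \<Rightarrow> real) \<Rightarrow> bool" where
  "smooth f \<longleftrightarrow> (\<forall>k. C_k k f)"

definition test_function :: "('a::euclidean_space \<Rightarrow> real) \<Rightarrow> bool" where
  "test_function \<phi> \<longleftrightarrow> smooth \<phi> \<and> compact (closure {x. \<phi> x \<noteq> 0})
     \<and> closure {x. \<phi> x \<noteq> 0} \<subseteq> interior unit_cube"

section \<open>Weak derivatives and Sobolev spaces\<close>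

definition has_weak_pderiv ::
    "'a::euclidean_space \<Rightarrow> ('a \<Rightarrow> real) \<Rightarrow> ('a \<Rightarrow> real) \<Rightarrow> bool" where
  "has_weak_pderiv i f g \<longleftrightarrow> L2 cube_measure g \<and>
     (\<forall>\<phi>. test_function \<phi> \<longrightarrow>
        L2_inner cube_measure f (pderiv_at i \<phi>) = - L2_inner cube_measure g \<phi>)"

text \<open>Weak derivatives are unique up to null sets; the choice of a representative is
  immaterial. The same applies to \<open>weak_div\<close> and \<open>bdry_trace\<close> below.\<close>

definition weak_pderiv :: "'a::euclidean_space \<Rightarrow> ('a \<Rightarrow> real) \<Rightarrow> 'a \<Rightarrow> real" where
  "weak_pderiv i f = (SOME g. has_weak_pderiv i f g)"

definition H1 :: "('a::euclidean_space \<Rightarrow> real) \<Rightarrow> bool" where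
  "H1 f \<longleftrightarrow> L2 cube_measure f \<and> (\<forall>i\<in>Basis. \<exists>g. has_weak_pderiv i f g)"

definition H2 :: "('a::euclidean_space \<Rightarrow> real) \<Rightarrow> bool" where
  "H2 f \<longleftrightarrow> H1 f \<and> (\<forall>i\<in>Basis. H1 (weak_pderiv i f))"

definition H1_norm :: "('a::euclidean_space \<Rightarrow> real) \<Rightarrow> real" where
  "H1_norm f = sqrt ((L2_norm cube_measure f)\<^sup>2
     + (\<Sum>i\<in>Basis. (L2_norm cube_measure (weak_pderiv i f))\<^sup>2))"

definition H2_norm :: "('a::euclidean_space \<Rightarrow> real) \<Rightarrow> real" where
  "H2_norm f = sqrt ((L2_norm cube_measure f)\<^sup>2
     + (\<Sum>i\<in>Basis. (L2_norm cube_measure (weak_pderiv i f))\<^sup>2)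
     + (\<Sum>i\<in>Basis. \<Sum>j\<in>Basis. (L2_norm cube_measure (weak_pderiv j (weak_pderiv i f)))\<^sup>2))"

definition laplace :: "('a::euclidean_space \<Rightarrow> real) \<Rightarrow> 'a \<Rightarrow> real" where
  "laplace f x = (\<Sum>i\<in>Basis. weak_pderiv i (weak_pderiv i f) x)"

definition weak_grad :: "('a::euclidean_space \<Rightarrow> real) \<Rightarrow> 'a \<Rightarrow> 'a" where
  "weak_grad f x = (\<Sum>i\<in>Basis. weak_pderiv i f x *\<^sub>R i)"

definition has_weak_div :: "('a::euclidean_space \<Rightarrow> 'a) \<Rightarrow> ('a \<Rightarrow> real) \<Rightarrow> bool" where
  "has_weak_div q g \<longleftrightarrow> L2 cube_measure g \<and>
     (\<forall>\<phi>. test_function \<phi> \<longrightarrow>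
        (LINT x|cube_measure. q x \<bullet> (\<Sum>i\<in>Basis. pderiv_at i \<phi> x *\<^sub>R i))
          = - L2_inner cube_measure g \<phi>)"

definition weak_div :: "('a::euclidean_space \<Rightarrow> 'a) \<Rightarrow> 'a \<Rightarrow> real" where
  "weak_div q = (SOME g. has_weak_div q g)"

definition Hdiv_norm :: "('a::euclidean_space \<Rightarrow> 'a) \<Rightarrow> real" where
  "Hdiv_norm q = sqrt ((L2_norm cube_measure q)\<^sup>2 + (L2_norm cube_measure (weak_div q))\<^sup>2)"

section \<open>The boundary of the cube\<close>

text \<open>The \<open>(d-1)\<close>-dimensional Lebesgue measure on the face
  \<open>{x \<in> unit_cube. x \<bullet> i = c}\<close>, \<open>c \<in> {0, 1}\<close>, parametrised by the remaining
  coordinates. For \<open>d = 1\<close> the product is empty and this is the unit mass at the end point.\<close>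

definition face_measure :: "'a::euclidean_space \<Rightarrow> real \<Rightarrow> 'a measure" where
  "face_measure i c =
     distr (\<Pi>\<^sub>M j\<in>Basis - {i}. restrict_space lborel {0..1}) borel
       (\<lambda>y. c *\<^sub>R i + (\<Sum>j\<in>Basis - {i}. y j *\<^sub>R j))"

definition bdry_measure :: "'a::euclidean_space measure" where
  "bdry_measure = measure_of UNIV (sets borel)
     (\<lambda>A. \<Sum>i\<in>Basis. \<Sum>c\<in>{0, 1}. emeasure (face_measure i c) A)"

lemma sets_bdry_measure [simp, measurable_cong]: "sets bdry_measure = sets borel"
  unfolding bdry_measure_def using sets.sigma_sets_eq[of borel] by simp

lemma space_bdry_measure [simp]: "space bdry_measure = UNIV"
  unfolding bdry_measure_def by simp

lemma emeasure_bdry_measure: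
  fixes A :: "'a::euclidean_space set"
  assumes "A \<in> sets borel"
  shows "emeasure bdry_measure A = (\<Sum>i\<in>Basis. \<Sum>c\<in>{0, 1}. emeasure (face_measure i c) A)"
proof (rule emeasure_measure_of[OF bdry_measure_def])
  have "sets bdry_measure = sets (borel :: 'a measure)" by simp
  then show "A \<in> sets bdry_measure" using assms by simp
  show "positive (sets bdry_measure)
    (\<lambda>A. \<Sum>i\<in>Basis. \<Sum>c\<in>{0, 1}. emeasure (face_measure i c) (A::'a set))"
    by (simp add: positive_def)
  show "countably_additive (sets bdry_measure)
    (\<lambda>A. \<Sum>i\<in>Basis. \<Sum>c\<in>{0, 1}. emeasure (face_measure i c) (A::'a set))"
  proof (rule countably_additiveI)
    fix F :: "nat \<Rightarrow> 'a set"
    assume F: "range F \<subseteq> sets bdry_measure" "disjoint_family F"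
    have "(\<Sum>n. emeasure (face_measure i c) (F n)) = emeasure (face_measure i c) (\<Union>n. F n)"
      for i :: 'a and c
      using F by (intro suminf_emeasure) (auto simp: face_measure_def)
    then show "(\<Sum>n. \<Sum>i\<in>Basis. \<Sum>c\<in>{0, 1}. emeasure (face_measure i c) (F n))
        = (\<Sum>i\<in>Basis. \<Sum>c\<in>{0, 1}. emeasure (face_measure i c) (\<Union>n. F n))"
      by (simp add: suminf_sum del: sum.insert)
  qed
qed (use sets.space_closed in auto)

text \<open>On the relative interior of each face this is the outer unit normal; on the intersections
  of distinct faces, which are null sets of \<open>bdry_measure\<close>, the value is irrelevant.\<close>

definition outer_normal :: "'a::euclidean_space \<Rightarrow> 'a" where
  "outer_normal x = (\<Sum>i\<in>Basis. (of_bool (x \<bullet> i = 1) - of_bool (x \<bullet> i = 0)) *\<^sub>R i)"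

text \<open>The trace operator \<open>H^1 \<rightarrow> L^2(boundary)\<close> is the continuous extension of the
  restriction map on functions that are smooth up to the boundary.\<close>

definition has_bdry_trace :: "('a::euclidean_space \<Rightarrow> real) \<Rightarrow> ('a \<Rightarrow> real) \<Rightarrow> bool" where
  "has_bdry_trace f g \<longleftrightarrow> L2 bdry_measure g \<and>
     (\<exists>u. (\<forall>m::nat. smooth (u m))
        \<and> (\<lambda>m. H1_norm (\<lambda>x. u m x - f x)) \<longlonglongrightarrow> 0
        \<and> (\<lambda>m. L2_norm bdry_measure (\<lambda>x. u m x - g x)) \<longlonglongrightarrow> 0)"

definition bdry_trace :: "('a::euclidean_space \<Rightarrow> real) \<Rightarrow> 'a \<Rightarrow> real" where
  "bdry_trace f = (SOME g. has_bdry_trace f g)"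

definition normal_deriv :: "('a::euclidean_space \<Rightarrow> real) \<Rightarrow> 'a \<Rightarrow> real" where
  "normal_deriv f x = outer_normal x \<bullet> (\<Sum>i\<in>Basis. bdry_trace (weak_pderiv i f) x *\<^sub>R i)"

section \<open>The second-order system\<close>

text \<open>Tuples \<open>(v 0, \<dots>, v (n - 1))\<close> are functions on \<open>nat\<close>, of which only the
  components \<open>k < n\<close> are used.\<close>

datatype bc = Dirichlet | Neumann | Robin

definition H2_vec :: "nat \<Rightarrow> (nat \<Rightarrow> 'a::euclidean_space \<Rightarrow> real) \<Rightarrow> bool" where
  "H2_vec n v \<longleftrightarrow> (\<forall>k<n. H2 (v k))"

definition H2_vec_norm :: "nat \<Rightarrow> (nat \<Rightarrow> 'a::euclidean_space \<Rightarrow> real) \<Rightarrow> real" where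
  "H2_vec_norm n v = (\<Sum>k<n. H2_norm (v k))"

definition P_star :: "nat \<Rightarrow> (nat \<Rightarrow> 'a::euclidean_space \<Rightarrow> real) \<Rightarrow> nat \<Rightarrow> 'a \<Rightarrow> real" where
  "P_star n v k x = (if Suc k < n then laplace (v k) x - v (Suc k) x else laplace (v k) x)"

fun S_star :: "bc \<Rightarrow> (nat \<Rightarrow> 'a::euclidean_space \<Rightarrow> real) \<Rightarrow> nat \<Rightarrow> 'a \<Rightarrow> real" where
  "S_star Dirichlet v k x = bdry_trace (v k) x"
| "S_star Neumann v k x = normal_deriv (v k) x"
| "S_star Robin v k x = bdry_trace (v k) x + normal_deriv (v k) x"

definition B_form :: "bc \<Rightarrow> nat \<Rightarrow> real \<Rightarrow> real \<Rightarrow> (nat \<Rightarrow> 'a::euclidean_space \<Rightarrow> real)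
    \<Rightarrow> (nat \<Rightarrow> 'a \<Rightarrow> real) \<Rightarrow> real" where
  "B_form \<alpha> n lam mu v w =
     (\<Sum>k<n. L2_inner cube_measure (P_star n v k) (P_star n w k))
     + lam * (\<Sum>k<n. L2_inner bdry_measure (S_star \<alpha> v k) (S_star \<alpha> w k))
     + (if \<alpha> = Neumann
        then mu * (LINT x|cube_measure. v 0 x) * (LINT x|cube_measure. w 0 x) else 0)"

end

theory Submission
  imports Defs
begin

text \<open>Green's formula tested with \<open>\<phi>\<^sub>k\<close> itself gives
  \<open>\<parallel>\<nabla>\<phi>\<^sub>k\<parallel>\<^sup>2 = - (\<Delta>\<phi>\<^sub>k, \<phi>\<^sub>k) + (\<partial>\<^sub>n \<phi>\<^sub>k, \<phi>\<^sub>k)\<close>, the last product being taken on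
  the boundary. Together with the trace inequality and the Poincare (Neumann) or Friedrichs
  (Dirichlet, Robin) inequality this bounds the \<open>H\<^sup>1\<close> norm of \<open>\<phi>\<^sub>k\<close> by \<open>\<Delta>\<phi>\<^sub>k\<close> and the boundary
  data. Since \<open>\<Delta>\<phi>\<^sub>k\<close> differs from the \<open>k\<close>-th component of \<open>P\<^sup>* v\<close> only by \<open>\<phi>\<^bsub>k+1\<^esub>\<close>, a
  downward induction on \<open>k\<close> bounds everything by the bilinear form. For the Neumann
  condition the means of \<open>\<phi>\<^sub>1, \<dots>\<close> are controlled by the divergence theorem. For the Dirichlet
  condition the boundary term is only linear in the trace, the factor \<open>\<partial>\<^sub>n \<phi>\<^sub>k\<close> being bounded
  through \<open>E\<close>; this is why the square root of the form appears.

  For smooth functions on the cube, Green's formula and the three inequalities follow from the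
  fundamental theorem of calculus on segments. Smooth functions are dense: contract a function towards the centre of
  the cube and mollify it. As the mollifiers involved are test functions, the same
  approximation also yields the uniqueness of weak derivatives.\<close>

section \<open>Square integrable functions\<close>

text \<open>The objects \<open>weak_pderiv\<close>, \<open>weak_div\<close> and
  \<open>bdry_trace\<close> are values of a choice operator, so nothing can be computed from them
  directly: every fact about them goes through test functions (uniqueness up to null sets) or
  through smooth functions converging to them. Existence of a trace is itself a Cauchy argument,
  which is where completeness of the square integrable functions enters. A second obstacle is
  measurability: \<open>cube_measure\<close> restricts the completed Lebesgue measure, while Fubini
  arguments want Borel sets and product measures; \<open>cube_borel\<close> is its Borel twin, and
  results are carried over. On the quantitative side, each energy estimate has the shape h^2 <= a +
  b h with h the \<open>H1_norm\<close>, so the linear term can be absorbed. In the recursion over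
  the components all data are collected in one number, a multiple of the form in the Neumann and
  Robin cases and of its square root in the Dirichlet case. The squared terms fit the latter because
  the form is at most a constant times E^2, hence at most a constant times E times its own square
  root.\<close>

lemma L2_D1: "L2 M f \<Longrightarrow> f \<in> borel_measurable M"
  and L2_D2: "L2 M f \<Longrightarrow> integrable M (\<lambda>x. (f x)\<^sup>2)"
  by (auto simp: L2_def)

lemma L2_mult_integrable:
  assumes "L2 M f" "L2 M g"
  shows "integrable M (\<lambda>x. f x * g x)"
proof (rule Bochner_Integration.integrable_bound)
  show "integrable M (\<lambda>x. (f x)\<^sup>2 + (g x)\<^sup>2)"
    using assms by (auto simp: L2_def)
  show "(\<lambda>x. f x * g x) \<in> borel_measurable M"
    using assms by (auto simp: L2_def)
  have "\<bar>a * b\<bar> \<le> \<bar>a\<^sup>2 + b\<^sup>2\<bar>" for a b :: real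
  proof -
    have "0 \<le> (\<bar>a\<bar> - \<bar>b\<bar>)\<^sup>2" by simp
    then have "2 * (\<bar>a\<bar> * \<bar>b\<bar>) \<le> a\<^sup>2 + b\<^sup>2" by (simp add: power2_diff)
    moreover have "0 \<le> \<bar>a\<bar> * \<bar>b\<bar>" by simp
    ultimately show ?thesis unfolding abs_mult by linarith
  qed
  then show "AE x in M. norm (f x * g x) \<le> norm ((f x)\<^sup>2 + (g x)\<^sup>2)" by simp
qed

lemma L2_add:
  assumes "L2 M f" "L2 M g"
  shows "L2 M (\<lambda>x. f x + g x)"
proof -
  have "integrable M (\<lambda>x. (f x)\<^sup>2 + 2 * (f x * g x) + (g x)\<^sup>2)"
    using assms L2_mult_integrable[OF assms] by (auto simp: L2_def)
  then show ?thesis using assms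
    by (auto simp: L2_def power2_sum algebra_simps)
qed

lemma L2_scale: "L2 M f \<Longrightarrow> L2 M (\<lambda>x. c * f x)"
  by (auto simp: L2_def power_mult_distrib)

lemma L2_zero: "L2 M (\<lambda>x. 0)"
  by (auto simp: L2_def)

lemma L2_uminus: "L2 M f \<Longrightarrow> L2 M (\<lambda>x. - f x)"
  using L2_scale[of M f "-1"] by simp

lemma L2_diff: "L2 M f \<Longrightarrow> L2 M g \<Longrightarrow> L2 M (\<lambda>x. f x - g x)"
  using L2_add[of M f "\<lambda>x. - g x"] L2_uminus[of M g] by simp

lemma L2_sum: "(\<And>i. i \<in> I \<Longrightarrow> L2 M (f i)) \<Longrightarrow> L2 M (\<lambda>x. \<Sum>i\<in>I. f i x)"
  by (induction I rule: infinite_finite_induct) (auto intro: L2_zero L2_add)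

lemma L2_cong_AE:
  assumes "L2 M f" "g \<in> borel_measurable M" "AE x in M. f x = g x"
  shows "L2 M g"
proof -
  have "AE x in M. (f x)\<^sup>2 = (g x)\<^sup>2" using assms(3) by eventually_elim simp
  then show ?thesis
    using assms integrable_cong_AE[of "\<lambda>x. (f x)\<^sup>2" M "\<lambda>x. (g x)\<^sup>2"]
    by (auto simp: L2_def)
qed

lemma L2_norm_nonneg [simp]: "0 \<le> L2_norm M f"
  by (simp add: L2_norm_def)

lemma L2_norm_sq_eq: "(L2_norm M f)\<^sup>2 = (LINT x|M. (f x)\<^sup>2)" for f :: "'a \<Rightarrow> real"
  by (simp add: L2_norm_def)

lemma L2_norm_sq: "(L2_norm M f)\<^sup>2 = L2_inner M f f"
  unfolding L2_norm_sq_eq L2_inner_def by (simp only: power2_eq_square)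

lemma L2_norm_cong_AE:
  fixes f g :: "'a \<Rightarrow> real"
  assumes "f \<in> borel_measurable M" "g \<in> borel_measurable M" "AE x in M. f x = g x"
  shows "L2_norm M f = L2_norm M g"
proof -
  have "(LINT x|M. (norm (f x))\<^sup>2) = (LINT x|M. (norm (g x))\<^sup>2)"
    by (rule integral_cong_AE) (use assms in auto)
  then show ?thesis by (simp add: L2_norm_def)
qed

lemma L2_inner_commute: "L2_inner M f g = L2_inner M g f"
  by (simp add: L2_inner_def mult.commute)

lemma L2_inner_add_left:
  assumes "L2 M f" "L2 M g" "L2 M h"
  shows "L2_inner M (\<lambda>x. f x + g x) h = L2_inner M f h + L2_inner M g h"
  unfolding L2_inner_def using assms
  by (simp add: distrib_right L2_mult_integrable)

lemma L2_inner_diff_left: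
  assumes "L2 M f" "L2 M g" "L2 M h"
  shows "L2_inner M (\<lambda>x. f x - g x) h = L2_inner M f h - L2_inner M g h"
  unfolding L2_inner_def using assms
  by (simp add: left_diff_distrib L2_mult_integrable)

lemma L2_inner_sum_left:
  assumes "\<And>i. i \<in> I \<Longrightarrow> L2 M (f i)" "L2 M h"
  shows "L2_inner M (\<lambda>x. \<Sum>i\<in>I. f i x) h = (\<Sum>i\<in>I. L2_inner M (f i) h)"
  unfolding L2_inner_def using assms
  by (simp add: sum_distrib_right L2_mult_integrable)

lemma L2_inner_add_right:
  assumes "L2 M f" "L2 M g" "L2 M h"
  shows "L2_inner M h (\<lambda>x. f x + g x) = L2_inner M h f + L2_inner M h g"
  using L2_inner_add_left[OF assms]
  unfolding L2_inner_commute[of M _ h] .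

lemma L2_inner_diff_right:
  assumes "L2 M f" "L2 M g" "L2 M h"
  shows "L2_inner M h (\<lambda>x. f x - g x) = L2_inner M h f - L2_inner M h g"
  using L2_inner_diff_left[OF assms]
  unfolding L2_inner_commute[of M _ h] .

text \<open>Discriminant argument: the square of the norm of f - t g is a nonnegative quadratic
  polynomial in t. The case of norm zero is separate, since the polynomial is then affine.\<close>

lemma L2_Cauchy_Schwarz:
  assumes f: "L2 M f" and g: "L2 M g"
  shows "\<bar>L2_inner M f g\<bar> \<le> L2_norm M f * L2_norm M g"
proof -
  have ineq: "2 * t * L2_inner M f g \<le> (L2_norm M f)\<^sup>2 + t\<^sup>2 * (L2_norm M g)\<^sup>2" for t
  proof -
    have "0 \<le> (LINT x|M. (f x - t * g x)\<^sup>2)" by simp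
    also have "\<dots> = (LINT x|M. (f x)\<^sup>2 - 2 * t * (f x * g x) + t\<^sup>2 * (g x)\<^sup>2)"
      by (simp add: power2_diff power_mult_distrib algebra_simps)
    also have "\<dots> = (L2_norm M f)\<^sup>2 - 2 * t * L2_inner M f g + t\<^sup>2 * (L2_norm M g)\<^sup>2"
      using f g L2_mult_integrable[OF f g]
      by (simp add: L2_norm_sq_eq L2_inner_def L2_D2)
    finally show ?thesis by simp
  qed
  have "(L2_inner M f g)\<^sup>2 \<le> (L2_norm M f)\<^sup>2 * (L2_norm M g)\<^sup>2"
  proof (cases "L2_norm M g = 0")
    case True
    have "L2_inner M f g = 0"
    proof (rule ccontr)
      assume ne: "L2_inner M f g \<noteq> 0"
      \<comment> \<open>With no quadratic term, this t makes the left side of \<open>ineq\<close>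
        exceed the right side by exactly 1.\<close>
      define t where "t = ((L2_norm M f)\<^sup>2 + 1) / (2 * L2_inner M f g)"
      from ne have "2 * t * L2_inner M f g = (L2_norm M f)\<^sup>2 + 1"
        by (simp add: t_def)
      then show False using ineq[of t] True by simp
    qed
    then show ?thesis by simp
  next
    case False
    then have pos: "(L2_norm M g)\<^sup>2 > 0" by simp
    \<comment> \<open>The minimiser of the quadratic polynomial in t.\<close>
    define t where "t = L2_inner M f g / (L2_norm M g)\<^sup>2"
    have "t\<^sup>2 * (L2_norm M g)\<^sup>2 = t * L2_inner M f g"
      using pos by (simp add: t_def power2_eq_square)
    then have "t * L2_inner M f g \<le> (L2_norm M f)\<^sup>2" using ineq[of t] by simp
    then show ?thesis using pos by (simp add: t_def power2_eq_square field_simps)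
  qed
  then have "(L2_inner M f g)\<^sup>2 \<le> (L2_norm M f * L2_norm M g)\<^sup>2"
    by (simp add: power_mult_distrib)
  then show ?thesis by (simp add: abs_le_square_iff[symmetric] abs_mult)
qed

lemma L2_norm_add_sq:
  assumes f: "L2 M f" and g: "L2 M g"
  shows "(L2_norm M (\<lambda>x. f x + g x))\<^sup>2
    = (L2_norm M f)\<^sup>2 + 2 * L2_inner M f g + (L2_norm M g)\<^sup>2"
  using L2_inner_add_left[OF f g L2_add[OF f g]] L2_inner_add_right[OF f g f]
    L2_inner_add_right[OF f g g] L2_inner_commute[of M g f]
  by (simp add: L2_norm_sq)

lemma L2_norm_triangle:
  assumes f: "L2 M f" and g: "L2 M g"
  shows "L2_norm M (\<lambda>x. f x + g x) \<le> L2_norm M f + L2_norm M g"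
proof (rule power2_le_imp_le)
  show "(L2_norm M (\<lambda>x. f x + g x))\<^sup>2 \<le> (L2_norm M f + L2_norm M g)\<^sup>2"
    using L2_Cauchy_Schwarz[OF f g] by (simp add: L2_norm_add_sq[OF f g] power2_sum)
qed simp

lemma L2_norm_scale: "L2_norm M (\<lambda>x. c * f x) = \<bar>c\<bar> * L2_norm M f" for f :: "'a \<Rightarrow> real"
  by (simp add: L2_norm_def abs_mult power_mult_distrib real_sqrt_mult)

lemma L2_norm_uminus: "L2_norm M (\<lambda>x. - f x) = L2_norm M f" for f :: "'a \<Rightarrow> real"
  by (simp add: L2_norm_def)

lemma L2_norm_minus_commute: "L2_norm M (\<lambda>x. f x - g x) = L2_norm M (\<lambda>x. g x - f x)"
  for f g :: "'a \<Rightarrow> real"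
  by (simp add: L2_norm_def power2_commute)

lemma L2_norm_triangle_diff:
  assumes f: "L2 M f" and g: "L2 M g"
  shows "L2_norm M (\<lambda>x. f x - g x) \<le> L2_norm M f + L2_norm M g"
  using L2_norm_triangle[OF f L2_uminus[OF g]] by (simp add: L2_norm_uminus)

lemma L2_norm_diff_abs:
  assumes f: "L2 M f" and g: "L2 M g"
  shows "\<bar>L2_norm M f - L2_norm M g\<bar> \<le> L2_norm M (\<lambda>x. f x - g x)"
  using L2_norm_triangle[OF L2_diff[OF f g] g] L2_norm_triangle[OF L2_diff[OF g f] f]
  by (simp add: L2_norm_minus_commute[of M g f])

lemma L2_norm_zero [simp]: "L2_norm M (\<lambda>x. 0 :: real) = 0"
  by (simp add: L2_norm_def)

lemma L2_norm_sum_le: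
  assumes "\<And>i. i \<in> I \<Longrightarrow> L2 M (f i)"
  shows "L2_norm M (\<lambda>x. \<Sum>i\<in>I. f i x) \<le> (\<Sum>i\<in>I. L2_norm M (f i))"
  using assms
proof (induction I rule: infinite_finite_induct)
  case (insert i I)
  then have "L2_norm M (\<lambda>x. f i x + (\<Sum>i\<in>I. f i x))
      \<le> L2_norm M (f i) + L2_norm M (\<lambda>x. \<Sum>i\<in>I. f i x)"
    by (intro L2_norm_triangle L2_sum) auto
  also have "\<dots> \<le> L2_norm M (f i) + (\<Sum>i\<in>I. L2_norm M (f i))"
    using insert by auto
  finally show ?case using insert by simp
qed auto

lemma L2_norm_eq_0_AE:
  fixes f :: "'a \<Rightarrow> real"
  assumes "L2 M f" "L2_norm M f = 0"
  shows "AE x in M. f x = 0"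
  using assms integral_nonneg_eq_0_iff_AE[of M "\<lambda>x. (f x)\<^sup>2"]
  by (auto simp: L2_norm_def L2_def)

lemma L2_norm_mono:
  fixes f g :: "'a \<Rightarrow> real"
  assumes "L2 M f" "L2 M g" "AE x in M. \<bar>f x\<bar> \<le> \<bar>g x\<bar>"
  shows "L2_norm M f \<le> L2_norm M g"
proof -
  have "(LINT x|M. (norm (f x))\<^sup>2) \<le> (LINT x|M. (norm (g x))\<^sup>2)"
    by (rule integral_mono_AE) (use assms in \<open>auto simp: L2_def abs_le_square_iff\<close>)
  then show ?thesis by (simp add: L2_norm_def)
qed

text \<open>Serves two multipliers: indicators of subintervals in the one-dimensional Friedrichs
  inequality, and the components of the outer normal on the boundary.\<close>

lemma L2_mult_bounded:
  fixes b :: "'a \<Rightarrow> real"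
  assumes f: "L2 M f" and b: "b \<in> borel_measurable M" "\<And>x. \<bar>b x\<bar> \<le> 1"
  shows "L2 M (\<lambda>x. b x * f x)" "L2_norm M (\<lambda>x. b x * f x) \<le> L2_norm M f"
proof -
  have *: "\<bar>b x * f x\<bar> \<le> \<bar>f x\<bar>" for x
    using b(2)[of x] by (simp add: abs_mult mult_left_le_one_le)
  show L: "L2 M (\<lambda>x. b x * f x)"
    unfolding L2_def
  proof (intro conjI Bochner_Integration.integrable_bound[OF L2_D2[OF f]])
    show "AE x in M. norm ((b x * f x)\<^sup>2) \<le> norm ((f x)\<^sup>2)"
      using * by (simp add: abs_le_square_iff)
  qed (use f b in \<open>auto simp: L2_def\<close>)
  show "L2_norm M (\<lambda>x. b x * f x) \<le> L2_norm M f"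
    by (intro L2_norm_mono L f) (use * in auto)
qed

lemma tendsto_L2_norm:
  assumes "\<And>m. L2 M (u m)" "L2 M f" "(\<lambda>m. L2_norm M (\<lambda>x. u m x - f x)) \<longlonglongrightarrow> 0"
  shows "(\<lambda>m. L2_norm M (u m)) \<longlonglongrightarrow> L2_norm M f"
proof (rule LIM_zero_cancel, rule Lim_null_comparison[OF _ assms(3)])
  show "\<forall>\<^sub>F m in sequentially.
      norm (L2_norm M (u m) - L2_norm M f) \<le> L2_norm M (\<lambda>x. u m x - f x)"
    using L2_norm_diff_abs[OF assms(1,2)] by simp
qed

text \<open>The device by which Green's formula and the divergence theorem pass from smooth
  approximants to Sobolev functions.\<close>

lemma tendsto_L2_inner:
  assumes u: "\<And>m. L2 M (u m)" "L2 M f" "(\<lambda>m. L2_norm M (\<lambda>x. u m x - f x)) \<longlonglongrightarrow> 0"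
    and w: "\<And>m. L2 M (w m)" "L2 M g" "(\<lambda>m. L2_norm M (\<lambda>x. w m x - g x)) \<longlonglongrightarrow> 0"
  shows "(\<lambda>m. L2_inner M (u m) (w m)) \<longlonglongrightarrow> L2_inner M f g"
proof (rule LIM_zero_cancel, rule Lim_null_comparison)
  have "(\<lambda>m. L2_norm M (\<lambda>x. u m x - f x) * L2_norm M (w m)
      + L2_norm M f * L2_norm M (\<lambda>x. w m x - g x))
      \<longlonglongrightarrow> 0 * L2_norm M g + L2_norm M f * 0"
    by (intro tendsto_intros u w tendsto_L2_norm)
  then show "(\<lambda>m. L2_norm M (\<lambda>x. u m x - f x) * L2_norm M (w m)
      + L2_norm M f * L2_norm M (\<lambda>x. w m x - g x)) \<longlonglongrightarrow> 0" by simp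
  have "\<bar>L2_inner M (u m) (w m) - L2_inner M f g\<bar>
      \<le> L2_norm M (\<lambda>x. u m x - f x) * L2_norm M (w m)
        + L2_norm M f * L2_norm M (\<lambda>x. w m x - g x)" for m
  proof -
    have "L2_inner M (u m) (w m) - L2_inner M f g
        = L2_inner M (\<lambda>x. u m x - f x) (w m) + L2_inner M f (\<lambda>x. w m x - g x)"
      using u w by (simp add: L2_inner_diff_left L2_inner_diff_right)
    then show ?thesis
      using L2_Cauchy_Schwarz[OF L2_diff[OF u(1)[of m] u(2)] w(1)[of m]]
        L2_Cauchy_Schwarz[OF u(2) L2_diff[OF w(1)[of m] w(2)]] by linarith
  qed
  then show "\<forall>\<^sub>F m in sequentially. norm (L2_inner M (u m) (w m) - L2_inner M f g)
      \<le> L2_norm M (\<lambda>x. u m x - f x) * L2_norm M (w m)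
        + L2_norm M f * L2_norm M (\<lambda>x. w m x - g x)" by simp
qed

section \<open>Smooth functions\<close>

lemma has_derivative_pderiv_at:
  assumes "f differentiable (at x)"
  shows "(f has_derivative (\<lambda>v. \<Sum>i\<in>Basis. (v \<bullet> i) * pderiv_at i f x)) (at x)"
proof -
  let ?D = "frechet_derivative f (at x)"
  have D: "(f has_derivative ?D) (at x)"
    using assms by (simp add: frechet_derivative_works)
  then have lin: "linear ?D" by (rule has_derivative_linear)
  have "?D v = (\<Sum>i\<in>Basis. (v \<bullet> i) * pderiv_at i f x)" for v
  proof -
    have "?D v = ?D (\<Sum>i\<in>Basis. (v \<bullet> i) *\<^sub>R i)" by (simp add: euclidean_representation)
    also have "\<dots> = (\<Sum>i\<in>Basis. (v \<bullet> i) * pderiv_at i f x)"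
      using lin by (simp add: linear_sum linear_cmul pderiv_at_def o_def)
    finally show ?thesis .
  qed
  then show ?thesis using D by (metis (no_types, lifting) ext)
qed

lemma pderiv_at_eqI:
  assumes "(f has_derivative D) (at x)"
  shows "pderiv_at i f x = D i"
  using frechet_derivative_at[OF assms] by (simp add: pderiv_at_def)

lemma pderiv_at_add:
  assumes "f differentiable (at x)" "g differentiable (at x)"
  shows "pderiv_at i (\<lambda>x. f x + g x) x = pderiv_at i f x + pderiv_at i g x"
  using pderiv_at_eqI[OF has_derivative_add[OF assms[unfolded frechet_derivative_works]]]
  by (simp add: pderiv_at_def)

lemma pderiv_at_mult:
  assumes "f differentiable (at x)" "g differentiable (at x)"
  shows "pderiv_at i (\<lambda>x. f x * g x) x = f x * pderiv_at i g x + pderiv_at i f x * g x"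
  using pderiv_at_eqI[OF has_derivative_mult[OF assms[unfolded frechet_derivative_works]]]
  by (simp add: pderiv_at_def)

lemma C_k_mono_Suc: "C_k (Suc k) f \<Longrightarrow> C_k k f"
proof (induction k arbitrary: f)
  case 0
  then show ?case
    by (auto intro!: differentiable_imp_continuous_on simp: differentiable_on_def)
qed auto

lemma C_k_mono: "C_k k f \<Longrightarrow> j \<le> k \<Longrightarrow> C_k j f"
  by (induction k) (auto simp del: C_k.simps dest: C_k_mono_Suc simp: le_Suc_eq)

lemma C_k_imp_continuous: "C_k k f \<Longrightarrow> continuous_on UNIV f"
  using C_k_mono[of k f 0] by simp

lemma C_k_const: "C_k k (\<lambda>x. c)"
proof (induction k arbitrary: c)
  case (Suc k)
  have "pderiv_at i (\<lambda>x. c) = (\<lambda>x. 0)" for i :: 'a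
    by (rule ext) (simp add: pderiv_at_eqI[OF has_derivative_const])
  then show ?case using Suc by simp
qed simp

lemma C_k_add: "C_k k f \<Longrightarrow> C_k k g \<Longrightarrow> C_k k (\<lambda>x. f x + g x)"
proof (induction k arbitrary: f g)
  case (Suc k)
  have "pderiv_at i (\<lambda>x. f x + g x) = (\<lambda>x. pderiv_at i f x + pderiv_at i g x)" for i
    using Suc.prems by (intro ext pderiv_at_add) auto
  then show ?case using Suc by auto
qed (simp add: continuous_on_add)

lemma C_k_mult: "C_k k f \<Longrightarrow> C_k k g \<Longrightarrow> C_k k (\<lambda>x. f x * g x)"
proof (induction k arbitrary: f g)
  case (Suc k)
  have "pderiv_at i (\<lambda>x. f x * g x) = (\<lambda>x. f x * pderiv_at i g x + pderiv_at i f x * g x)" for i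
    using Suc.prems by (intro ext pderiv_at_mult) auto
  moreover have "C_k k f" "C_k k g" using Suc.prems C_k_mono_Suc by blast+
  ultimately show ?case using Suc by (auto intro!: C_k_add)
qed (simp add: continuous_on_mult)

lemma C_k_cmult: "C_k k f \<Longrightarrow> C_k k (\<lambda>x. c * f x)"
  by (intro C_k_mult C_k_const)

lemma C_k_prod: "(\<And>i. i \<in> I \<Longrightarrow> C_k k (f i)) \<Longrightarrow> C_k k (\<lambda>x. \<Prod>i\<in>I. f i x)"
  by (induction I rule: infinite_finite_induct) (auto intro: C_k_const C_k_mult)

lemma pderiv_at_affine:
  assumes "f differentiable (at (a *\<^sub>R x + b))"
  shows "((\<lambda>x. f (a *\<^sub>R x + b)) has_derivative (\<lambda>v. frechet_derivative f (at (a *\<^sub>R x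
      + b)) (a *\<^sub>R v))) (at x)"
    and "pderiv_at i (\<lambda>x. f (a *\<^sub>R x + b)) x = a * pderiv_at i f (a *\<^sub>R x + b)"
proof -
  let ?D = "frechet_derivative f (at (a *\<^sub>R x + b))"
  have D: "(f has_derivative ?D) (at (a *\<^sub>R x + b))"
    using assms by (simp add: frechet_derivative_works)
  show *: "((\<lambda>x. f (a *\<^sub>R x + b)) has_derivative (\<lambda>v. ?D (a *\<^sub>R v))) (at x)"
    by (rule has_derivative_compose[where f = "\<lambda>x. a *\<^sub>R x + b" and g = f, OF _ D])
      (auto intro!: derivative_eq_intros)
  show "pderiv_at i (\<lambda>x. f (a *\<^sub>R x + b)) x = a * pderiv_at i f (a *\<^sub>R x + b)"
    unfolding pderiv_at_eqI[OF *] using has_derivative_linear[OF D]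
    by (simp add: linear_cmul pderiv_at_def)
qed

lemma C_k_affine: "C_k k f \<Longrightarrow> C_k k (\<lambda>x. f (a *\<^sub>R x + b))"
proof (induction k arbitrary: f)
  case 0
  then show ?case
    by (auto intro!: continuous_on_compose2[of UNIV f] continuous_intros)
next
  case (Suc k)
  have "pderiv_at i (\<lambda>x. f (a *\<^sub>R x + b)) = (\<lambda>x. a * pderiv_at i f (a *\<^sub>R x + b))" for i
    using Suc.prems by (intro ext pderiv_at_affine(2)) simp
  moreover have "(\<lambda>x. f (a *\<^sub>R x + b)) differentiable (at x)" for x
    using pderiv_at_affine(1)[of f a x b] Suc.prems by (auto simp: differentiable_def)
  ultimately show ?case using Suc by (simp add: C_k_cmult)
qed

lemma smooth_pderiv_at: "smooth f \<Longrightarrow> i \<in> Basis \<Longrightarrow> smooth (pderiv_at i f)"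
  unfolding smooth_def by (metis C_k.simps(2))

lemma smooth_differentiable: "smooth f \<Longrightarrow> f differentiable (at x)"
  unfolding smooth_def by (metis C_k.simps(2))

lemma smooth_imp_continuous: "smooth f \<Longrightarrow> continuous_on S f"
  unfolding smooth_def using C_k_imp_continuous continuous_on_subset by blast

text \<open>The complement of S is open, so f vanishes on a whole neighbourhood of x. Compact
  support is thereby inherited by derivatives.\<close>

lemma pderiv_at_eq_0_outside:
  assumes "closed S" "\<And>x. x \<notin> S \<Longrightarrow> f x = 0" "x \<notin> S"
  shows "pderiv_at i f x = 0"
proof -
  have "(f has_derivative (\<lambda>_. 0)) (at x)"
    by (rule has_derivative_transform_within_open[OF has_derivative_const[of 0], where s = "- S"])
      (use assms in auto)
  then show ?thesis by (rule pderiv_at_eqI)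
qed

subsection \<open>A smooth bump\<close>

text \<open>\<open>flat 1\<close> is the classical function exp(-1/t), extended by zero. The
  polynomial in 1/t is carried along because differentiation only changes that polynomial, so the
  family is closed under derivatives.\<close>

definition flat :: "real poly \<Rightarrow> real \<Rightarrow> real" where
  "flat p t = (if t > 0 then poly p (1 / t) * exp (- (1 / t)) else 0)"

lemma poly_exp_tendsto_0: "((\<lambda>s. poly p s * exp (- s)) \<longlongrightarrow> (0 :: real)) at_top"
proof -
  have "((\<lambda>s. \<Sum>i\<le>degree p. coeff p i * (s ^ i / exp s)) \<longlongrightarrow> (\<Sum>i\<le>degree p. coeff p i * 0)) at_top"
    by (intro tendsto_intros tendsto_power_div_exp_0)
  moreover have "(\<lambda>s. \<Sum>i\<le>degree p. coeff p i * (s ^ i / exp s)) = (\<lambda>s. poly p s * exp (- s))"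
    by (simp add: poly_altdef exp_minus sum_distrib_right divide_inverse mult.assoc)
  ultimately show ?thesis by simp
qed

lemma flat_tendsto_0: "(flat p \<longlongrightarrow> 0) (at_right 0)"
proof -
  have "((\<lambda>t. poly p (1 / t) * exp (- (1 / t))) \<longlongrightarrow> 0) (at_right 0)"
    using filterlim_compose[OF poly_exp_tendsto_0[of p] filterlim_inverse_at_top_right]
    by (simp add: inverse_eq_divide)
  then show ?thesis
    by (rule Lim_transform_eventually)
      (auto simp: flat_def eventually_at_right_less intro!: eventually_at_rightI[of 0 1])
qed

text \<open>With \<open>s = 1 / t\<close>, the \<open>t\<close>-derivative of \<open>p s * exp (- s)\<close> is
  \<open>s\<^sup>2 * (p s - p' s) * exp (- s)\<close>.\<close>

lemma flat_has_derivative: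
  "(flat p has_real_derivative flat ([:0, 0, 1:] * (p - pderiv p)) t) (at t)"
proof -
  consider "t > 0" | "t < 0" | "t = 0" by linarith
  then show ?thesis
  proof cases
    case 1
    have "((\<lambda>t. poly p (1 / t) * exp (- (1 / t))) has_real_derivative
        flat ([:0, 0, 1:] * (p - pderiv p)) t) (at t)"
      using 1 by (auto intro!: derivative_eq_intros simp: flat_def field_simps power2_eq_square)
    then show ?thesis
      by (rule has_field_derivative_transform_within_open[of _ _ _ "{0<..}"])
        (use 1 in \<open>auto simp: flat_def\<close>)
  next
    case 2
    have "((\<lambda>t. 0) has_real_derivative flat ([:0, 0, 1:] * (p - pderiv p)) t) (at t)"
      using 2 by (simp add: flat_def)
    then show ?thesis
      by (rule has_field_derivative_transform_within_open[of _ _ _ "{..<0}"])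
        (use 2 in \<open>auto simp: flat_def\<close>)
  next
    case 3
    \<comment> \<open>At the origin the difference quotient is again a member of the family: the
      factor 1/t is absorbed into the polynomial as \<open>[:0, 1:] * p\<close>.\<close>
    have "((\<lambda>t. flat p t / t) \<longlongrightarrow> 0) (at_right 0)"
    proof (rule Lim_transform_eventually[OF flat_tendsto_0[of "[:0, 1:] * p"]])
      show "\<forall>\<^sub>F t in at_right 0. flat ([:0, 1:] * p) t = flat p t / t"
        by (rule eventually_at_rightI[of 0 1]) (auto simp: flat_def)
    qed
    moreover have "((\<lambda>t. flat p t / t) \<longlongrightarrow> 0) (at_left 0)"
      by (rule tendsto_eventually) (auto simp: flat_def intro!: eventually_at_leftI[of "-1" 0])
    ultimately have "((\<lambda>t. flat p t / t) \<longlongrightarrow> 0) (at 0)"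
      by (simp add: filterlim_split_at)
    then show ?thesis using 3
      by (simp add: has_field_derivative_iff) (simp add: flat_def)
  qed
qed

text \<open>The polynomial stays arbitrary in the induction, since each derivative replaces it by
  another one.\<close>

lemma C_k_flat_inner: "C_k k (\<lambda>x::'a::euclidean_space. flat p (a * (x \<bullet> j) + b))"
proof (induction k arbitrary: p)
  case 0
  have "continuous_on UNIV (flat p)"
    using flat_has_derivative[of p] by (meson DERIV_isCont continuous_at_imp_continuous_on)
  then show ?case
    by (auto intro!: continuous_on_compose2[of UNIV "flat p"] continuous_intros)
next
  case (Suc k)
  let ?q = "[:0, 0, 1:] * (p - pderiv p)"
  have der: "((\<lambda>x::'a. flat p (a * (x \<bullet> j) + b)) has_derivative
      (\<lambda>v. flat ?q (a * (x \<bullet> j) + b) * (a * (v \<bullet> j)))) (at x)" for x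
    by (rule has_derivative_compose[where g = "flat p",
          OF _ flat_has_derivative[THEN has_field_derivative_imp_has_derivative]])
      (auto intro!: derivative_eq_intros)
  then have "pderiv_at i (\<lambda>x::'a. flat p (a * (x \<bullet> j) + b)) =
      (\<lambda>x. (a * (i \<bullet> j)) * flat ?q (a * (x \<bullet> j) + b))" for i :: 'a
    by (auto simp: pderiv_at_eqI[OF der])
  then show ?case using der Suc[of ?q]
    by (auto simp: differentiable_def simp del: mult_pCons_left intro!: C_k_cmult)
qed

text \<open>A product over the coordinates rather than a radial function: the support is a box,
  which is compared with the cube one coordinate at a time.\<close>

definition bump :: "real \<Rightarrow> 'a::euclidean_space \<Rightarrow> real" where
  "bump e x = (\<Prod>j\<in>Basis. flat 1 (e + x \<bullet> j) * flat 1 (e - x \<bullet> j))"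

lemma smooth_bump: "smooth (bump e)"
  unfolding smooth_def bump_def
proof (intro allI C_k_prod C_k_mult)
  show "C_k k (\<lambda>x::'a. flat 1 (e + x \<bullet> j))" for k j
    using C_k_flat_inner[of k 1 1 j e] by (simp add: add.commute)
  show "C_k k (\<lambda>x::'a. flat 1 (e - x \<bullet> j))" for k j
    using C_k_flat_inner[of k 1 "-1" j e] by (simp add: add.commute)
qed

lemma flat_nonneg: "flat 1 t \<ge> 0" and flat_pos: "t > 0 \<Longrightarrow> flat 1 t > 0"
  and flat_eq_0: "t \<le> 0 \<Longrightarrow> flat p t = 0"
  by (auto simp: flat_def)

lemma bump_nonneg: "bump e x \<ge> 0"
  unfolding bump_def by (intro prod_nonneg ballI mult_nonneg_nonneg flat_nonneg)

lemma bump_pos: "e > 0 \<Longrightarrow> bump e 0 > 0"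
  unfolding bump_def by (intro prod_pos ballI mult_pos_pos flat_pos) auto

lemma bump_eq_0: "x \<notin> cbox (- (e *\<^sub>R One)) (e *\<^sub>R One) \<Longrightarrow> bump e x = 0"
proof -
  assume "x \<notin> cbox (- (e *\<^sub>R One)) (e *\<^sub>R One)"
  then obtain j where j: "j \<in> Basis" "e + x \<bullet> j \<le> 0 \<or> e - x \<bullet> j \<le> 0"
    by (force simp: mem_box)
  then have "flat 1 (e + x \<bullet> j) * flat 1 (e - x \<bullet> j) = 0"
    by (auto simp: flat_eq_0)
  then show "bump e x = 0"
    unfolding bump_def using j by (intro prod_zero) auto
qed

section \<open>The cube and its faces\<close>

text \<open>A density on the whole line instead of a restricted space: the underlying space is
  \<open>UNIV\<close> with the Borel sets, so measurability in products involves no membership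
  conditions.\<close>

definition unit_interval_measure :: "real measure" where
  "unit_interval_measure = density lborel (indicator {0..1})"

text \<open>Borel counterpart of \<open>cube_measure\<close>; all product and Fubini arguments take
  place here.\<close>

definition cube_borel :: "'a::euclidean_space measure" where
  "cube_borel = density lborel (indicator unit_cube)"

lemma sets_unit_interval_measure [simp, measurable_cong]: "sets unit_interval_measure = sets borel"
  and space_unit_interval_measure [simp]: "space unit_interval_measure = UNIV"
  by (simp_all add: unit_interval_measure_def)

lemma sets_cube_borel [simp, measurable_cong]: "sets cube_borel = sets borel"
  and space_cube_borel [simp]: "space cube_borel = UNIV"
  by (simp_all add: cube_borel_def)

lemma unit_cube_borel [measurable, simp]: "unit_cube \<in> sets borel"
  by (simp add: unit_cube_def)

lemma compact_unit_cube: "compact unit_cube"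
  by (simp add: unit_cube_def)

lemma mem_unit_cube: "x \<in> unit_cube \<longleftrightarrow> (\<forall>j\<in>Basis. 0 \<le> x \<bullet> j \<and> x \<bullet> j \<le> 1)"
  by (auto simp: unit_cube_def mem_box)

lemma emeasure_unit_interval_measure:
  "A \<in> sets borel \<Longrightarrow> emeasure unit_interval_measure A = emeasure lborel (A \<inter> {0..1})"
  by (simp add: unit_interval_measure_def emeasure_density indicator_inter_arith[symmetric]
      Int_commute)

lemma emeasure_cube_borel_UNIV: "emeasure (cube_borel :: 'a::euclidean_space measure) UNIV = 1"
  by (simp add: cube_borel_def emeasure_density unit_cube_def emeasure_lborel_cbox_eq)

global_interpretation unit_interval: finite_measure unit_interval_measure
  by standard (simp add: emeasure_unit_interval_measure)

global_interpretation unit_interval_product: product_sigma_finite "\<lambda>_. unit_interval_measure"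
  by standard

global_interpretation cube_borel: finite_measure "cube_borel :: 'a::euclidean_space measure"
  by standard (simp add: emeasure_cube_borel_UNIV)

text \<open>The two products live on different underlying spaces, so they are compared by
  transporting along the identity map. Agreement on boxes determines a product measure.\<close>

lemma PiM_unit_interval_restrict:
  assumes "finite I"
  shows "distr (\<Pi>\<^sub>M j\<in>I. restrict_space lborel {0..1}) (\<Pi>\<^sub>M j\<in>I. unit_interval_measure) (\<lambda>y. y)
    = (\<Pi>\<^sub>M j\<in>I. unit_interval_measure)"
proof (rule unit_interval_product.PiM_eqI[OF assms])
  fix A :: "'a \<Rightarrow> real set" assume A: "\<And>i. i \<in> I \<Longrightarrow> A i \<in> sets unit_interval_measure"
  interpret sigma_finite_measure "restrict_space lborel {0..1::real}"
    by (rule sigma_finite_measure_restrict_space) (auto intro: sigma_finite_lborel)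
  interpret R: product_sigma_finite "\<lambda>_. restrict_space lborel {0..1::real}"
    by standard
  have meas: "(\<lambda>y. y) \<in> measurable (\<Pi>\<^sub>M j\<in>I. restrict_space lborel {0..1::real})
      (\<Pi>\<^sub>M j\<in>I. unit_interval_measure)"
  proof (rule measurable_PiM_single')
    show "(\<lambda>y. y) \<in> space (\<Pi>\<^sub>M j\<in>I. restrict_space lborel {0..1}) \<rightarrow> I \<rightarrow>\<^sub>E space unit_interval_measure"
      by (auto simp: space_PiM)
    fix i assume "i \<in> I"
    then have "(\<lambda>y. y i) \<in> measurable (\<Pi>\<^sub>M j\<in>I. restrict_space lborel {0..1::real}) (restrict_space
        lborel {0..1})"
      by (rule measurable_component_singleton)
    then show "(\<lambda>y. y i) \<in> measurable (\<Pi>\<^sub>M j\<in>I. restrict_space lborel {0..1::real})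
        unit_interval_measure"
      by (simp add: measurable_restrict_space2_iff cong: measurable_cong_sets)
  qed
  have "emeasure (distr (\<Pi>\<^sub>M j\<in>I. restrict_space lborel {0..1}) (\<Pi>\<^sub>M j\<in>I. unit_interval_measure) (\<lambda>y.
      y)) (Pi\<^sub>E I A)
     = emeasure (\<Pi>\<^sub>M j\<in>I. restrict_space lborel {0..1}) (Pi\<^sub>E I A \<inter> space (\<Pi>\<^sub>M j\<in>I. restrict_space
         lborel {0..1::real}))"
    using A assms by (subst emeasure_distr[OF meas]) (auto intro!: sets_PiM_I_finite simp:
        vimage_def Int_def)
  also have "Pi\<^sub>E I A \<inter> space (\<Pi>\<^sub>M j\<in>I. restrict_space lborel {0..1::real})
      = Pi\<^sub>E I (\<lambda>i. A i \<inter> {0..1})"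
    by (auto simp: space_PiM PiE_Int)
  also have "emeasure (\<Pi>\<^sub>M j\<in>I. restrict_space lborel {0..1}) \<dots>
      = (\<Prod>i\<in>I. emeasure (restrict_space lborel {0..1}) (A i \<inter> {0..1}))"
    using A by (intro R.emeasure_PiM[OF assms]) (auto simp: sets_restrict_space)
  also have "\<dots> = (\<Prod>i\<in>I. emeasure unit_interval_measure (A i))"
    using A by (intro prod.cong refl)
      (auto simp: emeasure_restrict_space emeasure_unit_interval_measure)
  finally show "emeasure (distr (\<Pi>\<^sub>M j\<in>I. restrict_space lborel {0..1}) (\<Pi>\<^sub>M j\<in>I.
      unit_interval_measure) (\<lambda>y. y)) (Pi\<^sub>E I A)
     = (\<Prod>i\<in>I. emeasure unit_interval_measure (A i))" .
qed simp

lemma PiM_unit_interval_density: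
  assumes "finite I"
  shows "density (\<Pi>\<^sub>M j\<in>I. lborel) (\<lambda>y. \<Prod>j\<in>I. indicator {0..1} (y j))
    = (\<Pi>\<^sub>M j\<in>I. unit_interval_measure)"
proof (rule unit_interval_product.PiM_eqI[OF assms])
  interpret L: product_sigma_finite "\<lambda>_. lborel :: real measure" by standard
  show "sets (density (\<Pi>\<^sub>M j\<in>I. lborel) (\<lambda>y. \<Prod>j\<in>I. indicator {0..1::real} (y j)))
    = sets (\<Pi>\<^sub>M j\<in>I. unit_interval_measure)"
    by (simp cong: sets_PiM_cong)
  fix A :: "'a \<Rightarrow> real set" assume A: "\<And>i. i \<in> I \<Longrightarrow> A i \<in> sets unit_interval_measure"
  have "emeasure (density (\<Pi>\<^sub>M j\<in>I. lborel) (\<lambda>y. \<Prod>j\<in>I. indicator {0..1} (y j))) (Pi\<^sub>E I A)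
      = (\<integral>\<^sup>+y. (\<Prod>j\<in>I. indicator {0..1} (y j)) * indicator (Pi\<^sub>E I A) y \<partial>(\<Pi>\<^sub>M j\<in>I. lborel))"
    using A assms by (intro emeasure_density) (auto intro!: sets_PiM_I_finite)
  also have "\<dots> = (\<integral>\<^sup>+y. (\<Prod>j\<in>I. indicator (A j \<inter> {0..1}) (y j)) \<partial>(\<Pi>\<^sub>M j\<in>I. lborel))"
  proof (rule nn_integral_cong)
    fix y assume "y \<in> space (\<Pi>\<^sub>M j\<in>I. lborel :: real measure)"
    then have "indicator (Pi\<^sub>E I A) y = (\<Prod>j\<in>I. indicator (A j) (y j) :: ennreal)"
      using assms by (auto simp: indicator_def space_PiM PiE_iff prod_zero_iff)
    then show "(\<Prod>j\<in>I. indicator {0..1} (y j)) * indicator (Pi\<^sub>E I A) y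
        = (\<Prod>j\<in>I. indicator (A j \<inter> {0..1}) (y j) :: ennreal)"
      by (simp add: prod.distrib[symmetric] indicator_inter_arith mult.commute)
  qed
  also have "\<dots> = (\<Prod>j\<in>I. emeasure unit_interval_measure (A j))"
    using A by (subst L.product_nn_integral_prod[OF assms])
      (auto intro!: prod.cong simp: emeasure_unit_interval_measure)
  finally show "emeasure (density (\<Pi>\<^sub>M j\<in>I. lborel) (\<lambda>y. \<Prod>j\<in>I. indicator {0..1} (y j))) (Pi\<^sub>E I A)
      = (\<Prod>j\<in>I. emeasure unit_interval_measure (A j))" .
qed

text \<open>Swaps the restricted intervals of the definition for
  \<open>unit_interval_measure\<close>, whose finite products have been set up once and for
  all.\<close>

lemma face_measure_eq:
  "face_measure i c = distr (\<Pi>\<^sub>M j\<in>Basis - {i}. unit_interval_measure) borel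
     (\<lambda>y. c *\<^sub>R i + (\<Sum>j\<in>Basis - {i}. y j *\<^sub>R j))"
  (is "_ = distr ?P borel ?f")
proof -
  have "?P = distr (\<Pi>\<^sub>M j\<in>Basis - {i}. restrict_space lborel {0..1}) ?P (\<lambda>y. y)"
    by (rule PiM_unit_interval_restrict[symmetric]) simp
  then have "distr ?P borel ?f
      = distr (distr (\<Pi>\<^sub>M j\<in>Basis - {i}. restrict_space lborel {0..1}) ?P (\<lambda>y. y)) borel ?f"
    by simp
  also have "\<dots> = face_measure i c"
    unfolding face_measure_def
  proof (subst distr_distr)
    show "?f \<in> measurable ?P borel" by measurable
    show "(\<lambda>y. y) \<in> measurable (\<Pi>\<^sub>M j\<in>Basis - {i}. restrict_space lborel {0..1::real}) ?P"
    proof (rule measurable_PiM_single')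
      show "(\<lambda>y. y) \<in> space (\<Pi>\<^sub>M j\<in>Basis - {i}. restrict_space lborel {0..1}) \<rightarrow> Basis
          - {i} \<rightarrow>\<^sub>E space unit_interval_measure"
        by (auto simp: space_PiM)
      fix j assume "j \<in> Basis - {i}"
      then have "(\<lambda>y. y j) \<in> measurable (\<Pi>\<^sub>M j\<in>Basis - {i}. restrict_space lborel {0..1::real})
          (restrict_space lborel {0..1})"
        by (rule measurable_component_singleton)
      then show "(\<lambda>y. y j) \<in> measurable (\<Pi>\<^sub>M j\<in>Basis - {i}. restrict_space lborel {0..1::real})
          unit_interval_measure"
        by (simp add: measurable_restrict_space2_iff cong: measurable_cong_sets)
    qed
  qed (simp add: o_def)
  finally show ?thesis by simp
qed

lemma sets_face_measure [simp, measurable_cong]: "sets (face_measure i c) = sets borel"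
  and space_face_measure [simp]: "space (face_measure i c) = UNIV"
  by (simp_all add: face_measure_def)

lemma emeasure_face_measure_UNIV: "emeasure (face_measure i c) UNIV = 1"
proof -
  have "emeasure (\<Pi>\<^sub>M j\<in>Basis - {i}. unit_interval_measure) (\<Pi>\<^sub>E j\<in>Basis - {i}. UNIV) = 1"
    by (subst unit_interval_product.emeasure_PiM) (auto simp: emeasure_unit_interval_measure)
  then show ?thesis
    unfolding face_measure_eq by (subst emeasure_distr) (auto simp: space_PiM)
qed

global_interpretation face: finite_measure "face_measure i c" for i c
  by standard (simp add: emeasure_face_measure_UNIV)

text \<open>Opposite faces are translates of each other, so integrals over either of them can be
  taken over the base face of the fibration of the cube.\<close>

lemma face_measure_shift: "face_measure i c = distr (face_measure i 0) borel (\<lambda>x. x + c *\<^sub>R i)"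
  unfolding face_measure_eq by (subst distr_distr) (simp_all add: o_def add.commute)

lemma AE_face_normal:
  assumes "i \<in> Basis"
  shows "AE x in face_measure i c. x \<bullet> i = c"
  unfolding face_measure_eq using assms
  by (subst AE_distr_iff) (auto simp: inner_add_left inner_sum_left inner_Basis intro!: AE_I2
      sum.neutral)

text \<open>The edges of a face are null: prescribing coordinate j to be 0 or 1 gives a box with one
  factor of measure zero. This is what makes the values of the normal on edges irrelevant.\<close>

lemma AE_face_tangential:
  assumes i: "i \<in> Basis" and j: "j \<in> Basis" "j \<noteq> i"
  shows "AE x in face_measure i c. 0 < x \<bullet> j \<and> x \<bullet> j < 1"
proof -
  let ?P = "\<Pi>\<^sub>M j\<in>Basis - {i}. unit_interval_measure"
  \<comment> \<open>The exceptional set is this box; its j-th factor meets the unit interval only in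
    the two end points.\<close>
  let ?N = "\<lambda>k. if k = j then - {0<..<1::real} else UNIV"
  have "emeasure ?P (\<Pi>\<^sub>E k\<in>Basis - {i}. ?N k) = 0"
  proof (subst unit_interval_product.emeasure_PiM)
    have "- {0<..<1} \<inter> {0..1} = {0, 1::real}" by auto
    then have "emeasure unit_interval_measure (?N j) = 0"
      by (simp add: emeasure_unit_interval_measure emeasure_lborel_countable)
    then show "(\<Prod>k\<in>Basis - {i}. emeasure unit_interval_measure (?N k)) = 0"
      using j by (intro prod_zero) auto
  qed auto
  then have "AE y in ?P. 0 < y j \<and> y j < 1"
  proof (rule AE_I[rotated])
    show "(\<Pi>\<^sub>E k\<in>Basis - {i}. ?N k) \<in> sets ?P"
      by (rule sets_PiM_I_finite) auto
    show "{y \<in> space ?P. \<not> (0 < y j \<and> y j < 1)} \<subseteq> (\<Pi>\<^sub>E k\<in>Basis - {i}. ?N k)"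
      by (rule subsetI) (simp add: space_PiM PiE_iff not_less)
  qed
  moreover have "(c *\<^sub>R i + (\<Sum>k\<in>Basis - {i}. y k *\<^sub>R k)) \<bullet> j = y j" for y
    using i j by (simp add: inner_add_left inner_sum_left inner_Basis if_distrib sum.delta cong:
        if_cong)
  ultimately show ?thesis
    unfolding face_measure_eq by (subst AE_distr_iff) auto
qed

lemma AE_face_relint:
  assumes "i \<in> Basis"
  shows "AE x in face_measure i c. x \<bullet> i = c \<and> (\<forall>j\<in>Basis - {i}. 0 < x \<bullet> j \<and> x \<bullet> j < 1)"
  using AE_face_normal[OF assms] AE_face_tangential[OF assms]
  by (subst AE_conj_iff, simp, subst AE_finite_all) auto

text \<open>Fubini in direction i: the cube is the product of its base face and the segments
  orthogonal to it. In dimension one the base face is a unit point mass, and the statement needs no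
  separate case.\<close>

lemma cube_borel_fiber:
  assumes i: "i \<in> Basis"
  shows "cube_borel = distr (face_measure i 0 \<Otimes>\<^sub>M unit_interval_measure) borel (\<lambda>(x, t). x + t *\<^sub>R i)"
proof (rule measure_eqI)
  fix A :: "'a set" assume "A \<in> sets cube_borel"
  then have A[measurable]: "A \<in> sets borel" by simp
  let ?P = "\<Pi>\<^sub>M j\<in>Basis - {i}. unit_interval_measure"
  let ?h = "\<lambda>y :: 'a \<Rightarrow> real. \<Sum>b\<in>Basis. y b *\<^sub>R b"
  have Bi: "Basis = insert i (Basis - {i})" using i by auto
  interpret pair_sigma_finite "face_measure i 0" unit_interval_measure by standard
  have "emeasure cube_borel A = (\<integral>\<^sup>+x. indicator unit_cube x * indicator A x \<partial>lborel)"
    by (simp add: cube_borel_def emeasure_density)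
  also have "\<dots> = (\<integral>\<^sup>+y. indicator unit_cube (?h y) * indicator A (?h y) \<partial>(\<Pi>\<^sub>M b\<in>Basis. lborel))"
    by (subst lborel_eq) (simp add: nn_integral_distr)
  also have "\<dots> = (\<integral>\<^sup>+y. (\<Prod>j\<in>Basis. indicator {0..1} (y j)) * indicator A (?h y)
      \<partial>(\<Pi>\<^sub>M b\<in>Basis. lborel))"
  proof (rule nn_integral_cong)
    fix y :: "'a \<Rightarrow> real"
    have "indicator unit_cube (?h y) = (\<Prod>j\<in>Basis. indicator {0..1} (y j) :: ennreal)"
      by (auto simp: indicator_def mem_unit_cube prod_zero_iff)
    then show "indicator unit_cube (?h y) * indicator A (?h y)
        = (\<Prod>j\<in>Basis. indicator {0..1} (y j)) * (indicator A (?h y) :: ennreal)"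
      by simp
  qed
  also have "\<dots> = (\<integral>\<^sup>+y. indicator A (?h y) \<partial>(\<Pi>\<^sub>M b\<in>Basis. unit_interval_measure))"
    by (subst PiM_unit_interval_density[symmetric]) (simp_all add: nn_integral_density)
  \<comment> \<open>The integration over coordinate i is split off from the product.\<close>
  also have "\<dots> = (\<integral>\<^sup>+y. (\<integral>\<^sup>+t. indicator A (?h (y(i := t))) \<partial>unit_interval_measure) \<partial>?P)"
    by (subst Bi, subst unit_interval_product.product_nn_integral_insert) (simp_all flip: Bi)
  also have "\<dots> = (\<integral>\<^sup>+y. (\<integral>\<^sup>+t. indicator A ((\<Sum>b\<in>Basis - {i}. y b *\<^sub>R b) + t *\<^sub>R i)
      \<partial>unit_interval_measure) \<partial>?P)"
  proof -
    have "?h (y(i := t)) = (\<Sum>b\<in>Basis - {i}. y b *\<^sub>R b) + t *\<^sub>R i" for y t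
      using i by (subst sum.remove[OF _ i]) (auto simp: add.commute intro!: sum.cong)
    then show ?thesis by simp
  qed
  also have "\<dots> = (\<integral>\<^sup>+x. (\<integral>\<^sup>+t. indicator A (x + t *\<^sub>R i) \<partial>unit_interval_measure) \<partial>face_measure i 0)"
    unfolding face_measure_eq by (subst nn_integral_distr) simp_all
  also have "\<dots> = (\<integral>\<^sup>+z. indicator A (fst z + snd z *\<^sub>R i) \<partial>(face_measure i 0 \<Otimes>\<^sub>M
      unit_interval_measure))"
    by (subst unit_interval.nn_integral_fst[symmetric]) simp_all
  also have "\<dots> = (\<integral>\<^sup>+x. indicator A x \<partial>distr (face_measure i 0 \<Otimes>\<^sub>M unit_interval_measure) borel (\<lambda>(x,
      t). x + t *\<^sub>R i))"
    by (subst nn_integral_distr) (simp_all add: case_prod_beta)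
  also have "\<dots> = emeasure (distr (face_measure i 0 \<Otimes>\<^sub>M unit_interval_measure) borel (\<lambda>(x, t). x
      + t *\<^sub>R i)) A"
    by (rule nn_integral_indicator) simp
  finally show "emeasure cube_borel A = \<dots>" .
qed simp

lemma AE_cube_borel: "AE x in cube_borel. x \<in> unit_cube"
  unfolding cube_borel_def by (subst AE_density) (auto simp: indicator_def)

lemma AE_face_cube:
  assumes "i \<in> Basis" "c \<in> {0, 1}"
  shows "AE x in face_measure i c. x \<in> unit_cube"
  using AE_face_relint[OF assms(1), of c] 
proof eventually_elim
  case (elim x)
  have "0 \<le> x \<bullet> j \<and> x \<bullet> j \<le> 1" if "j \<in> Basis" for j
    using elim that assms(2) by (cases "j = i") (auto simp: less_imp_le)
  then show ?case by (simp add: mem_unit_cube)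
qed

subsection \<open>Integration over the boundary\<close>

text \<open>\<open>bdry_measure\<close> is specified only through its values on sets, as a sum over
  the faces. The usual induction over measurable functions lifts that sum to integrals.\<close>

lemma nn_integral_sum_measure:
  fixes f :: "'a \<Rightarrow> ennreal"
  assumes "finite K" "\<And>k. k \<in> K \<Longrightarrow> sets (M k) = sets N"
    and em: "\<And>A. A \<in> sets N \<Longrightarrow> emeasure N A = (\<Sum>k\<in>K. emeasure (M k) A)"
    and f: "f \<in> borel_measurable N"
  shows "(\<integral>\<^sup>+x. f x \<partial>N) = (\<Sum>k\<in>K. \<integral>\<^sup>+x. f x \<partial>M k)"
proof -
  have meas: "borel_measurable (M k) = (borel_measurable N :: ('a \<Rightarrow> ennreal) set)" if "k \<in> K" for k
    using assms(2)[OF that] by (rule measurable_cong_sets) simp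
  from f show ?thesis
  proof (induction rule: borel_measurable_induct)
    case (cong f g)
    moreover have "space (M k) = space N" if "k \<in> K" for k
      using assms(2)[OF that] by (rule sets_eq_imp_space_eq)
    ultimately show ?case
      by (auto intro!: sum.cong nn_integral_cong simp: nn_integral_cong[of N f g])
  next
    case (set A)
    then show ?case using em assms(2) by simp
  next
    case (mult u c)
    then have "(\<integral>\<^sup>+x. c * u x \<partial>M k) = c * (\<integral>\<^sup>+x. u x \<partial>M k)" if "k \<in> K" for k
      using meas[OF that] by (intro nn_integral_cmult) simp
    with mult show ?case by (simp add: nn_integral_cmult sum_distrib_left)
  next
    case (add u v)
    then have "(\<integral>\<^sup>+x. v x + u x \<partial>M k) = (\<integral>\<^sup>+x. v x \<partial>M k) + (\<integral>\<^sup>+x. u x \<partial>M k)"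
      if "k \<in> K" for k
      using meas[OF that] by (intro nn_integral_add) simp_all
    with add show ?case by (simp add: nn_integral_add sum.distrib)
  next
    case (seq U)
    have "(\<integral>\<^sup>+x. (SUP i. U i x) \<partial>N) = (SUP i. \<integral>\<^sup>+x. U i x \<partial>N)"
      using seq by (intro nn_integral_monotone_convergence_SUP) auto
    also have "\<dots> = (SUP i. \<Sum>k\<in>K. \<integral>\<^sup>+x. U i x \<partial>M k)"
      using seq by simp
    also have "\<dots> = (\<Sum>k\<in>K. SUP i. \<integral>\<^sup>+x. U i x \<partial>M k)"
      using seq by (intro ennreal_SUP_sum) (auto simp: incseq_def le_fun_def intro!:
          nn_integral_mono)
    also have "\<dots> = (\<Sum>k\<in>K. \<integral>\<^sup>+x. (SUP i. U i x) \<partial>M k)"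
      using seq meas by (intro sum.cong refl nn_integral_monotone_convergence_SUP[symmetric]) auto
    finally show ?case by (simp add: image_comp)
  qed
qed

lemma
  fixes f :: "'a \<Rightarrow> real"
  assumes K: "finite K" "\<And>k. k \<in> K \<Longrightarrow> sets (M k) = sets N"
    and em: "\<And>A. A \<in> sets N \<Longrightarrow> emeasure N A = (\<Sum>k\<in>K. emeasure (M k) A)"
    and f: "f \<in> borel_measurable N"
  shows integrable_sum_measure: "integrable N f \<longleftrightarrow> (\<forall>k\<in>K. integrable (M k) f)"
    and integral_sum_measure: "integrable N f \<Longrightarrow> (LINT x|N. f x) = (\<Sum>k\<in>K. LINT x|M k. f x)"
proof -
  have meas: "borel_measurable (M k) = (borel_measurable N :: ('a \<Rightarrow> real) set)" if "k \<in> K" for k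
    using K(2)[OF that] by (rule measurable_cong_sets) simp
  note nn = nn_integral_sum_measure[OF K em]
  show *: "integrable N f \<longleftrightarrow> (\<forall>k\<in>K. integrable (M k) f)"
    using f meas K(1) by (auto simp: integrable_iff_bounded nn ennreal_sum_less_top)
  assume int: "integrable N f"
  \<comment> \<open>Finiteness of the integrals of both parts (s = 1 and s = -1) lets
    \<open>enn2real\<close> commute with the sum over K.\<close>
  have fin: "(\<integral>\<^sup>+x. ennreal (s * f x) \<partial>M k) < top" if "k \<in> K" "s \<in> {-1, 1}" for k s
  proof -
    have "(\<integral>\<^sup>+x. ennreal (s * f x) \<partial>M k) \<le> (\<integral>\<^sup>+x. ennreal (norm (f x)) \<partial>M k)"
      using that(2) by (intro nn_integral_mono ennreal_leI) auto
    also have "\<dots> < top" using * int that by (auto simp: integrable_iff_bounded)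
    finally show ?thesis .
  qed
  have "(LINT x|N. f x) = enn2real (\<Sum>k\<in>K. \<integral>\<^sup>+x. f x \<partial>M k) - enn2real (\<Sum>k\<in>K. \<integral>\<^sup>+x. - f x \<partial>M k)"
    using f by (simp add: real_lebesgue_integral_def[OF int] nn)
  also have "\<dots> = (\<Sum>k\<in>K. LINT x|M k. f x)"
    using * int fin[of _ 1] fin[of _ "-1"]
    by (simp add: real_lebesgue_integral_def enn2real_sum sum_subtractf)
  finally show "(LINT x|N. f x) = (\<Sum>k\<in>K. LINT x|M k. f x)" .
qed

text \<open>A face is encoded as a pair (i, c), turning the double sum over directions and sides
  into one sum over a finite index set.\<close>

lemma bdry_measure_index:
  defines "K \<equiv> (Basis :: 'a::euclidean_space set) \<times> {0, 1 :: real}"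
  shows "finite K" "\<And>k. k \<in> K \<Longrightarrow> sets (case_prod face_measure k) = sets (bdry_measure :: 'a measure)"
    "\<And>A. A \<in> sets (bdry_measure :: 'a measure) \<Longrightarrow>
       emeasure bdry_measure A = (\<Sum>k\<in>K. emeasure (case_prod face_measure k) A)"
  by (auto simp: K_def emeasure_bdry_measure sum.cartesian_product case_prod_unfold simp del:
      sum.insert)

lemma integral_bdry_measure:
  fixes f :: "'a::euclidean_space \<Rightarrow> real"
  assumes "integrable bdry_measure f"
  shows "(LINT x|bdry_measure. f x) = (\<Sum>i\<in>Basis. \<Sum>c\<in>{0, 1}. LINT x|face_measure i c. f x)"
  using integral_sum_measure[OF bdry_measure_index borel_measurable_integrable[OF assms] assms]
  by (simp add: sum.cartesian_product case_prod_unfold del: sum.insert)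

global_interpretation bdry: finite_measure "bdry_measure :: 'a::euclidean_space measure"
  by standard (simp add: emeasure_bdry_measure emeasure_face_measure_UNIV ennreal_mult_eq_top_iff)

lemma AE_bdry_measure:
  assumes "Measurable.pred borel P"
    "\<And>i c. i \<in> Basis \<Longrightarrow> c \<in> {0, 1} \<Longrightarrow> AE x in face_measure i c. P x"
  shows "AE x in bdry_measure. P x"
proof (rule AE_I[of _ _ "{x. \<not> P x}"])
  have meas: "{x. \<not> P x} \<in> sets borel" using assms(1) by measurable
  have "emeasure (face_measure i c) {x. \<not> P x} = 0" if "i \<in> Basis" "c \<in> {0, 1}" for i c
    using assms(2)[OF that] meas by (subst (asm) AE_iff_measurable[OF _ refl]) auto
  then show "emeasure bdry_measure {x. \<not> P x} = 0"
    using meas by (simp add: emeasure_bdry_measure)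
qed (use assms(1) in auto)

lemma AE_bdry_cube: "AE x in bdry_measure. x \<in> unit_cube"
  by (rule AE_bdry_measure) (auto intro: AE_face_cube)

text \<open>Stated for any finite Borel measure concentrated on the cube, so that it covers the
  cube, each face, the whole boundary and the unit interval alike.\<close>

lemma continuous_integrable:
  fixes f :: "'a::euclidean_space \<Rightarrow> real"
  assumes M: "finite_measure M" "sets M = sets borel" "AE x in M. x \<in> unit_cube"
    and f: "continuous_on UNIV f"
  shows "integrable M f"
proof -
  have "compact (f ` unit_cube)"
    using f compact_unit_cube by (meson compact_continuous_image continuous_on_subset subset_UNIV)
  then obtain B where B: "\<And>x. x \<in> unit_cube \<Longrightarrow> \<bar>f x\<bar> \<le> B"
    using compact_imp_bounded[of "f ` unit_cube"] by (auto simp: bounded_real)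
  show ?thesis
  proof (rule finite_measure.integrable_const_bound[OF M(1)])
    show "AE x in M. norm (f x) \<le> B" using M(3) by eventually_elim (use B in auto)
    show "f \<in> borel_measurable M"
      using borel_measurable_continuous_onI[OF f] M(2) by (simp cong: measurable_cong_sets)
  qed
qed

lemma continuous_L2:
  fixes f :: "'a::euclidean_space \<Rightarrow> real"
  assumes M: "finite_measure M" "sets M = sets borel" "AE x in M. x \<in> unit_cube"
    and f: "continuous_on UNIV f"
  shows "L2 M f"
  unfolding L2_def
  using continuous_integrable[OF M, of "\<lambda>x. (f x)\<^sup>2"] continuous_integrable[OF M f] f
  by (auto intro!: continuous_intros)

lemmas continuous_integrable_cube =
  continuous_integrable[OF cube_borel.finite_measure_axioms sets_cube_borel AE_cube_borel]
lemmas continuous_integrable_face =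
  continuous_integrable[OF face.finite_measure_axioms sets_face_measure AE_face_cube]
lemmas continuous_integrable_bdry =
  continuous_integrable[OF bdry.finite_measure_axioms sets_bdry_measure AE_bdry_cube]
lemmas continuous_L2_cube =
  continuous_L2[OF cube_borel.finite_measure_axioms sets_cube_borel AE_cube_borel]
lemmas continuous_L2_bdry =
  continuous_L2[OF bdry.finite_measure_axioms sets_bdry_measure AE_bdry_cube]

section \<open>One-dimensional inequalities on the unit interval\<close>

lemma AE_unit_interval: "AE t in unit_interval_measure. t \<in> {0..1}"
  unfolding unit_interval_measure_def by (subst AE_density) (auto simp: indicator_def)

lemma continuous_L2_unit_interval:
  assumes "continuous_on UNIV h"
  shows "L2 unit_interval_measure h"
  using continuous_L2[OF unit_interval.finite_measure_axioms, of h] assms AE_unit_interval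
  by (simp add: unit_cube_def)

lemma continuous_integrable_unit_interval:
  fixes h :: "real \<Rightarrow> real"
  assumes "continuous_on UNIV h"
  shows "integrable unit_interval_measure h"
  using continuous_integrable[OF unit_interval.finite_measure_axioms, of h] assms AE_unit_interval
  by (simp add: unit_cube_def)

lemma integral_unit_interval_measure:
  fixes h :: "real \<Rightarrow> real"
  assumes "h \<in> borel_measurable borel"
  shows "(LINT t|unit_interval_measure. h t) = (LINT t|lborel. indicator {0..1} t * h t)"
  unfolding unit_interval_measure_def ennreal_indicator[symmetric]
  using assms by (subst integral_density) auto

text \<open>Cauchy-Schwarz against the constant 1, whose norm is 1 on a probability space.\<close>

lemma unit_interval_jensen:
  assumes h: "L2 unit_interval_measure h"
  shows "(LINT t|unit_interval_measure. h t)\<^sup>2 \<le> (LINT t|unit_interval_measure. (h t)\<^sup>2)"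
proof -
  have 1: "L2 unit_interval_measure (\<lambda>t. 1)" by (rule continuous_L2_unit_interval) simp
  have "L2_norm unit_interval_measure (\<lambda>t. 1 :: real) = 1"
    by (simp add: L2_norm_def measure_def emeasure_unit_interval_measure)
  then have "\<bar>LINT t|unit_interval_measure. h t\<bar> \<le> L2_norm unit_interval_measure h"
    using L2_Cauchy_Schwarz[OF h 1] by (simp add: L2_inner_def)
  then have "\<bar>LINT t|unit_interval_measure. h t\<bar>\<^sup>2 \<le> (L2_norm unit_interval_measure h)\<^sup>2"
    by (rule power_mono) simp
  then show ?thesis by (simp add: L2_norm_sq_eq)
qed

lemma DERIV_imp_continuous_on:
  "(\<And>t. (h has_real_derivative h' t) (at t)) \<Longrightarrow> continuous_on UNIV h"
  by (meson DERIV_isCont continuous_at_imp_continuous_on)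

lemma unit_interval_FTC:
  assumes h: "\<And>t. (h has_real_derivative h' t) (at t)" "continuous_on UNIV h'"
    and s: "0 \<le> s" "s \<le> 1"
  shows "(LINT t|unit_interval_measure. indicator {0..s} t * h' t) = h s - h 0"
proof -
  have [measurable]: "h' \<in> borel_measurable borel"
    by (rule borel_measurable_continuous_onI[OF h(2)])
  have "(LINT t|unit_interval_measure. indicator {0..s} t * h' t)
      = (LINT t|lborel. indicator {0..1} t * (indicator {0..s} t * h' t))"
    by (rule integral_unit_interval_measure) measurable
  also have "\<dots> = (LINT t|lborel. indicator {0..s} t *\<^sub>R h' t)"
    using s by (intro Bochner_Integration.integral_cong) (auto simp: indicator_def)
  also have "\<dots> = h s - h 0"
    using h s
    by (intro integral_FTC_atLeastAtMost)
      (auto intro: continuous_on_subset has_vector_derivative_at_within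
        simp: has_real_derivative_iff_has_vector_derivative)
  finally show ?thesis .
qed

lemma unit_interval_FTC1:
  assumes h: "\<And>t. (h has_real_derivative h' t) (at t)" "continuous_on UNIV h'"
  shows "(LINT t|unit_interval_measure. h' t) = h 1 - h 0"
proof -
  have "(LINT t|unit_interval_measure. h' t) = (LINT t|unit_interval_measure. indicator {0..1} t *
      h' t)"
  proof (rule integral_cong_AE)
    show "AE t in unit_interval_measure. h' t = indicator {0..1} t * h' t"
      using AE_unit_interval by eventually_elim (simp add: indicator_def)
  qed (use borel_measurable_continuous_onI[OF h(2)] in measurable)
  then show ?thesis using unit_interval_FTC[OF h, of 1] by simp
qed

lemma two_squares: "(a + b)\<^sup>2 \<le> 2 * a\<^sup>2 + 2 * b\<^sup>2" for a b :: real
  using zero_le_power2[of "a - b"] by (simp add: power2_sum power2_diff)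

text \<open>The weight \<open>t - (1 - c)\<close> makes the boundary term at the opposite end point vanish.\<close>

lemma unit_interval_trace:
  assumes h: "\<And>t. (h has_real_derivative h' t) (at t)" "continuous_on UNIV h'"
    and c: "c \<in> {0, 1}"
  shows "(h c)\<^sup>2 \<le> (LINT t|unit_interval_measure. 2 * (h t)\<^sup>2 + 2 * (h' t)\<^sup>2)"
proof -
  have ch: "continuous_on UNIV h" by (rule DERIV_imp_continuous_on[OF h(1)])
  let ?k = "\<lambda>t. h t + (t - (1 - c)) * h' t"
  have ck: "continuous_on UNIV ?k" using ch h(2) by (intro continuous_intros)
  have "(LINT t|unit_interval_measure. ?k t) = (1 - (1 - c)) * h 1 - (0 - (1 - c)) * h 0"
    by (rule unit_interval_FTC1[OF _ ck]) (auto intro!: derivative_eq_intros h)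
  also have "\<dots> = h c" using c by auto
  finally have "(h c)\<^sup>2 \<le> (LINT t|unit_interval_measure. (?k t)\<^sup>2)"
    using unit_interval_jensen[OF continuous_L2_unit_interval[OF ck]] by simp
  also have "\<dots> \<le> (LINT t|unit_interval_measure. 2 * (h t)\<^sup>2 + 2 * (h' t)\<^sup>2)"
  proof (rule integral_mono_AE)
    show "AE t in unit_interval_measure. (?k t)\<^sup>2 \<le> 2 * (h t)\<^sup>2 + 2 * (h' t)\<^sup>2"
      using AE_unit_interval
    proof eventually_elim
      case (elim t)
      then have "\<bar>t - (1 - c)\<bar> \<le> 1" using c by auto
      then have "(t - (1 - c))\<^sup>2 \<le> 1" using abs_square_le_1 by blast
      then have "((t - (1 - c)) * h' t)\<^sup>2 \<le> (h' t)\<^sup>2"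
        by (simp add: power_mult_distrib mult_left_le_one_le)
      then show ?case using two_squares[of "h t" "(t - (1 - c)) * h' t"] by linarith
    qed
  qed (intro continuous_integrable_unit_interval continuous_intros ck ch h(2))+
  finally show ?thesis .
qed

text \<open>Write h s as h 0 plus the integral of h' over [0, s]. The resulting bound does not
  depend on s, so integrating over s costs nothing.\<close>

lemma unit_interval_friedrichs:
  assumes h: "\<And>t. (h has_real_derivative h' t) (at t)" "continuous_on UNIV h'"
  shows "(LINT t|unit_interval_measure. (h t)\<^sup>2) \<le> 2 * (h 0)\<^sup>2
      + 2 * (LINT t|unit_interval_measure. (h' t)\<^sup>2)"
    (is "_ \<le> ?R")
proof -
  have ch: "continuous_on UNIV h" by (rule DERIV_imp_continuous_on[OF h(1)])
  have L: "L2 unit_interval_measure h'" by (rule continuous_L2_unit_interval[OF h(2)])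
  have "(h s)\<^sup>2 \<le> ?R" if s: "s \<in> {0..1}" for s
  proof -
    note ib = L2_mult_bounded[OF L, of "indicator {0..s}"]
    have "(h s - h 0)\<^sup>2 \<le> (LINT t|unit_interval_measure. (indicator {0..s} t * h' t)\<^sup>2)"
      using unit_interval_FTC[OF h, of s] s unit_interval_jensen[OF ib(1)]
      by (simp add: indicator_def)
    also have "\<dots> = (L2_norm unit_interval_measure (\<lambda>t. indicator {0..s} t * h' t))\<^sup>2"
      by (simp add: L2_norm_sq_eq)
    also have "\<dots> \<le> (L2_norm unit_interval_measure h')\<^sup>2"
      using ib(2) by (intro power_mono) (auto simp: indicator_def)
    finally show ?thesis using two_squares[of "h 0" "h s - h 0"]
      by (simp add: L2_norm_sq_eq)
  qed
  then have "AE t in unit_interval_measure. (h t)\<^sup>2 \<le> ?R"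
    using AE_unit_interval by (auto elim: eventually_mono)
  then have "(LINT t|unit_interval_measure. (h t)\<^sup>2) \<le> (LINT t|unit_interval_measure. ?R)"
    by (intro integral_mono_AE continuous_integrable_unit_interval continuous_intros ch)
  then show ?thesis by (simp add: measure_def emeasure_unit_interval_measure)
qed

section \<open>From segments to the cube\<close>

lemma has_derivative_line:
  fixes u :: "'a::euclidean_space \<Rightarrow> real"
  assumes "\<And>x. u differentiable (at x)"
  shows "((\<lambda>t. u (x + t *\<^sub>R v)) has_real_derivative (\<Sum>i\<in>Basis. (v \<bullet> i) * pderiv_at i u (x
      + t *\<^sub>R v))) (at t)"
proof -
  have "((\<lambda>t. u (x + t *\<^sub>R v)) has_derivative
      (\<lambda>s. \<Sum>i\<in>Basis. ((s *\<^sub>R v) \<bullet> i) * pderiv_at i u (x + t *\<^sub>R v))) (at t)"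
    by (rule has_derivative_compose[where g = u, OF _ has_derivative_pderiv_at[OF assms]])
      (auto intro!: derivative_eq_intros)
  moreover have "(\<lambda>s. \<Sum>i\<in>Basis. ((s *\<^sub>R v) \<bullet> i) * pderiv_at i u (x + t *\<^sub>R v))
      = (*) (\<Sum>i\<in>Basis. (v \<bullet> i) * pderiv_at i u (x + t *\<^sub>R v))"
    by (simp add: fun_eq_iff sum_distrib_left mult_ac)
  ultimately show ?thesis by (simp add: has_field_derivative_def)
qed

lemma has_derivative_line_Basis:
  fixes u :: "'a::euclidean_space \<Rightarrow> real"
  assumes "\<And>x. u differentiable (at x)" and i: "i \<in> Basis"
  shows "((\<lambda>t. u (x + t *\<^sub>R i)) has_real_derivative pderiv_at i u (x + t *\<^sub>R i)) (at t)"
  using has_derivative_line[OF assms(1), of x i t] i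
  by (simp add: inner_Basis if_distrib[of "\<lambda>a. a * _"] sum.delta cong: if_cong)

lemma integral_cube_fiber:
  fixes f :: "'a::euclidean_space \<Rightarrow> real"
  assumes f: "continuous_on UNIV f" and i: "i \<in> Basis"
  shows "(LINT x|cube_borel. f x) = (LINT x|face_measure i 0. LINT t|unit_interval_measure. f (x
      + t *\<^sub>R i))"
    and "integrable (face_measure i 0) (\<lambda>x. LINT t|unit_interval_measure. f (x + t *\<^sub>R i))"
proof -
  have [measurable]: "f \<in> borel_measurable borel" by (rule borel_measurable_continuous_onI[OF f])
  interpret pair_sigma_finite "face_measure i 0" unit_interval_measure by standard
  have int: "integrable (face_measure i 0 \<Otimes>\<^sub>M unit_interval_measure) (\<lambda>(x, t). f (x + t *\<^sub>R i))"
    using continuous_integrable_cube[OF f] unfolding cube_borel_fiber[OF i]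
    by (subst (asm) integrable_distr_eq) (simp_all add: case_prod_unfold)
  show "(LINT x|cube_borel. f x) = (LINT x|face_measure i 0. LINT t|unit_interval_measure. f (x
      + t *\<^sub>R i))"
    using integral_fst'[OF int] unfolding cube_borel_fiber[OF i]
    by (simp add: integral_distr case_prod_unfold)
  show "integrable (face_measure i 0) (\<lambda>x. LINT t|unit_interval_measure. f (x + t *\<^sub>R i))"
    using integrable_fst'[OF int] by simp
qed

lemma integral_face_shift:
  fixes f :: "'a::euclidean_space \<Rightarrow> real"
  assumes f: "continuous_on UNIV f"
  shows "(LINT x|face_measure i c. f x) = (LINT x|face_measure i 0. f (x + c *\<^sub>R i))"
  using borel_measurable_continuous_onI[OF f]
  by (subst face_measure_shift) (simp add: integral_distr)

lemma C_k_1D: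
  assumes "C_k 1 u"
  shows "\<And>x. u differentiable (at x)" "\<And>i S. i \<in> Basis \<Longrightarrow> continuous_on S (pderiv_at i u)"
    "\<And>S. continuous_on S u"
  using assms C_k_imp_continuous[OF assms] by (auto intro: continuous_on_subset)

lemma continuous_shift:
  "continuous_on UNIV f \<Longrightarrow> continuous_on UNIV (\<lambda>x. f (x + a))"
  "continuous_on UNIV f \<Longrightarrow> continuous_on UNIV (\<lambda>t. f (x + t *\<^sub>R v))"
  for f :: "'a::euclidean_space \<Rightarrow> real"
  by (auto intro!: continuous_on_compose2[of UNIV f] continuous_intros)

text \<open>The fundamental theorem of calculus on every segment in direction i, integrated over the
  base face. One coordinate at a time is enough, since each use has a derivative in a single
  direction.\<close>

theorem divergence_cube:
  fixes w :: "'a::euclidean_space \<Rightarrow> real"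
  assumes w: "C_k 1 w" and i: "i \<in> Basis"
  shows "(LINT x|cube_borel. pderiv_at i w x)
    = (LINT x|face_measure i 1. w x) - (LINT x|face_measure i 0. w x)"
proof -
  note cw = C_k_1D[OF w]
  have "(LINT x|cube_borel. pderiv_at i w x)
      = (LINT x|face_measure i 0. LINT t|unit_interval_measure. pderiv_at i w (x + t *\<^sub>R i))"
    by (rule integral_cube_fiber(1)[OF cw(2)[OF i] i])
  also have "\<dots> = (LINT x|face_measure i 0. w (x + 1 *\<^sub>R i) - w (x + 0 *\<^sub>R i))"
    by (intro Bochner_Integration.integral_cong refl
        unit_interval_FTC1[OF has_derivative_line_Basis[OF cw(1) i] continuous_shift(2)[OF cw(2)[OF
            i]]])
  also have "\<dots> = (LINT x|face_measure i 0. w (x + 1 *\<^sub>R i)) - (LINT x|face_measure i 0. w (x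
      + 0 *\<^sub>R i))"
    by (intro Bochner_Integration.integral_diff continuous_integrable_face i continuous_shift cw)
        auto
  also have "\<dots> = (LINT x|face_measure i 1. w x) - (LINT x|face_measure i 0. w x)"
    by (simp only: integral_face_shift[OF cw(3), symmetric])
  finally show ?thesis .
qed

text \<open>The one-dimensional trace estimate on the segments orthogonal to the face; hence only
  the derivative in the normal direction enters.\<close>

lemma face_trace_le:
  fixes u :: "'a::euclidean_space \<Rightarrow> real"
  assumes u: "C_k 1 u" and i: "i \<in> Basis" and c: "c \<in> {0, 1}"
  shows "(LINT x|face_measure i c. (u x)\<^sup>2)
    \<le> 2 * (LINT x|cube_borel. (u x)\<^sup>2) + 2 * (LINT x|cube_borel. (pderiv_at i u x)\<^sup>2)"
proof -
  note cu = C_k_1D[OF u]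
  have cont: "continuous_on UNIV (\<lambda>x. 2 * (u x)\<^sup>2 + 2 * (pderiv_at i u x)\<^sup>2)"
    using cu(2)[OF i] cu(3) by (intro continuous_intros)
  have "(LINT x|face_measure i c. (u x)\<^sup>2) = (LINT x|face_measure i 0. (u (x + c *\<^sub>R i))\<^sup>2)"
    using cu(3) by (intro integral_face_shift continuous_intros)
  also have "\<dots> \<le> (LINT x|face_measure i 0. LINT t|unit_interval_measure.
      2 * (u (x + t *\<^sub>R i))\<^sup>2 + 2 * (pderiv_at i u (x + t *\<^sub>R i))\<^sup>2)"
    by (intro integral_mono continuous_integrable_face i integral_cube_fiber(2)[OF cont i]
        unit_interval_trace has_derivative_line_Basis cu continuous_shift c
        continuous_on_power) auto
  also have "\<dots> = (LINT x|cube_borel. 2 * (u x)\<^sup>2 + 2 * (pderiv_at i u x)\<^sup>2)"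
    by (rule integral_cube_fiber(1)[OF cont i, symmetric])
  also have "\<dots> = 2 * (LINT x|cube_borel. (u x)\<^sup>2) + 2 * (LINT x|cube_borel. (pderiv_at i u x)\<^sup>2)"
    using cu(2)[OF i] cu(3)
    by (simp add: continuous_integrable_cube continuous_on_power)
  finally show ?thesis .
qed

text \<open>Again the one-dimensional inequality on orthogonal segments, started from the face at 0:
  control on one face and of one derivative suffices.\<close>

lemma cube_friedrichs:
  fixes u :: "'a::euclidean_space \<Rightarrow> real"
  assumes u: "C_k 1 u" and i: "i \<in> Basis"
  shows "(LINT x|cube_borel. (u x)\<^sup>2)
    \<le> 2 * (LINT x|face_measure i 0. (u x)\<^sup>2) + 2 * (LINT x|cube_borel. (pderiv_at i u x)\<^sup>2)"
proof -
  note cu = C_k_1D[OF u]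
  have cont: "continuous_on UNIV (\<lambda>x. (u x)\<^sup>2)" "continuous_on UNIV (\<lambda>x. (pderiv_at i u x)\<^sup>2)"
    using cu(2)[OF i] cu(3) by (intro continuous_intros; simp)+
  have "(LINT x|cube_borel. (u x)\<^sup>2)
      = (LINT x|face_measure i 0. LINT t|unit_interval_measure. (u (x + t *\<^sub>R i))\<^sup>2)"
    by (rule integral_cube_fiber(1)[OF cont(1) i])
  also have "\<dots> \<le> (LINT x|face_measure i 0. 2 * (u (x + 0 *\<^sub>R i))\<^sup>2
      + 2 * (LINT t|unit_interval_measure. (pderiv_at i u (x + t *\<^sub>R i))\<^sup>2))"
    by (intro integral_mono integral_cube_fiber(2)[OF cont(1) i]
        Bochner_Integration.integrable_add integrable_mult_right integral_cube_fiber(2)[OF cont(2)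
            i]
        continuous_integrable_face i unit_interval_friedrichs has_derivative_line_Basis cu
        continuous_shift continuous_on_power) auto
  also have "\<dots> = 2 * (LINT x|face_measure i 0. (u x)\<^sup>2)
      + 2 * (LINT x|face_measure i 0. LINT t|unit_interval_measure. (pderiv_at i u (x + t *\<^sub>R i))\<^sup>2)"
    using continuous_integrable_face[OF i, of 0, OF _ cont(1)] integral_cube_fiber(2)[OF cont(2) i]
    by simp
  finally show ?thesis using integral_cube_fiber(1)[OF cont(2) i] by simp
qed

subsection \<open>The Poincare inequality\<close>

lemma measure_cube_borel_UNIV: "measure (cube_borel :: 'a::euclidean_space measure) UNIV = 1"
  by (simp add: measure_def emeasure_cube_borel_UNIV)

text \<open>Change of variables z = b + a x. The Jacobian a^d is at least 2^(-d), and the image of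
  the cube stays inside the cube.\<close>

lemma nn_integral_cube_affine_le:
  fixes F :: "'a::euclidean_space \<Rightarrow> ennreal"
  assumes F: "F \<in> borel_measurable borel" and a: "1 / 2 \<le> a"
    and sub: "\<And>x. x \<in> unit_cube \<Longrightarrow> b + a *\<^sub>R x \<in> unit_cube"
  shows "(\<integral>\<^sup>+x. F (b + a *\<^sub>R x) \<partial>cube_borel) \<le> 2 ^ DIM('a) * (\<integral>\<^sup>+x. F x \<partial>cube_borel)"
proof -
  note F[measurable]
  let ?F = "\<lambda>x. indicator unit_cube x * F x"
  have a0: "a > 0" using a by simp
  have "1 \<le> (2 * a) ^ DIM('a)" using a by (intro one_le_power) simp
  \<comment> \<open>This factor is at least 1 and can be inserted freely; its second part then
    cancels against the Jacobian.\<close>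
  then have one: "(1 :: ennreal) \<le> 2 ^ DIM('a) * ennreal (a ^ DIM('a))"
    using a0 by (simp add: power_mult_distrib ennreal_power ennreal_leI
        flip: ennreal_numeral ennreal_1 ennreal_mult)
  have "(\<integral>\<^sup>+x. F (b + a *\<^sub>R x) \<partial>cube_borel) = (\<integral>\<^sup>+x. indicator unit_cube x * F (b + a *\<^sub>R x) \<partial>lborel)"
    by (simp add: cube_borel_def nn_integral_density)
  also have "\<dots> \<le> (\<integral>\<^sup>+x. ?F (b + a *\<^sub>R x) \<partial>lborel)"
    by (intro nn_integral_mono) (use sub in \<open>auto simp: indicator_def\<close>)
  also have "\<dots> \<le> (2 ^ DIM('a) * ennreal (a ^ DIM('a))) * (\<integral>\<^sup>+x. ?F (b + a *\<^sub>R x) \<partial>lborel)"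
    using mult_right_mono[OF one] by simp
  also have "\<dots> = 2 ^ DIM('a) * (\<integral>\<^sup>+x. ennreal (a ^ DIM('a)) * ?F (b + a *\<^sub>R x) \<partial>lborel)"
    by (simp add: nn_integral_cmult mult.assoc)
  also have "(\<integral>\<^sup>+x. ennreal (a ^ DIM('a)) * ?F (b + a *\<^sub>R x) \<partial>lborel) = (\<integral>\<^sup>+x. ?F x \<partial>lborel)"
    using a0 by (subst (2) lborel_affine[of a b]) (simp_all add: nn_integral_density
        nn_integral_distr)
  also have "\<dots> = (\<integral>\<^sup>+x. F x \<partial>cube_borel)"
    by (simp add: cube_borel_def nn_integral_density)
  finally show ?thesis .
qed

lemma convex_unit_cube:
  "x \<in> unit_cube \<Longrightarrow> y \<in> unit_cube \<Longrightarrow> 0 \<le> s \<Longrightarrow> s \<le> 1 \<Longrightarrow> (1 - s) *\<^sub>R y + s *\<^sub>R x \<in> unit_cube"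
  using convex_box(1)[of 0 One] unfolding unit_cube_def convex_alt by blast

text \<open>For \<open>s \<ge> 1 / 2\<close> one substitutes in \<open>x\<close>, otherwise in \<open>y\<close>: either way the Jacobian is at
  least \<open>(1 / 2) ^ DIM('a)\<close>.\<close>

lemma segment_nn_integral_le:
  fixes G :: "'a::euclidean_space \<Rightarrow> ennreal"
  assumes G[measurable]: "G \<in> borel_measurable borel"
  shows "(\<integral>\<^sup>+x. \<integral>\<^sup>+y. \<integral>\<^sup>+s. G ((1 - s) *\<^sub>R y + s *\<^sub>R x) \<partial>unit_interval_measure \<partial>cube_borel \<partial>cube_borel)
    \<le> 2 ^ DIM('a) * (\<integral>\<^sup>+x. G x \<partial>cube_borel)" (is "_ \<le> ?R")
proof -
  interpret cc: pair_sigma_finite "cube_borel :: 'a measure" "cube_borel :: 'a measure" by standard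
  interpret cu: pair_sigma_finite "cube_borel :: 'a measure" unit_interval_measure by standard
  have "(\<integral>\<^sup>+x. \<integral>\<^sup>+y. G ((1 - s) *\<^sub>R y + s *\<^sub>R x) \<partial>cube_borel \<partial>cube_borel) \<le> ?R"
    if s: "s \<in> {0..1}" for s
  proof (cases "1 / 2 \<le> s")
    case True
    have "(\<integral>\<^sup>+x. \<integral>\<^sup>+y. G ((1 - s) *\<^sub>R y + s *\<^sub>R x) \<partial>cube_borel \<partial>cube_borel)
        = (\<integral>\<^sup>+y. \<integral>\<^sup>+x. G ((1 - s) *\<^sub>R y + s *\<^sub>R x) \<partial>cube_borel \<partial>cube_borel)"
      by (rule cc.Fubini'[symmetric]) measurable
    also have "\<dots> \<le> (\<integral>\<^sup>+y. ?R \<partial>(cube_borel :: 'a measure))"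
    proof (rule nn_integral_mono_AE)
      show "AE y in cube_borel. (\<integral>\<^sup>+x. G ((1 - s) *\<^sub>R y + s *\<^sub>R x) \<partial>cube_borel) \<le> ?R"
        using AE_cube_borel
        by eventually_elim (use True s in \<open>auto intro!: nn_integral_cube_affine_le
            convex_unit_cube\<close>)
    qed
    also have "\<dots> = ?R" by (simp add: emeasure_cube_borel_UNIV)
    finally show ?thesis .
  next
    case False
    have "(\<integral>\<^sup>+x. \<integral>\<^sup>+y. G ((1 - s) *\<^sub>R y + s *\<^sub>R x) \<partial>cube_borel \<partial>cube_borel) \<le> (\<integral>\<^sup>+x. ?R
        \<partial>(cube_borel :: 'a measure))"
    proof (rule nn_integral_mono_AE)
      show "AE x in cube_borel. (\<integral>\<^sup>+y. G ((1 - s) *\<^sub>R y + s *\<^sub>R x) \<partial>cube_borel) \<le> ?R"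
        using AE_cube_borel
      proof eventually_elim
        case (elim x)
        then show ?case
          using nn_integral_cube_affine_le[OF G, of "1 - s" "s *\<^sub>R x"] convex_unit_cube[of x _ s]
              False s
          by (auto simp: add.commute)
      qed
    qed
    also have "\<dots> = ?R" by (simp add: emeasure_cube_borel_UNIV)
    finally show ?thesis .
  qed
  note bound = this
  have "(\<integral>\<^sup>+x. \<integral>\<^sup>+y. \<integral>\<^sup>+s. G ((1 - s) *\<^sub>R y + s *\<^sub>R x) \<partial>unit_interval_measure \<partial>cube_borel \<partial>cube_borel)
      = (\<integral>\<^sup>+x. \<integral>\<^sup>+s. \<integral>\<^sup>+y. G ((1 - s) *\<^sub>R y + s *\<^sub>R x) \<partial>cube_borel \<partial>unit_interval_measure \<partial>cube_borel)"
    by (intro nn_integral_cong cu.Fubini'[symmetric]) measurable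
  also have "\<dots> = (\<integral>\<^sup>+s. \<integral>\<^sup>+x. \<integral>\<^sup>+y. G ((1 - s) *\<^sub>R y + s *\<^sub>R x) \<partial>cube_borel \<partial>cube_borel
      \<partial>unit_interval_measure)"
    by (intro cu.Fubini'[symmetric]) measurable
  also have "\<dots> \<le> (\<integral>\<^sup>+s. ?R \<partial>unit_interval_measure)"
  proof (rule nn_integral_mono_AE)
    show "AE s in unit_interval_measure.
        (\<integral>\<^sup>+x. \<integral>\<^sup>+y. G ((1 - s) *\<^sub>R y + s *\<^sub>R x) \<partial>cube_borel \<partial>cube_borel) \<le> ?R"
      using AE_unit_interval by eventually_elim (rule bound)
  qed
  also have "\<dots> = ?R" by (simp add: emeasure_unit_interval_measure)
  finally show ?thesis .
qed

text \<open>Fundamental theorem along the segment from y to x, then Jensen and Cauchy-Schwarz. Each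
  component of x - y is at most 1 in modulus on the cube, whence the factor
  \<open>DIM('a)\<close>.\<close>

lemma segment_estimate:
  fixes u :: "'a::euclidean_space \<Rightarrow> real"
  assumes u: "C_k 1 u" and xy: "x \<in> unit_cube" "y \<in> unit_cube"
  defines "G \<equiv> \<lambda>z. real DIM('a) * (\<Sum>i\<in>Basis. (pderiv_at i u z)\<^sup>2)"
  shows "(u x - u y)\<^sup>2 \<le> (LINT s|unit_interval_measure. G ((1 - s) *\<^sub>R y + s *\<^sub>R x))"
proof -
  note cu = C_k_1D[OF u]
  let ?v = "x - y"
  let ?h' = "\<lambda>s. \<Sum>i\<in>Basis. (?v \<bullet> i) * pderiv_at i u (y + s *\<^sub>R ?v)"
  have seg: "(1 - s) *\<^sub>R y + s *\<^sub>R x = y + s *\<^sub>R ?v" for s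
    by (simp add: algebra_simps)
  have cont: "continuous_on UNIV ?h'" "continuous_on UNIV (\<lambda>s. G (y + s *\<^sub>R ?v))"
    unfolding G_def using cu(2) by (intro continuous_intros continuous_shift(2); simp)+
  have "(LINT s|unit_interval_measure. ?h' s) = u (y + 1 *\<^sub>R ?v) - u (y + 0 *\<^sub>R ?v)"
    by (rule unit_interval_FTC1[OF has_derivative_line[OF cu(1)] cont(1)])
  then have "(u x - u y)\<^sup>2 \<le> (LINT s|unit_interval_measure. (?h' s)\<^sup>2)"
    using unit_interval_jensen[OF continuous_L2_unit_interval[OF cont(1)]] by simp
  also have "\<dots> \<le> (LINT s|unit_interval_measure. G (y + s *\<^sub>R ?v))"
  proof (intro integral_mono continuous_integrable_unit_interval cont continuous_on_power)
    fix s
    have "(?h' s)\<^sup>2 \<le> (\<Sum>i\<in>Basis. (?v \<bullet> i)\<^sup>2) * (\<Sum>i\<in>Basis. (pderiv_at i u (y + s *\<^sub>R ?v))\<^sup>2)"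
      by (rule Cauchy_Schwarz_ineq_sum)
    also have "(\<Sum>i\<in>Basis. (?v \<bullet> i)\<^sup>2) \<le> (\<Sum>i\<in>(Basis :: 'a set). 1)"
    proof (rule sum_mono)
      fix i :: 'a assume "i \<in> Basis"
      then have "\<bar>?v \<bullet> i\<bar> \<le> 1" using xy by (fastforce simp: mem_unit_cube inner_diff_left
          abs_le_iff)
      then show "(?v \<bullet> i)\<^sup>2 \<le> 1" using abs_square_le_1 by blast
    qed
    then have "(\<Sum>i\<in>Basis. (?v \<bullet> i)\<^sup>2) * (\<Sum>i\<in>Basis. (pderiv_at i u (y + s *\<^sub>R ?v))\<^sup>2) \<le> G (y + s *\<^sub>R ?v)"
      unfolding G_def by (intro mult_right_mono sum_nonneg) auto
    finally show "(?h' s)\<^sup>2 \<le> G (y + s *\<^sub>R ?v)" .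
  qed
  finally show ?thesis by (simp only: seg)
qed

text \<open>The variance of u is half the double integral of (u x - u y)^2. Each difference is
  estimated along a segment, and averaging over all segments is controlled by
  \<open>segment_nn_integral_le\<close>.\<close>

lemma cube_poincare:
  fixes u :: "'a::euclidean_space \<Rightarrow> real"
  assumes u: "C_k 1 u"
  shows "(LINT x|cube_borel. (u x)\<^sup>2)
    \<le> (LINT x|cube_borel. u x)\<^sup>2 + 2 ^ DIM('a) * real DIM('a) * (\<Sum>i\<in>Basis. LINT x|cube_borel.
        (pderiv_at i u x)\<^sup>2)"
proof -
  note cu = C_k_1D[OF u]
  define G where "G z = real DIM('a) * (\<Sum>i\<in>Basis. (pderiv_at i u z)\<^sup>2)" for z
  define m q where "m = (LINT x|cube_borel. u x)" and "q = (LINT x|cube_borel. (u x)\<^sup>2)"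
  have cG: "continuous_on UNIV G"
    unfolding G_def using cu(2) by (intro continuous_intros; simp)
  have G0: "G z \<ge> 0" for z by (simp add: G_def sum_nonneg)
  have [measurable]: "G \<in> borel_measurable borel" "u \<in> borel_measurable borel"
    using borel_measurable_continuous_onI cG cu(3) by blast+
  note int = continuous_integrable_cube[OF cu(3)]
    continuous_integrable_cube[OF continuous_on_power[OF cu(3)], of 2]
  have y: "(LINT y|cube_borel. (u x - u y)\<^sup>2) = (u x)\<^sup>2 - 2 * m * u x + q" for x
  proof -
    have "(LINT y|cube_borel. (u x - u y)\<^sup>2) = (LINT y|cube_borel. (u x)\<^sup>2 + (u y)\<^sup>2 - 2 * u x * u y)"
      by (simp add: power2_diff)
    also have "\<dots> = (u x)\<^sup>2 - 2 * m * u x + q"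
      using int by (simp add: measure_cube_borel_UNIV m_def q_def)
    finally show ?thesis .
  qed
  \<comment> \<open>Expanding the square; the cube has measure 1, so the double integral is twice
    the variance.\<close>
  have "(LINT x|cube_borel. LINT y|cube_borel. (u x - u y)\<^sup>2) = 2 * q - 2 * m\<^sup>2"
    unfolding y using int by (simp add: measure_cube_borel_UNIV m_def q_def power2_eq_square)
  moreover have "ennreal (LINT x|cube_borel. LINT y|cube_borel. (u x - u y)\<^sup>2)
      = (\<integral>\<^sup>+x. \<integral>\<^sup>+y. ennreal ((u x - u y)\<^sup>2) \<partial>cube_borel \<partial>cube_borel)"
  proof -
    have "ennreal (LINT x|cube_borel. LINT y|cube_borel. (u x - u y)\<^sup>2)
        = (\<integral>\<^sup>+x. ennreal (LINT y|cube_borel. (u x - u y)\<^sup>2) \<partial>cube_borel)"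
    proof (rule nn_integral_eq_integral[symmetric])
      show "integrable cube_borel (\<lambda>x. LINT y|cube_borel. (u x - u y)\<^sup>2)"
        unfolding y using int by simp
    qed simp
    also have "\<dots> = (\<integral>\<^sup>+x. \<integral>\<^sup>+y. ennreal ((u x - u y)\<^sup>2) \<partial>cube_borel \<partial>cube_borel)"
      by (intro nn_integral_cong nn_integral_eq_integral[symmetric] continuous_integrable_cube
          continuous_intros cu) auto
    finally show ?thesis .
  qed
  moreover have "\<dots> \<le> (\<integral>\<^sup>+x. \<integral>\<^sup>+y. \<integral>\<^sup>+s. ennreal (G ((1 - s) *\<^sub>R y + s *\<^sub>R x)) \<partial>unit_interval_measure
      \<partial>cube_borel \<partial>cube_borel)"
  proof (rule nn_integral_mono_AE)
    have "ennreal ((u x - u y)\<^sup>2) \<le> (\<integral>\<^sup>+s. ennreal (G ((1 - s) *\<^sub>R y + s *\<^sub>R x))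
        \<partial>unit_interval_measure)"
      if xy: "x \<in> unit_cube" "y \<in> unit_cube" for x y
    proof -
      have "continuous_on UNIV (\<lambda>s. G ((1 - s) *\<^sub>R y + s *\<^sub>R x))"
        by (intro continuous_on_compose2[OF cG] continuous_intros) auto
      then show ?thesis
        using segment_estimate[OF u xy, folded G_def] G0
        by (subst nn_integral_eq_integral) (auto intro: continuous_integrable_unit_interval
            ennreal_leI)
    qed
    then have *: "AE y in cube_borel. ennreal ((u x - u y)\<^sup>2)
        \<le> (\<integral>\<^sup>+s. ennreal (G ((1 - s) *\<^sub>R y + s *\<^sub>R x)) \<partial>unit_interval_measure)" if "x \<in> unit_cube"
            for x
      using AE_cube_borel that by (auto elim: eventually_mono)
    show "AE x in cube_borel. (\<integral>\<^sup>+y. ennreal ((u x - u y)\<^sup>2) \<partial>cube_borel)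
        \<le> (\<integral>\<^sup>+y. \<integral>\<^sup>+s. ennreal (G ((1 - s) *\<^sub>R y + s *\<^sub>R x)) \<partial>unit_interval_measure \<partial>cube_borel)"
      using AE_cube_borel by eventually_elim (intro nn_integral_mono_AE *)
  qed
  moreover have "\<dots> \<le> 2 ^ DIM('a) * (\<integral>\<^sup>+x. ennreal (G x) \<partial>cube_borel)"
    by (rule segment_nn_integral_le) measurable
  moreover have "\<dots> = ennreal (2 ^ DIM('a) * (LINT x|cube_borel. G x))"
    using continuous_integrable_cube[OF cG] G0
    by (simp add: nn_integral_eq_integral ennreal_mult flip: ennreal_power ennreal_numeral)
  ultimately have "ennreal (2 * q - 2 * m\<^sup>2) \<le> ennreal (2 ^ DIM('a) * (LINT x|cube_borel. G x))"
    by (metis (no_types, lifting) order.trans)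
  moreover have GI: "(LINT x|cube_borel. G x) = real DIM('a) * (\<Sum>i\<in>Basis. LINT x|cube_borel.
      (pderiv_at i u x)\<^sup>2)"
    unfolding G_def using cu(2)
    by (simp add: continuous_integrable_cube continuous_on_power)
  moreover have "0 \<le> 2 ^ DIM('a) * (LINT x|cube_borel. G x)"
    using G0 by simp
  ultimately have "2 * q - 2 * m\<^sup>2 \<le> 2 ^ DIM('a) * (LINT x|cube_borel. G x)"
    by (simp only: ennreal_le_iff)
  \<comment> \<open>Halving would give the better constant; nonnegativity of the integral of
    \<open>G\<close> allows the factor 1/2 to be dropped.\<close>
  moreover have "q \<le> m\<^sup>2 + 2 ^ DIM('a) * (LINT x|cube_borel. G x)"
    if "2 * q - 2 * m\<^sup>2 \<le> 2 ^ DIM('a) * (LINT x|cube_borel. G x)"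
    using that \<open>0 \<le> 2 ^ DIM('a) * (LINT x|cube_borel. G x)\<close> by linarith
  ultimately show ?thesis by (simp add: m_def q_def GI mult.assoc)
qed

section \<open>Mollification\<close>

lemma unit_cube_Int_lebesgue [simp]:
  "unit_cube \<inter> space (lebesgue :: 'a::euclidean_space measure) \<in> sets (lebesgue :: 'a measure)"
  by (simp add: unit_cube_def)

lemma borel_imp_measurable_cube_measure [measurable_dest]:
  "f \<in> borel_measurable borel \<Longrightarrow> f \<in> borel_measurable cube_measure"
  by (intro measurable_restrict_space1 measurable_completion) simp

lemma AE_cube_measure_iff: "(AE x in cube_measure. P x) \<longleftrightarrow> (AE x in lborel. x \<in> unit_cube \<longrightarrow> P x)"
  by (simp add: AE_restrict_space_iff AE_completion_iff)

lemma AE_cube_borel_iff: "(AE x in cube_borel. P x) \<longleftrightarrow> (AE x in lborel. x \<in> unit_cube \<longrightarrow> P x)"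
  unfolding cube_borel_def by (subst AE_density) (auto simp: indicator_def)

lemma
  fixes f :: "'a::euclidean_space \<Rightarrow> real"
  assumes f: "f \<in> borel_measurable borel"
  shows integral_cube_measure_borel: "(LINT x|cube_measure. f x) = (LINT x|cube_borel. f x)"
    and integrable_cube_measure_borel: "integrable cube_measure f \<longleftrightarrow> integrable cube_borel f"
proof -
  have meas: "(\<lambda>x. indicator unit_cube x *\<^sub>R f x) \<in> borel_measurable lborel"
    using f by measurable
  have "(LINT x|cube_measure. f x) = (LINT x|lborel. indicator unit_cube x *\<^sub>R f x)"
    by (simp only: integral_restrict_space[OF unit_cube_Int_lebesgue] integral_completion[OF meas])
  also have "\<dots> = (LINT x|cube_borel. f x)"
    unfolding cube_borel_def ennreal_indicator[symmetric]
    using f by (subst integral_density) auto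
  finally show "(LINT x|cube_measure. f x) = (LINT x|cube_borel. f x)" .
  have "integrable cube_measure f \<longleftrightarrow> integrable lborel (\<lambda>x. indicator unit_cube x *\<^sub>R f x)"
    by (simp only: integrable_restrict_space[OF unit_cube_Int_lebesgue] integrable_completion[OF
        meas])
  also have "\<dots> \<longleftrightarrow> integrable cube_borel f"
    unfolding cube_borel_def ennreal_indicator[symmetric]
    using f by (subst integrable_density) auto
  finally show "integrable cube_measure f \<longleftrightarrow> integrable cube_borel f" .
qed

lemma
  fixes f :: "'a::euclidean_space \<Rightarrow> real"
  assumes f: "f \<in> borel_measurable borel"
  shows L2_cube_measure_borel: "L2 cube_measure f \<longleftrightarrow> L2 cube_borel f"
    and L2_norm_cube_measure_borel: "L2_norm cube_measure f = L2_norm cube_borel f"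
proof -
  have [measurable]: "f \<in> borel_measurable borel" by (rule f)
  have "(\<lambda>x. (f x)\<^sup>2) \<in> borel_measurable borel" by measurable
  note sq = integral_cube_measure_borel[OF this] integrable_cube_measure_borel[OF this]
  show "L2 cube_measure f \<longleftrightarrow> L2 cube_borel f"
    unfolding L2_def sq using f borel_imp_measurable_cube_measure[OF f]
    by (simp cong: measurable_cong_sets)
  show "L2_norm cube_measure f = L2_norm cube_borel f"
    by (simp add: L2_norm_def sq)
qed

text \<open>Elements of the function spaces are merely Lebesgue measurable. Passing to an almost
  everywhere equal Borel function opens the way to Fubini.\<close>

lemma borel_representative:
  fixes f :: "'a::euclidean_space \<Rightarrow> real"
  assumes "f \<in> borel_measurable cube_measure"
  obtains g where "g \<in> borel_measurable borel" "AE x in cube_measure. f x = g x"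
proof -
  have "(\<lambda>x. indicator unit_cube x *\<^sub>R f x) \<in> borel_measurable lebesgue"
    using assms by (simp only: borel_measurable_restrict_space_iff[OF unit_cube_Int_lebesgue])
  then obtain g where g: "g \<in> borel_measurable lborel"
      "AE x in lborel. indicator unit_cube x *\<^sub>R f x = g x"
    using completion_ex_borel_measurable_real by blast
  have "AE x in cube_measure. f x = g x"
    unfolding AE_cube_measure_iff using g(2) by eventually_elim (auto simp: indicator_def)
  with g(1) show ?thesis by (intro that) auto
qed

lemma continuous_L2_cube_measure:
  fixes f :: "'a::euclidean_space \<Rightarrow> real"
  assumes "continuous_on UNIV f"
  shows "L2 cube_measure f"
  using continuous_L2_cube[OF assms] L2_cube_measure_borel[OF borel_measurable_continuous_onI[OF
      assms]]
  by simp

lemma L2_integrable_cube: "L2 cube_measure f \<Longrightarrow> integrable cube_measure f"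
  using L2_mult_integrable[of cube_measure f "\<lambda>x. 1"] continuous_L2_cube_measure[of "\<lambda>x. 1"] by simp

section \<open>Smooth functions of compact support\<close>

text \<open>Unlike for \<open>test_function\<close>, the support may lie anywhere: convolution
  kernels are centred at the origin, a corner of the cube.\<close>

definition smooth_cpt :: "('a::euclidean_space \<Rightarrow> real) \<Rightarrow> bool" where
  "smooth_cpt f \<longleftrightarrow> smooth f \<and> (\<exists>S. compact S \<and> (\<forall>x. x \<notin> S \<longrightarrow> f x = 0))"

lemma smooth_cpt_smooth: "smooth_cpt f \<Longrightarrow> smooth f"
  by (simp add: smooth_cpt_def)

lemma smooth_cpt_pderiv_at: "smooth_cpt f \<Longrightarrow> i \<in> Basis \<Longrightarrow> smooth_cpt (pderiv_at i f)"
  unfolding smooth_cpt_def using pderiv_at_eq_0_outside[OF compact_imp_closed] smooth_pderiv_at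
  by metis

lemma smooth_cpt_bounded:
  assumes "smooth_cpt f"
  obtains B where "B \<ge> 0" "\<And>x. \<bar>f x\<bar> \<le> B"
proof -
  obtain S where S: "compact S" "\<And>x. x \<notin> S \<Longrightarrow> f x = 0"
    using assms by (auto simp: smooth_cpt_def)
  have "bounded (f ` S)"
    using S smooth_imp_continuous[OF smooth_cpt_smooth[OF assms]]
    by (intro compact_imp_bounded compact_continuous_image)
  then obtain B where "\<And>x. x \<in> S \<Longrightarrow> \<bar>f x\<bar> \<le> B" by (auto simp: bounded_real)
  then have "\<bar>f x\<bar> \<le> max 0 B" for x
    using S(2)[of x] by (cases "x \<in> S") (auto simp: le_max_iff_disj)
  then show ?thesis by (intro that[of "max 0 B"]) auto
qed

lemma smooth_cpt_derivs_bounded: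
  assumes "smooth_cpt f"
  obtains B where "B \<ge> 0" "\<And>i x. i \<in> Basis \<Longrightarrow> \<bar>pderiv_at i f x\<bar> \<le> B"
proof -
  have "\<forall>i\<in>Basis. \<exists>B. B \<ge> 0 \<and> (\<forall>x. \<bar>pderiv_at i f x\<bar> \<le> B)"
    using smooth_cpt_bounded[OF smooth_cpt_pderiv_at[OF assms]] by metis
  then obtain B where B: "\<And>i. i \<in> Basis \<Longrightarrow> B i \<ge> 0" "\<And>i x. i \<in> Basis \<Longrightarrow> \<bar>pderiv_at i f x\<bar> \<le> B i"
    by metis
  show ?thesis
  proof (rule that[of "sum B Basis"])
    fix i :: 'a and x assume i: "i \<in> Basis"
    then have "B i \<le> sum B Basis" using B(1) by (intro member_le_sum) auto
    then show "\<bar>pderiv_at i f x\<bar> \<le> sum B Basis" using B(2)[OF i, of x] by linarith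
  qed (use B(1) in \<open>auto intro: sum_nonneg\<close>)
qed

lemma sum_inner_le:
  fixes v :: "'a::euclidean_space"
  assumes "\<And>i. i \<in> Basis \<Longrightarrow> \<bar>p i\<bar> \<le> B"
  shows "\<bar>\<Sum>i\<in>Basis. (v \<bullet> i) * p i\<bar> \<le> (real DIM('a) * B) * norm v"
proof -
  have "\<bar>\<Sum>i\<in>Basis. (v \<bullet> i) * p i\<bar> \<le> (\<Sum>i\<in>(Basis :: 'a set). norm v * B)"
    using assms Basis_le_norm[of _ v]
    by (intro order.trans[OF sum_abs] sum_mono) (simp add: abs_mult mult_mono)
  then show ?thesis by (simp add: mult_ac)
qed

lemma smooth_cpt_lipschitz:
  fixes f :: "'a::euclidean_space \<Rightarrow> real"
  assumes "smooth_cpt f"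
  obtains L where "L \<ge> 0" "\<And>x y. \<bar>f y - f x\<bar> \<le> L * norm (y - x)"
proof -
  obtain B where B: "B \<ge> 0" "\<And>i x. i \<in> Basis \<Longrightarrow> \<bar>pderiv_at i f x\<bar> \<le> B"
    using smooth_cpt_derivs_bounded[OF assms] by blast
  have der: "(f has_derivative (\<lambda>v. \<Sum>i\<in>Basis. (v \<bullet> i) * pderiv_at i f x)) (at x within UNIV)" for x
    using has_derivative_pderiv_at[OF smooth_differentiable[OF smooth_cpt_smooth[OF assms]]] by simp
  have "norm (f y - f x) \<le> (real DIM('a) * B) * norm (y - x)" for x y
    by (rule differentiable_bound[OF convex_UNIV der])
      (auto intro!: onorm_le sum_inner_le B)
  with B(1) show ?thesis by (intro that[of "real DIM('a) * B"]) auto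
qed

text \<open>The quadratic remainder is uniform in x. This uniformity is what later permits
  differentiation under the integral sign by a direct estimate.\<close>

lemma smooth_cpt_taylor:
  fixes f :: "'a::euclidean_space \<Rightarrow> real"
  assumes f: "smooth_cpt f"
  obtains L where "L \<ge> 0"
    "\<And>x v. \<bar>f (x + v) - f x - (\<Sum>i\<in>Basis. (v \<bullet> i) * pderiv_at i f x)\<bar> \<le> L * (norm v)\<^sup>2"
proof -
  have "\<forall>i\<in>Basis. \<exists>L. L \<ge> 0 \<and> (\<forall>x y. \<bar>pderiv_at i f y - pderiv_at i f x\<bar> \<le> L * norm (y - x))"
    using smooth_cpt_lipschitz[OF smooth_cpt_pderiv_at[OF f]] by metis
  then obtain L where L: "\<And>i. i \<in> Basis \<Longrightarrow> L i \<ge> 0"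
      "\<And>i x y. i \<in> Basis \<Longrightarrow> \<bar>pderiv_at i f y - pderiv_at i f x\<bar> \<le> L i * norm (y - x)"
    by metis
  define M where "M = sum L Basis"
  have M: "M \<ge> 0" using L(1) by (auto simp: M_def intro: sum_nonneg)
  have Lip: "\<bar>pderiv_at i f y - pderiv_at i f x\<bar> \<le> M * norm (y - x)" if i: "i \<in> Basis" for i x y
  proof -
    have "L i \<le> M" using L(1) i unfolding M_def by (intro member_le_sum) auto
    then have "L i * norm (y - x) \<le> M * norm (y - x)" by (rule mult_right_mono) simp
    then show ?thesis using L(2)[OF i, of y x] by linarith
  qed
  let ?D = "\<lambda>x v. \<Sum>i\<in>Basis. (v \<bullet> i) * pderiv_at i f x"
  have der: "(f has_derivative ?D x) (at x within S)" for x S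
    using has_derivative_pderiv_at[OF smooth_differentiable[OF smooth_cpt_smooth[OF f]]]
      has_derivative_at_withinI by blast
  have "\<bar>f (x + v) - f x - ?D x v\<bar> \<le> (real DIM('a) * M) * (norm v)\<^sup>2" for x v
  proof -
    have "norm (f (x + v) - f x - ?D x (x + v - x)) \<le> norm (x + v
        - x) * (real DIM('a) * (M * norm v))"
    \<comment> \<open>On the ball of radius \<open>norm v\<close> the partial derivatives deviate
      from those at the centre by at most M times that radius, by their Lipschitz bound.\<close>
    proof (rule differentiable_bound_linearization[of _ _ "cball x (norm v)"])
      fix z assume "z \<in> cball x (norm v)"
      then have "norm (z - x) \<le> norm v" by (simp add: dist_norm norm_minus_commute)
      then have "\<bar>pderiv_at i f z - pderiv_at i f x\<bar> \<le> M * norm v" if "i \<in> Basis" for i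
        using Lip[OF that, of z x] M by (meson mult_left_mono order.trans)
      then have "\<bar>\<Sum>i\<in>Basis. (w \<bullet> i) * (pderiv_at i f z - pderiv_at i f x)\<bar>
          \<le> (real DIM('a) * (M * norm v)) * norm w" for w
        by (rule sum_inner_le)
      then show "onorm (?D z - ?D x) \<le> real DIM('a) * (M * norm v)"
        by (intro onorm_le) (simp add: sum_subtractf right_diff_distrib)
    qed (auto intro: der simp: dist_norm mult_left_le_one_le)
    then show ?thesis by (simp add: power2_eq_square mult_ac)
  qed
  then show ?thesis using M by (intro that[of "real DIM('a) * M"]) auto
qed

subsection \<open>Smoothness of convolutions\<close>

text \<open>Convolution over the cube, evaluated at the affine image a x + b: this builds the
  contraction towards the centre into the convolution.\<close>

definition conv :: "('a::euclidean_space \<Rightarrow> real) \<Rightarrow> ('a \<Rightarrow> real) \<Rightarrow> real \<Rightarrow> 'a \<Rightarrow> 'a \<Rightarrow> real" where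
  "conv h \<theta> a b x = (LINT y|cube_measure. h y * \<theta> (a *\<^sub>R x + b - y))"

lemma integrable_mult_bounded:
  fixes h k :: "'a \<Rightarrow> real"
  assumes "integrable M h" "k \<in> borel_measurable M" "\<And>y. \<bar>k y\<bar> \<le> B"
  shows "integrable M (\<lambda>y. h y * k y)"
proof (rule Bochner_Integration.integrable_bound)
  show "integrable M (\<lambda>y. B * h y)" using assms by simp
  have "B \<ge> 0" using assms(3) by (meson abs_ge_zero order.trans)
  then have "norm (h y * k y) \<le> norm (B * h y)" for y
    using mult_right_mono[OF assms(3)[of y], of "\<bar>h y\<bar>"] by (simp add: abs_mult mult.commute)
  then show "AE y in M. norm (h y * k y) \<le> norm (B * h y)" by simp
qed (use assms in measurable)

lemma conv_integrable:
  assumes h: "integrable cube_measure h" and \<theta>: "smooth_cpt \<theta>"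
  shows "integrable cube_measure (\<lambda>y. h y * \<theta> (z - y))"
proof -
  obtain B where "\<And>x. \<bar>\<theta> x\<bar> \<le> B" using smooth_cpt_bounded[OF \<theta>] by blast
  moreover have "continuous_on UNIV (\<lambda>y. \<theta> (z - y))"
    using smooth_imp_continuous[OF smooth_cpt_smooth[OF \<theta>]]
    by (rule continuous_on_compose2) (auto intro!: continuous_intros)
  ultimately show ?thesis
    using h by (intro integrable_mult_bounded borel_imp_measurable_cube_measure
        borel_measurable_continuous_onI) auto
qed

text \<open>The chain rule contributes the factor a. The uniform Taylor remainder of \<theta>,
  integrated against h, remains quadratic in the increment.\<close>

lemma conv_has_derivative:
  fixes h \<theta> :: "'a::euclidean_space \<Rightarrow> real"
  assumes h: "integrable cube_measure h" and \<theta>: "smooth_cpt \<theta>"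
  shows "(conv h \<theta> a b has_derivative (\<lambda>v. \<Sum>i\<in>Basis. (v \<bullet> i) * (a * conv h (pderiv_at i \<theta>) a b x)))
      (at x)"
proof -
  let ?D = "\<lambda>v. \<Sum>i\<in>Basis. (v \<bullet> i) * (a * conv h (pderiv_at i \<theta>) a b x)"
  obtain L where L: "L \<ge> 0"
    "\<And>x v. \<bar>\<theta> (x + v) - \<theta> x - (\<Sum>i\<in>Basis. (v \<bullet> i) * pderiv_at i \<theta> x)\<bar> \<le> L * (norm v)\<^sup>2"
    using smooth_cpt_taylor[OF \<theta>] by blast
  define C where "C = (LINT y|cube_measure. \<bar>h y\<bar>) * (L * a\<^sup>2)"
  note int = conv_integrable[OF h \<theta>] conv_integrable[OF h smooth_cpt_pderiv_at[OF \<theta>]]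
  have bound: "\<bar>conv h \<theta> a b y - conv h \<theta> a b x - ?D (y - x)\<bar> \<le> C * (norm (y - x))\<^sup>2" for y
  proof -
    let ?v = "y - x"
    let ?R = "\<lambda>z. \<theta> (a *\<^sub>R y + b - z) - \<theta> (a *\<^sub>R x + b - z)
        - (\<Sum>i\<in>Basis. (a *\<^sub>R ?v \<bullet> i) * pderiv_at i \<theta> (a *\<^sub>R x + b - z))"
    have "conv h \<theta> a b y - conv h \<theta> a b x - ?D ?v = (LINT z|cube_measure. h z * \<theta> (a *\<^sub>R y + b - z)
        - h z * \<theta> (a *\<^sub>R x + b - z)
        - (\<Sum>i\<in>Basis. (?v \<bullet> i) * (a * (h z * pderiv_at i \<theta> (a *\<^sub>R x + b - z)))))"
      using int by (simp add: conv_def)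
    also have "\<dots> = (LINT z|cube_measure. h z * ?R z)"
      by (simp add: right_diff_distrib sum_distrib_left mult_ac)
    finally have eq: "conv h \<theta> a b y - conv h \<theta> a b x - ?D ?v = (LINT z|cube_measure. h z * ?R z)" .
    have R: "\<bar>?R z\<bar> \<le> L * a\<^sup>2 * (norm ?v)\<^sup>2" for z
    proof -
      have shift: "a *\<^sub>R y + b - z = (a *\<^sub>R x + b - z) + a *\<^sub>R ?v" by (simp add: algebra_simps)
      show ?thesis using L(2)[of "a *\<^sub>R x + b - z" "a *\<^sub>R ?v", folded shift]
        by (simp add: power_mult_distrib mult.assoc)
    qed
    have "\<bar>LINT z|cube_measure. h z * ?R z\<bar> \<le> (LINT z|cube_measure. \<bar>h z\<bar> * (L * a\<^sup>2 * (norm ?v)\<^sup>2))"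
    proof (rule integral_abs_bound_integral)
      have "integrable cube_measure (\<lambda>z. h z * \<theta> (a *\<^sub>R y + b - z) - h z * \<theta> (a *\<^sub>R x + b - z)
        - (\<Sum>i\<in>Basis. (?v \<bullet> i) * (a * (h z * pderiv_at i \<theta> (a *\<^sub>R x + b - z)))))"
        using int by simp
      then show "integrable cube_measure (\<lambda>z. h z * ?R z)"
        by (simp add: right_diff_distrib sum_distrib_left mult_ac)
      show "integrable cube_measure (\<lambda>z. \<bar>h z\<bar> * (L * a\<^sup>2 * (norm ?v)\<^sup>2))"
        using h by simp
      show "\<bar>h z * ?R z\<bar> \<le> \<bar>h z\<bar> * (L * a\<^sup>2 * (norm ?v)\<^sup>2)" for z
        unfolding abs_mult by (intro mult_left_mono R) simp
    qed
    then show ?thesis unfolding eq C_def using h by (simp add: mult_ac)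
  qed
  show ?thesis
    unfolding has_derivative_iff_norm
  proof
    have "linear ?D"
      by (rule linearI) (simp_all add: inner_add_left distrib_right sum.distrib sum_distrib_left
          mult.assoc)
    then show "bounded_linear ?D" by (simp add: linear_conv_bounded_linear)
    show "((\<lambda>y. norm ((conv h \<theta> a b y - conv h \<theta> a b x) - ?D (y - x)) / norm (y - x)) \<longlongrightarrow> 0) (at x)"
    proof (rule Lim_null_comparison)
      show "\<forall>\<^sub>F y in at x. norm (norm ((conv h \<theta> a b y - conv h \<theta> a b x) - ?D (y - x)) / norm (y
          - x)) \<le> C * norm (y - x)"
      proof (rule always_eventually, rule allI)
        fix y
        show "norm (norm ((conv h \<theta> a b y - conv h \<theta> a b x) - ?D (y - x)) / norm (y - x))
            \<le> C * norm (y - x)"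
        proof (cases "y = x")
          case False
          then have "norm (y - x) > 0" by simp
          then show ?thesis using bound[of y] by (simp add: divide_le_eq power2_eq_square
              mult.assoc)
        qed simp
      qed
      have "((\<lambda>y. C * norm (y - x)) \<longlongrightarrow> C * norm (x - x)) (at x)" by (intro tendsto_intros)
      then show "((\<lambda>y. C * norm (y - x)) \<longlongrightarrow> 0) (at x)" by simp
    qed
  qed
qed

lemma pderiv_at_conv:
  assumes "integrable cube_measure h" "smooth_cpt \<theta>" "i \<in> Basis"
  shows "pderiv_at i (conv h \<theta> a b) = (\<lambda>x. a * conv h (pderiv_at i \<theta>) a b x)"
  using pderiv_at_eqI[OF conv_has_derivative[OF assms(1,2)]] assms(3)
  by (auto simp: fun_eq_iff inner_Basis if_distrib[of "\<lambda>a. a * _"] sum.delta cong: if_cong)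

text \<open>Differentiation moves to the kernel and yields the same kind of convolution, so the
  induction generalises over the kernel.\<close>

lemma smooth_conv:
  assumes h: "integrable cube_measure h" and \<theta>: "smooth_cpt \<theta>"
  shows "smooth (conv h \<theta> a b)"
proof -
  have "C_k k (conv h \<theta> a b)" if "smooth_cpt \<theta>" for k \<theta>
    using that
  proof (induction k arbitrary: \<theta>)
    case 0
    then show ?case
      using conv_has_derivative[OF h 0]
      by (auto intro!: continuous_at_imp_continuous_on has_derivative_continuous)
  next
    case (Suc k)
    have "conv h \<theta> a b differentiable (at x)" for x
      using conv_has_derivative[OF h Suc.prems] by (auto simp: differentiable_def)
    moreover have "C_k k (pderiv_at i (conv h \<theta> a b))" if "i \<in> Basis" for i
      unfolding pderiv_at_conv[OF h Suc.prems that]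
      by (intro C_k_cmult Suc.IH smooth_cpt_pderiv_at Suc.prems that)
    ultimately show ?case by simp
  qed
  then show ?thesis using \<theta> by (simp add: smooth_def)
qed

subsection \<open>The mollifier\<close>

definition mollifier :: "real \<Rightarrow> 'a::euclidean_space \<Rightarrow> real" where
  "mollifier e z = bump e z / (LINT z|lborel. bump e (z :: 'a))"

lemma bump_integrable: "integrable lborel (bump e :: 'a::euclidean_space \<Rightarrow> real)"
proof -
  let ?S = "cbox (- (e *\<^sub>R One)) (e *\<^sub>R One) :: 'a set"
  have "integrable lborel (\<lambda>x. indicator ?S x *\<^sub>R bump e x)"
    by (intro borel_integrable_compact smooth_imp_continuous[OF smooth_bump]) simp
  moreover have "(\<lambda>x. indicator ?S x *\<^sub>R bump e x) = bump e"
    using bump_eq_0[of _ e] by (auto simp: fun_eq_iff indicator_def)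
  ultimately show ?thesis by simp
qed

lemma bump_measurable [measurable]: "bump e \<in> borel_measurable borel"
  by (intro borel_measurable_continuous_onI smooth_imp_continuous smooth_bump)

lemma mollifier_measurable [measurable]: "mollifier e \<in> borel_measurable borel"
  unfolding mollifier_def by measurable

lemma bump_integral_pos:
  assumes e: "e > 0"
  shows "(LINT z|lborel. bump e (z :: 'a::euclidean_space)) > 0"
proof (rule ccontr)
  assume "\<not> (LINT z|lborel. bump e (z :: 'a)) > 0"
  moreover have "(LINT z|lborel. bump e (z :: 'a)) \<ge> 0" by (simp add: bump_nonneg)
  ultimately have "(LINT z|lborel. bump e (z :: 'a)) = 0" by linarith
  then have "AE z in lborel. bump e (z :: 'a) = 0"
    using integral_nonneg_eq_0_iff_AE[OF bump_integrable[where 'a = 'a], of e]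
        by (simp add: bump_nonneg)
  then have "{z :: 'a. bump e z \<noteq> 0} \<in> null_sets lborel"
    by (subst (asm) AE_iff_null) auto
  \<comment> \<open>A continuous function that is positive at 0 is nonzero on a nonempty open set,
    and such a set is never negligible.\<close>
  then have "negligible {z :: 'a. bump e z \<noteq> 0}"
    by (simp add: negligible_iff_null_sets null_sets_completionI)
  moreover have "open {z :: 'a. bump e z \<noteq> 0}"
    using smooth_imp_continuous[OF smooth_bump, of UNIV e]
    by (intro open_Collect_neq continuous_on_const)
  moreover have "0 \<in> {z :: 'a. bump e z \<noteq> 0}" using bump_pos[OF e, where 'a = 'a] by simp
  ultimately show False using open_not_negligible by blast
qed

lemma mollifier_nonneg: "mollifier e z \<ge> 0"
  unfolding mollifier_def by (intro divide_nonneg_nonneg bump_nonneg integral_nonneg_AE) (simp add: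
      bump_nonneg)

lemma mollifier_eq_0: "z \<notin> cbox (- (e *\<^sub>R One)) (e *\<^sub>R One) \<Longrightarrow> mollifier e z = 0"
  by (simp add: mollifier_def bump_eq_0)

lemma smooth_cpt_mollifier: "smooth_cpt (mollifier e :: 'a::euclidean_space \<Rightarrow> real)"
  unfolding smooth_cpt_def
proof
  show "smooth (mollifier e :: 'a \<Rightarrow> real)"
    using C_k_cmult[OF smooth_bump[of e, where 'a = 'a, unfolded smooth_def, rule_format],
        of _ "1 / (LINT z|lborel. bump e (z :: 'a))"]
    unfolding smooth_def mollifier_def[abs_def] by simp
  show "\<exists>S. compact S \<and> (\<forall>x :: 'a. x \<notin> S \<longrightarrow> mollifier e x = 0)"
    using mollifier_eq_0 by (intro exI[of _ "cbox (- (e *\<^sub>R One)) (e *\<^sub>R One)"]) auto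
qed

lemma nn_integral_mollifier:
  assumes e: "e > 0"
  shows "(\<integral>\<^sup>+z. ennreal (mollifier e (z :: 'a::euclidean_space)) \<partial>lborel) = 1"
proof -
  have "integrable lborel (mollifier e :: 'a \<Rightarrow> real)"
    using bump_integrable[where 'a = 'a] by (simp add: mollifier_def[abs_def])
  then have "(\<integral>\<^sup>+z. ennreal (mollifier e (z :: 'a)) \<partial>lborel)
      = ennreal (LINT z|lborel. mollifier e (z :: 'a))"
    by (rule nn_integral_eq_integral) (simp add: mollifier_nonneg)
  also have "(LINT z|lborel. mollifier e (z :: 'a)) = 1"
    using bump_integral_pos[OF e, where 'a = 'a] by (simp add: mollifier_def)
  finally show ?thesis by simp
qed

lemma nn_integral_lborel_reflect:
  fixes F :: "'a::euclidean_space \<Rightarrow> ennreal"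
  assumes "F \<in> borel_measurable borel"
  shows "(\<integral>\<^sup>+y. F (z - y) \<partial>lborel) = (\<integral>\<^sup>+y. F y \<partial>lborel)"
  using assms by (subst (2) lborel_affine[of "-1" z]) (simp_all add: nn_integral_density
      nn_integral_distr)

lemma nn_integral_lborel_shift:
  fixes F :: "'a::euclidean_space \<Rightarrow> ennreal"
  assumes "F \<in> borel_measurable borel"
  shows "(\<integral>\<^sup>+y. F (y - z) \<partial>lborel) = (\<integral>\<^sup>+y. F y \<partial>lborel)"
  using assms by (subst (2) lborel_affine[of "1" "- z"]) (simp_all add: nn_integral_density
      nn_integral_distr)

text \<open>Before averaging at scale \<open>delta m / 4\<close>, the cube is contracted towards its centre by the
  factor \<open>1 - delta m\<close>, so that the averages only involve points of the open cube.\<close>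

definition delta :: "nat \<Rightarrow> real" where
  "delta m = 1 / (real m + 2)"

definition contract :: "nat \<Rightarrow> 'a::euclidean_space \<Rightarrow> 'a" where
  "contract m x = (1 - delta m) *\<^sub>R x + (delta m / 2) *\<^sub>R One"

definition mollify :: "nat \<Rightarrow> ('a::euclidean_space \<Rightarrow> real) \<Rightarrow> 'a \<Rightarrow> real" where
  "mollify m h = conv h (mollifier (delta m / 4)) (1 - delta m) ((delta m / 2) *\<^sub>R One)"

lemma delta_pos: "delta m > 0" and delta_le: "delta m \<le> 1 / 2"
  by (auto simp: delta_def field_simps)

lemma delta_tendsto: "delta \<longlonglongrightarrow> 0"
  unfolding delta_def by real_asymp

lemma mollify_eq: "mollify m h x = (LINT y|cube_measure. h y * mollifier (delta m / 4) (contract m x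
    - y))"
  by (simp add: mollify_def conv_def contract_def)

text \<open>A contracted point keeps distance \<open>delta m / 2\<close> from every face, while no
  coordinate moves by more than the same amount.\<close>

lemma contract_bounds:
  assumes "x \<in> unit_cube" "j \<in> Basis"
  shows "delta m / 2 \<le> contract m x \<bullet> j" "contract m x \<bullet> j \<le> 1 - delta m / 2"
    "\<bar>contract m x \<bullet> j - x \<bullet> j\<bar> \<le> delta m / 2"
proof -
  have c: "contract m x \<bullet> j = (1 - delta m) * (x \<bullet> j) + delta m / 2"
    using assms(2) by (simp add: contract_def inner_add_left)
  have x: "0 \<le> x \<bullet> j" "x \<bullet> j \<le> 1" using assms by (auto simp: mem_unit_cube)
  have "0 \<le> (1 - delta m) * (x \<bullet> j)" "(1 - delta m) * (x \<bullet> j) \<le> (1 - delta m) * 1"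
    using x delta_le[of m] by (auto intro!: mult_nonneg_nonneg mult_left_mono)
  then show "delta m / 2 \<le> contract m x \<bullet> j" "contract m x \<bullet> j \<le> 1 - delta m / 2"
    unfolding c by (auto simp: field_simps)
  have "contract m x \<bullet> j - x \<bullet> j = delta m * (1 / 2 - x \<bullet> j)"
    unfolding c by (simp add: algebra_simps)
  then have "\<bar>contract m x \<bullet> j - x \<bullet> j\<bar> = delta m * \<bar>1 / 2 - x \<bullet> j\<bar>"
    using delta_pos[of m] by (simp add: abs_mult)
  also have "\<dots> \<le> delta m * (1 / 2)"
  proof (rule mult_left_mono)
    show "\<bar>1 / 2 - x \<bullet> j\<bar> \<le> 1 / 2" using x by linarith
  qed (use delta_pos[of m] in simp)
  finally show "\<bar>contract m x \<bullet> j - x \<bullet> j\<bar> \<le> delta m / 2" by simp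
qed

lemma mollifier_supp:
  assumes "mollifier e (z - y) \<noteq> 0" "j \<in> Basis"
  shows "\<bar>z \<bullet> j - y \<bullet> j\<bar> \<le> e"
proof -
  have "z - y \<in> cbox (- (e *\<^sub>R One)) (e *\<^sub>R One)" using assms(1) mollifier_eq_0 by blast
  then show ?thesis using assms(2) by (auto simp: mem_box inner_diff_left abs_le_iff)
qed

text \<open>The contraction leaves a margin of \<open>delta m / 2\<close>; the radius
  \<open>delta m / 4\<close> of the kernel uses up half of it.\<close>

lemma mollifier_supp_interior:
  assumes x: "x \<in> unit_cube" and k: "mollifier (delta m / 4) (contract m x - y) \<noteq> 0"
  shows "y \<in> cbox ((delta m / 4) *\<^sub>R One) ((1 - delta m / 4) *\<^sub>R One)"
  unfolding mem_box
proof
  fix j :: 'a assume j: "j \<in> Basis"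
  show "(delta m / 4) *\<^sub>R One \<bullet> j \<le> y \<bullet> j \<and> y \<bullet> j \<le> (1 - delta m / 4) *\<^sub>R One \<bullet> j"
    using mollifier_supp[OF k j] contract_bounds[OF x j, of m] j unfolding abs_le_iff by auto
qed

lemma mollifier_supp_cube:
  assumes x: "x \<in> unit_cube" and k: "mollifier (delta m / 4) (contract m x - y) \<noteq> 0"
  shows "y \<in> unit_cube"
  using mollifier_supp_interior[OF assms] delta_pos[of m] by (force simp: mem_box mem_unit_cube)

lemma smooth_reflect: "smooth \<theta> \<Longrightarrow> smooth (\<lambda>y. \<theta> (z - y))"
  unfolding smooth_def using C_k_affine[of _ \<theta> "-1" z] by (simp add: algebra_simps)

lemma pderiv_at_reflect: "smooth \<theta> \<Longrightarrow> pderiv_at i (\<lambda>y. \<theta> (z - y)) y = - pderiv_at i \<theta> (z - y)"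
  using pderiv_at_affine(2)[of \<theta> "-1" y z i] smooth_differentiable[of \<theta>]
      by (simp add: algebra_simps)

text \<open>For x in the closed cube, up to and including its boundary, the kernel in y is an
  admissible test function. A mollified value is therefore a pairing with a test function.\<close>

lemma test_function_mollifier:
  assumes x: "x \<in> unit_cube"
  shows "test_function (\<lambda>y. mollifier (delta m / 4) (contract m x - y))"
proof -
  let ?\<phi> = "\<lambda>y. mollifier (delta m / 4) (contract m x - y)"
  let ?S = "cbox ((delta m / 4) *\<^sub>R One) ((1 - delta m / 4) *\<^sub>R One) :: 'a set"
  have sub: "closure {y. ?\<phi> y \<noteq> 0} \<subseteq> ?S"
    using mollifier_supp_interior[OF x] by (intro closure_minimal) auto
  moreover have "compact (closure {y. ?\<phi> y \<noteq> 0})"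
    using sub by (meson compact_cbox closed_closure compact_Int_closed inf.absorb_iff2
        compact_closure bounded_subset bounded_closure bounded_cbox closure_subset)
  moreover have "?S \<subseteq> interior unit_cube"
    using delta_pos[of m] by (force simp: unit_cube_def mem_box interior_cbox)
  ultimately show ?thesis
    unfolding test_function_def
    using smooth_reflect[OF smooth_cpt_smooth[OF smooth_cpt_mollifier]] by blast
qed

text \<open>No mass of the kernel is lost across the boundary of the cube, again thanks to the
  contraction.\<close>

lemma nn_integral_mollifier_cube:
  assumes x: "x \<in> unit_cube"
  shows "(\<integral>\<^sup>+y. ennreal (mollifier (delta m / 4) (contract m x - y)) \<partial>cube_borel) = 1"
proof -
  have "(\<integral>\<^sup>+y. ennreal (mollifier (delta m / 4) (contract m x - y)) \<partial>cube_borel)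
      = (\<integral>\<^sup>+y. indicator unit_cube y * ennreal (mollifier (delta m / 4) (contract m x - y)) \<partial>lborel)"
    by (simp add: cube_borel_def nn_integral_density)
  also have "\<dots> = (\<integral>\<^sup>+y. ennreal (mollifier (delta m / 4) (contract m x - y)) \<partial>lborel)"
  proof (rule nn_integral_cong)
    fix y
    have "mollifier (delta m / 4) (contract m x - y) = 0" if "y \<notin> unit_cube"
      using mollifier_supp_cube[OF x] that by blast
    then show "indicator unit_cube y * ennreal (mollifier (delta m / 4) (contract m x - y))
        = ennreal (mollifier (delta m / 4) (contract m x - y))"
      by (auto simp: indicator_def)
  qed
  also have "\<dots> = 1"
    using nn_integral_lborel_reflect[of "\<lambda>z. ennreal (mollifier (delta m / 4) z)"] delta_pos[of m]
    by (simp add: nn_integral_mollifier)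
  finally show ?thesis .
qed

lemma mollifier_integrable_cube:
  assumes h: "integrable cube_borel h"
  shows "integrable cube_borel (\<lambda>y. h y * mollifier e (z - y))"
proof -
  obtain B where "\<And>x. \<bar>mollifier e (x :: 'a)\<bar> \<le> B" using smooth_cpt_bounded[OF smooth_cpt_mollifier]
      by blast
  then show ?thesis using h by (intro integrable_mult_bounded[of _ _ _ B]) measurable
qed

lemma integral_mollifier_cube:
  assumes x: "x \<in> unit_cube"
  shows "(LINT y|cube_borel. mollifier (delta m / 4) (contract m x - y)) = 1"
proof -
  have "integrable cube_borel (\<lambda>y. mollifier (delta m / 4) (contract m x - y))"
    using mollifier_integrable_cube[of "\<lambda>y. 1"] by simp
  then show ?thesis
    using nn_integral_mollifier_cube[OF x, of m]
    by (simp add: nn_integral_eq_integral mollifier_nonneg ennreal_eq_1)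
qed

lemma mollify_borel:
  assumes [measurable]: "h \<in> borel_measurable borel"
  shows "mollify m h x = (LINT y|cube_borel. h y * mollifier (delta m / 4) (contract m x - y))"
  unfolding mollify_eq by (intro integral_cube_measure_borel) measurable

lemma smooth_mollify: "L2 cube_measure h \<Longrightarrow> smooth (mollify m h)"
  unfolding mollify_def by (intro smooth_conv smooth_cpt_mollifier L2_integrable_cube)

lemma mollify_diff:
  assumes "L2 cube_measure f" "L2 cube_measure g"
  shows "mollify m (\<lambda>y. f y - g y) x = mollify m f x - mollify m g x"
  using conv_integrable[OF L2_integrable_cube[OF assms(1)] smooth_cpt_mollifier]
    conv_integrable[OF L2_integrable_cube[OF assms(2)] smooth_cpt_mollifier]
  by (simp add: mollify_eq left_diff_distrib)

text \<open>Jensen's inequality for the probability density given by the kernel, obtained from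
  Cauchy-Schwarz by splitting the kernel into two square roots.\<close>

lemma mollify_pointwise:
  fixes h :: "'a::euclidean_space \<Rightarrow> real"
  assumes h: "L2 cube_borel h" and x: "x \<in> unit_cube"
  shows "(mollify m h x)\<^sup>2 \<le> (LINT y|cube_borel. (h y)\<^sup>2 * mollifier (delta m / 4) (contract m x
      - y))"
proof -
  let ?k = "\<lambda>y. mollifier (delta m / 4) (contract m x - y)"
  have [measurable]: "h \<in> borel_measurable borel" using L2_D1[OF h]
      by (simp cong: measurable_cong_sets)
  have L: "L2 cube_borel (\<lambda>y. h y * sqrt (?k y))" "L2 cube_borel (\<lambda>y. sqrt (?k y))"
    using mollifier_integrable_cube[OF L2_D2[OF h]] mollifier_integrable_cube[of "\<lambda>y. 1"]
    by (auto simp: L2_def power_mult_distrib mollifier_nonneg)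
  have "mollify m h x = L2_inner cube_borel (\<lambda>y. h y * sqrt (?k y)) (\<lambda>y. sqrt (?k y))"
    by (simp add: mollify_borel L2_inner_def mult.assoc mollifier_nonneg)
  moreover have "(L2_norm cube_borel (\<lambda>y. sqrt (?k y)))\<^sup>2 = 1"
    by (simp add: L2_norm_sq_eq mollifier_nonneg integral_mollifier_cube[OF x])
  then have "L2_norm cube_borel (\<lambda>y. sqrt (?k y)) = 1"
    using L2_norm_nonneg[of cube_borel "\<lambda>y. sqrt (?k y)"] by (simp add: power2_eq_1_iff)
  ultimately have "\<bar>mollify m h x\<bar> \<le> L2_norm cube_borel (\<lambda>y. h y * sqrt (?k y))"
    using L2_Cauchy_Schwarz[OF L] by simp
  then have "\<bar>mollify m h x\<bar>\<^sup>2 \<le> (L2_norm cube_borel (\<lambda>y. h y * sqrt (?k y)))\<^sup>2"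
    by (rule power_mono) simp
  then show ?thesis by (simp add: L2_norm_sq_eq power_mult_distrib mollifier_nonneg)
qed

text \<open>Integrate the pointwise bound and exchange the integrals. What matters is that the
  constant does not depend on m.\<close>

lemma mollify_L2_le:
  fixes h :: "'a::euclidean_space \<Rightarrow> real"
  assumes h: "L2 cube_borel h"
  shows "L2_norm cube_borel (mollify m h) \<le> sqrt (2 ^ DIM('a)) * L2_norm cube_borel h"
proof -
  let ?k = "\<lambda>x y :: 'a. mollifier (delta m / 4) (contract m x - y)"
  interpret cc: pair_sigma_finite "cube_borel :: 'a measure" "cube_borel :: 'a measure" by standard
  have hm[measurable]: "h \<in> borel_measurable borel" using L2_D1[OF h]
      by (simp cong: measurable_cong_sets)
  have [measurable]: "contract m \<in> borel_measurable borel"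
    unfolding contract_def by measurable
  have int2: "integrable cube_borel (\<lambda>x. (mollify m h x)\<^sup>2)"
    using h L2_cube_measure_borel[OF hm]
    by (intro continuous_integrable_cube continuous_intros smooth_imp_continuous smooth_mollify)
        simp
  \<comment> \<open>In the variable x the kernel is composed with the contraction, whose ratio is at
    least 1/2; the Jacobian costs at most 2^d.\<close>
  have inner: "(\<integral>\<^sup>+x. ennreal (?k x y) \<partial>cube_borel) \<le> 2 ^ DIM('a)" for y
  proof -
    have T: "contract m x = (delta m / 2) *\<^sub>R One + (1 - delta m) *\<^sub>R x" for x :: 'a
      by (simp add: contract_def)
    have "contract m x \<in> unit_cube" if "x \<in> unit_cube" for x :: 'a
      using contract_bounds(1,2)[OF that, of _ m] delta_pos[of m] delta_le[of m]
      unfolding mem_unit_cube by (smt (verit) divide_nonneg_nonneg)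
    then have "(\<integral>\<^sup>+x. ennreal (?k x y) \<partial>cube_borel)
        \<le> 2 ^ DIM('a) * (\<integral>\<^sup>+z. ennreal (mollifier (delta m / 4) (z - y)) \<partial>cube_borel)"
      unfolding T using delta_le[of m] by (intro nn_integral_cube_affine_le) auto
    also have "(\<integral>\<^sup>+z. ennreal (mollifier (delta m / 4) (z - y)) \<partial>cube_borel)
        \<le> (\<integral>\<^sup>+z. ennreal (mollifier (delta m / 4) (z - y)) \<partial>lborel)"
      by (subst cube_borel_def, subst nn_integral_density) (auto intro!: nn_integral_mono simp:
          indicator_def)
    also have "\<dots> = 1"
      using nn_integral_lborel_shift[of "\<lambda>z. ennreal (mollifier (delta m / 4) z)"] delta_pos[of m]
      by (simp add: nn_integral_mollifier)
    finally show ?thesis by (simp add: mult_left_mono)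
  qed
  have "ennreal (LINT x|cube_borel. (mollify m h x)\<^sup>2) = (\<integral>\<^sup>+x. ennreal ((mollify m h x)\<^sup>2)
      \<partial>cube_borel)"
    by (rule nn_integral_eq_integral[symmetric, OF int2]) simp
  also have "\<dots> \<le> (\<integral>\<^sup>+x. \<integral>\<^sup>+y. ennreal ((h y)\<^sup>2) * ennreal (?k x y) \<partial>cube_borel \<partial>cube_borel)"
  proof (rule nn_integral_mono_AE)
    show "AE x in cube_borel. ennreal ((mollify m h x)\<^sup>2) \<le> (\<integral>\<^sup>+y. ennreal ((h y)\<^sup>2) * ennreal (?k x y)
        \<partial>cube_borel)"
      using AE_cube_borel
    proof eventually_elim
      case (elim x)
      have "(\<integral>\<^sup>+y. ennreal ((h y)\<^sup>2) * ennreal (?k x y) \<partial>cube_borel)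
          = (\<integral>\<^sup>+y. ennreal ((h y)\<^sup>2 * ?k x y) \<partial>cube_borel)"
        by (simp add: ennreal_mult mollifier_nonneg)
      also have "\<dots> = ennreal (LINT y|cube_borel. (h y)\<^sup>2 * ?k x y)"
        by (rule nn_integral_eq_integral[OF mollifier_integrable_cube[OF L2_D2[OF h]]]) (simp add:
            mollifier_nonneg)
      finally show ?case using mollify_pointwise[OF h elim] by (simp add: ennreal_leI)
    qed
  qed
  also have "\<dots> = (\<integral>\<^sup>+y. \<integral>\<^sup>+x. ennreal ((h y)\<^sup>2) * ennreal (?k x y) \<partial>cube_borel \<partial>cube_borel)"
    by (rule cc.Fubini'[symmetric]) measurable
  also have "\<dots> = (\<integral>\<^sup>+y. ennreal ((h y)\<^sup>2) * (\<integral>\<^sup>+x. ennreal (?k x y) \<partial>cube_borel) \<partial>cube_borel)"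
    by (intro nn_integral_cong nn_integral_cmult) measurable
  also have "\<dots> \<le> (\<integral>\<^sup>+y. ennreal ((h y)\<^sup>2) * 2 ^ DIM('a) \<partial>cube_borel)"
    by (intro nn_integral_mono mult_left_mono inner) simp
  also have "\<dots> = (\<integral>\<^sup>+y. ennreal ((h y)\<^sup>2) \<partial>cube_borel) * 2 ^ DIM('a)"
    by (rule nn_integral_multc) simp
  also have "\<dots> = ennreal ((LINT y|cube_borel. (h y)\<^sup>2) * 2 ^ DIM('a))"
    by (simp add: nn_integral_eq_integral[OF L2_D2[OF h]] ennreal_mult flip: ennreal_power
        ennreal_numeral)
  finally have "(LINT x|cube_borel. (mollify m h x)\<^sup>2) \<le> (LINT y|cube_borel. (h y)\<^sup>2) * 2 ^ DIM('a)"
    by (subst (asm) ennreal_le_iff) auto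
  then have "sqrt (LINT x|cube_borel. (mollify m h x)\<^sup>2) \<le> sqrt (2 ^ DIM('a) * (LINT y|cube_borel. (h
      y)\<^sup>2))"
    by (simp add: mult.commute)
  then show ?thesis by (simp add: L2_norm_def real_sqrt_mult)
qed

section \<open>Convergence of the mollifications\<close>

lemma L2_norm_tendsto_0_dominated:
  fixes s :: "nat \<Rightarrow> 'a \<Rightarrow> real"
  assumes "\<And>n. s n \<in> borel_measurable M" "integrable M w"
    "AE x in M. (\<lambda>n. s n x) \<longlonglongrightarrow> 0" "\<And>n. AE x in M. (s n x)\<^sup>2 \<le> w x"
  shows "(\<lambda>n. L2_norm M (s n)) \<longlonglongrightarrow> 0"
proof -
  note assms(1)[measurable]
  have "(\<lambda>n. LINT x|M. (s n x)\<^sup>2) \<longlonglongrightarrow> (LINT x|M. 0)"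
  proof (rule integral_dominated_convergence[where w = w])
    show "AE x in M. (\<lambda>n. (s n x)\<^sup>2) \<longlonglongrightarrow> 0"
      using assms(3) by eventually_elim (use tendsto_power[of _ 0 _ 2] in fastforce)
  qed (use assms in auto)
  then have "(\<lambda>n. sqrt (LINT x|M. (s n x)\<^sup>2)) \<longlonglongrightarrow> sqrt 0"
    by (intro tendsto_real_sqrt) simp
  then show ?thesis by (simp add: L2_norm_def)
qed

definition clip :: "real \<Rightarrow> real \<Rightarrow> real" where
  "clip N t = max (- N) (min N t)"

lemma clip_measurable [measurable]: "clip N \<in> borel_measurable borel"
  unfolding clip_def by measurable

text \<open>Truncation comes first because dominated convergence for continuous approximants needs
  an integrable bound, which a clipped function supplies.\<close>

lemma L2_approx_bounded:
  fixes h :: "'a::euclidean_space \<Rightarrow> real"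
  assumes h[measurable]: "h \<in> borel_measurable borel" and L: "L2 cube_borel h" and e: "e > 0"
  obtains N where "N \<ge> 0" "L2_norm cube_borel (\<lambda>x. h x - clip N (h x)) < e"
proof -
  have "(\<lambda>n. L2_norm cube_borel (\<lambda>x. h x - clip (real n) (h x))) \<longlonglongrightarrow> 0"
  proof (rule L2_norm_tendsto_0_dominated[OF _ L2_D2[OF L]])
    show "AE x in cube_borel. (\<lambda>n. h x - clip (real n) (h x)) \<longlonglongrightarrow> 0"
    proof (intro AE_I2 tendsto_eventually)
      fix x
      show "\<forall>\<^sub>F n in sequentially. h x - clip (real n) (h x) = 0"
        using eventually_ge_at_top[of "nat \<lceil>\<bar>h x\<bar>\<rceil>"]
        by eventually_elim (auto simp: clip_def max_def min_def; linarith)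
    qed
    have "\<bar>h x - clip (real n) (h x)\<bar> \<le> \<bar>h x\<bar>" for n x
      by (auto simp: clip_def max_def min_def)
    then show "AE x in cube_borel. (h x - clip (real n) (h x))\<^sup>2 \<le> (h x)\<^sup>2" for n
      by (simp add: abs_le_square_iff)
  qed measurable
  then have "\<forall>\<^sub>F n in sequentially. L2_norm cube_borel (\<lambda>x. h x - clip (real n) (h x)) < e"
    using e by (rule order_tendstoD)
  then obtain n :: nat where "L2_norm cube_borel (\<lambda>x. h x - clip (real n) (h x)) < e"
    by (auto simp: eventually_sequentially)
  then show ?thesis by (intro that[of "real n"]) auto
qed

lemma L2_bounded_approx_continuous:
  fixes h :: "'a::euclidean_space \<Rightarrow> real"
  assumes h[measurable]: "h \<in> borel_measurable borel" and N: "N \<ge> 0" and e: "e > 0"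
  obtains g where "continuous_on UNIV g" "L2_norm cube_borel (\<lambda>x. clip N (h x) - g x) < e"
proof -
  \<comment> \<open>This notion of measurability provides continuous functions converging to h off a
    negligible set; clipping them makes the convergence dominated.\<close>
  have "h measurable_on UNIV"
    by (intro lebesgue_measurable_imp_measurable_on measurable_completion) auto
  then obtain Z g where Z: "negligible Z" and g: "\<And>n. continuous_on UNIV (g n)"
      "\<And>x. x \<notin> Z \<Longrightarrow> (\<lambda>n. g n x) \<longlonglongrightarrow> h x"
    unfolding measurable_on_def by auto
  let ?g = "\<lambda>n x. clip N (g n x)"
  have c: "continuous_on UNIV (?g n)" for n
    unfolding clip_def using g(1) by (intro continuous_intros)
  have "(\<lambda>n. L2_norm cube_borel (\<lambda>x. clip N (h x) - ?g n x)) \<longlonglongrightarrow> 0"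
  proof (rule L2_norm_tendsto_0_dominated)
    show "(\<lambda>x. clip N (h x) - ?g n x) \<in> borel_measurable cube_borel" for n
      using borel_measurable_continuous_onI[OF c] by measurable
    show "integrable cube_borel (\<lambda>x. (2 * N)\<^sup>2)" by simp
    have "AE x in lebesgue. x \<notin> Z"
      using Z by (intro AE_not_in) (simp add: negligible_iff_null_sets)
    then have "AE x in lborel. x \<notin> Z" by (simp only: AE_completion_iff)
    then have "AE x in lborel. x \<in> unit_cube \<longrightarrow> (\<lambda>n. clip N (h x) - ?g n x) \<longlonglongrightarrow> 0"
    proof eventually_elim
      case (elim x)
      have "(\<lambda>n. clip N (h x) - ?g n x) \<longlonglongrightarrow> clip N (h x) - clip N (h x)"
        unfolding clip_def by (intro tendsto_intros g(2) elim)
      then show ?case by simp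
    qed
    then show "AE x in cube_borel. (\<lambda>n. clip N (h x) - ?g n x) \<longlonglongrightarrow> 0"
      by (simp only: AE_cube_borel_iff)
    have "\<bar>clip N s - clip N t\<bar> \<le> 2 * N" for s t
      using N by (auto simp: clip_def max_def min_def)
    then have "(clip N s - clip N t)\<^sup>2 \<le> (2 * N)\<^sup>2" for s t
      using N by (metis abs_ge_zero power2_abs power_mono)
    then show "AE x in cube_borel. (clip N (h x) - ?g n x)\<^sup>2 \<le> (2 * N)\<^sup>2" for n by simp
  qed
  then have "\<forall>\<^sub>F n in sequentially. L2_norm cube_borel (\<lambda>x. clip N (h x) - ?g n x) < e"
    using e by (rule order_tendstoD)
  then obtain n :: nat where "L2_norm cube_borel (\<lambda>x. clip N (h x) - ?g n x) < e"
    by (auto simp: eventually_sequentially)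
  then show ?thesis using c by (intro that) auto
qed

lemma clip_L2:
  fixes h :: "'a::euclidean_space \<Rightarrow> real"
  assumes [measurable]: "h \<in> borel_measurable borel" and N: "N \<ge> 0"
  shows "L2 cube_borel (\<lambda>x. clip N (h x))"
proof -
  have "\<bar>clip N t\<bar> \<le> N" for t using N by (auto simp: clip_def max_def min_def)
  then have "norm ((clip N t)\<^sup>2) \<le> N\<^sup>2" for t
    by (simp add: abs_le_square_iff[symmetric] N)
  then show ?thesis unfolding L2_def
    by (intro conjI cube_borel.integrable_const_bound[of _ "N\<^sup>2"]) auto
qed

lemma L2_dense_continuous:
  fixes h :: "'a::euclidean_space \<Rightarrow> real"
  assumes h: "h \<in> borel_measurable borel" and L: "L2 cube_borel h" and e: "e > 0"
  obtains g where "continuous_on UNIV g" "L2_norm cube_borel (\<lambda>x. h x - g x) < e"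
proof -
  obtain N where N: "N \<ge> 0" "L2_norm cube_borel (\<lambda>x. h x - clip N (h x)) < e / 2"
    using L2_approx_bounded[OF h L, of "e / 2"] e by auto
  obtain g where g: "continuous_on UNIV g" "L2_norm cube_borel (\<lambda>x. clip N (h x) - g x) < e / 2"
    using L2_bounded_approx_continuous[OF h N(1), of "e / 2"] e by auto
  note cl = clip_L2[OF h N(1)]
  have "L2_norm cube_borel (\<lambda>x. (h x - clip N (h x)) + (clip N (h x) - g x)) < e"
    using L2_norm_triangle[OF L2_diff[OF L cl] L2_diff[OF cl continuous_L2_cube[OF g(1)]]] N(2) g(2)
    by linarith
  then show ?thesis by (intro that[OF g(1)]) simp
qed

text \<open>The kernel averages only over points of the cube close to x, where g differs little from
  g x by uniform continuity.\<close>

lemma mollify_continuous_bound: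
  fixes g :: "'a::euclidean_space \<Rightarrow> real"
  assumes g: "continuous_on UNIV g" and e: "e > 0"
  shows "\<forall>\<^sub>F m in sequentially. \<forall>x\<in>unit_cube. \<bar>mollify m g x - g x\<bar> \<le> e"
proof -
  have "uniformly_continuous_on unit_cube g"
    using g by (intro compact_uniformly_continuous compact_unit_cube) (rule continuous_on_subset,
        auto)
  then obtain d where d: "d > 0"
    "\<And>x y. x \<in> unit_cube \<Longrightarrow> y \<in> unit_cube \<Longrightarrow> dist y x < d \<Longrightarrow> dist (g y) (g x) < e"
    using e unfolding uniformly_continuous_on_def by metis
  have "(\<lambda>m. real DIM('a) * delta m) \<longlonglongrightarrow> real DIM('a) * 0"
    by (intro tendsto_intros delta_tendsto)
  then have "\<forall>\<^sub>F m in sequentially. real DIM('a) * delta m < d"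
    using d(1) by (intro order_tendstoD) auto
  then show ?thesis
  proof eventually_elim
    case (elim m)
    have gm[measurable]: "g \<in> borel_measurable borel" by (rule borel_measurable_continuous_onI[OF
        g])
    show ?case
    proof
      fix x :: 'a assume x: "x \<in> unit_cube"
      let ?k = "\<lambda>y. mollifier (delta m / 4) (contract m x - y)"
      note int = mollifier_integrable_cube[OF continuous_integrable_cube[OF g]]
        mollifier_integrable_cube[of "\<lambda>y :: 'a. 1"]
      have "mollify m g x - g x = (LINT y|cube_borel. g y * ?k y) - g x * (LINT y|cube_borel. ?k y)"
        by (simp add: mollify_borel integral_mollifier_cube[OF x])
      also have "\<dots> = (LINT y|cube_borel. (g y - g x) * ?k y)"
        using int by (simp add: left_diff_distrib)
      finally have "\<bar>mollify m g x - g x\<bar> = \<bar>LINT y|cube_borel. (g y - g x) * ?k y\<bar>" by simp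
      also have "\<dots> \<le> (LINT y|cube_borel. e * ?k y)"
      proof (rule integral_abs_bound_integral)
        show "integrable cube_borel (\<lambda>y. (g y - g x) * ?k y)" "integrable cube_borel (\<lambda>y. e * ?k y)"
          using int by (simp_all add: left_diff_distrib)
        fix y
        show "\<bar>(g y - g x) * ?k y\<bar> \<le> e * ?k y"
        proof (cases "?k y = 0")
          case False
          have y: "y \<in> unit_cube" by (rule mollifier_supp_cube[OF x False])
          have "norm (y - x) \<le> (\<Sum>j\<in>(Basis :: 'a set). \<bar>(y - x) \<bullet> j\<bar>)" by (rule norm_le_l1)
          also have "\<dots> \<le> (\<Sum>j\<in>(Basis :: 'a set). delta m)"
          proof (rule sum_mono)
            fix j :: 'a assume j: "j \<in> Basis"
            \<comment> \<open>At most \<open>delta m / 2\<close> from the contraction plus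
              \<open>delta m / 4\<close> from the radius of the kernel.\<close>
            show "\<bar>(y - x) \<bullet> j\<bar> \<le> delta m"
              using mollifier_supp[OF False j] contract_bounds(3)[OF x j, of m] delta_pos[of m]
              unfolding inner_diff_left by linarith
          qed
          finally have "dist y x < d" using elim by (simp add: dist_norm)
          then have "\<bar>g y - g x\<bar> \<le> e" using d(2)[OF x y] by (simp add: dist_real_def)
          then show ?thesis by (simp add: abs_mult mollifier_nonneg mult_right_mono)
        qed simp
      qed
      also have "\<dots> = e" by (simp add: integral_mollifier_cube[OF x])
      finally show "\<bar>mollify m g x - g x\<bar> \<le> e" .
    qed
  qed
qed

lemma continuous_mollify:
  "L2 cube_borel h \<Longrightarrow> h \<in> borel_measurable borel \<Longrightarrow> continuous_on UNIV (mollify m h)"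
  by (intro smooth_imp_continuous smooth_mollify) (simp add: L2_cube_measure_borel)

text \<open>Approximate h by a continuous g; the uniform bound of mollification controls the
  mollified error, and for g itself the convergence is uniform.\<close>

lemma mollify_tendsto_borel:
  fixes h :: "'a::euclidean_space \<Rightarrow> real"
  assumes h: "h \<in> borel_measurable borel" and L: "L2 cube_borel h"
  shows "(\<lambda>m. L2_norm cube_borel (\<lambda>x. mollify m h x - h x)) \<longlonglongrightarrow> 0"
proof (rule LIMSEQ_I)
  fix e :: real assume e: "e > 0"
  define C where "C = sqrt (2 ^ DIM('a))"
  have C: "C \<ge> 0" by (simp add: C_def)
  \<comment> \<open>The three errors add up to at most C \<eta> + 2 \<eta>; the third summand in C +
    3 makes the final inequality strict.\<close>
  define \<eta> where "\<eta> = e / (C + 3)"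
  have \<eta>: "\<eta> > 0" using e C by (simp add: \<eta>_def)
  obtain g where g: "continuous_on UNIV g" "L2_norm cube_borel (\<lambda>x. h x - g x) < \<eta>"
    using L2_dense_continuous[OF h L \<eta>] by blast
  have gb: "g \<in> borel_measurable borel" by (rule borel_measurable_continuous_onI[OF g(1)])
  note Lg = continuous_L2_cube[OF g(1)]
  have hgb: "(\<lambda>x. h x - g x) \<in> borel_measurable borel" using h gb by measurable
  note Lhg = L2_diff[OF L Lg]
  have "norm (L2_norm cube_borel (\<lambda>x. mollify m h x - h x) - 0) < e"
    if m: "\<forall>x\<in>unit_cube. \<bar>mollify m g x - g x\<bar> \<le> \<eta>" for m
  proof -
    note Lm = continuous_L2_cube[OF continuous_mollify]
    have split: "mollify m h x - h x = mollify m (\<lambda>y. h y - g y) x + ((mollify m g x - g x) + (g x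
        - h x))" for x
      using mollify_diff[of h g m x] L Lg h gb by (simp add: L2_cube_measure_borel)
    have 1: "L2_norm cube_borel (mollify m (\<lambda>y. h y - g y)) \<le> C * \<eta>"
      using mollify_L2_le[OF Lhg, of m] g(2) C unfolding C_def
      by (smt (verit) mult_left_mono)
    have "L2_norm cube_borel (\<lambda>x. mollify m g x - g x) \<le> L2_norm cube_borel (\<lambda>x :: 'a. \<eta>)"
    proof (rule L2_norm_mono)
      show "AE x in cube_borel. \<bar>mollify m g x - g x\<bar> \<le> \<bar>\<eta>\<bar>"
        using AE_cube_borel by eventually_elim (use m \<eta> in auto)
    qed (intro L2_diff Lm Lg gb continuous_L2_cube continuous_on_const)+
    also have "\<dots> = \<eta>" using \<eta> by (simp add: L2_norm_def measure_cube_borel_UNIV)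
    finally have 2: "L2_norm cube_borel (\<lambda>x. mollify m g x - g x) \<le> \<eta>" .
    have 3: "L2_norm cube_borel (\<lambda>x. g x - h x) < \<eta>"
      using g(2) by (simp add: L2_norm_minus_commute[of _ g h])
    have "L2_norm cube_borel (\<lambda>x. mollify m h x - h x)
        \<le> L2_norm cube_borel (mollify m (\<lambda>y. h y - g y))
          + (L2_norm cube_borel (\<lambda>x. mollify m g x - g x) + L2_norm cube_borel (\<lambda>x. g x - h x))"
      unfolding split
      by (intro order.trans[OF L2_norm_triangle] add_left_mono L2_norm_triangle L2_add L2_diff
          Lm Lg L Lhg hgb gb)
    also have "\<dots> \<le> C * \<eta> + 2 * \<eta>" using 1 2 3 by linarith
    also have "\<dots> < (C + 3) * \<eta>" using \<eta> by (simp add: algebra_simps)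
    also have "\<dots> = e" using C by (simp add: \<eta>_def)
    finally show ?thesis by simp
  qed
  then show "\<exists>no. \<forall>m\<ge>no. norm (L2_norm cube_borel (\<lambda>x. mollify m h x - h x) - 0) < e"
    using mollify_continuous_bound[OF g(1) \<eta>] unfolding eventually_sequentially by blast
qed

lemma mollify_cong_AE:
  assumes "f \<in> borel_measurable cube_measure" "g \<in> borel_measurable cube_measure"
    "AE x in cube_measure. f x = g x"
  shows "mollify m f x = mollify m g x"
proof -
  have [measurable]: "(\<lambda>y. mollifier (delta m / 4) (contract m x
      - y)) \<in> borel_measurable cube_measure"
    by (rule borel_imp_measurable_cube_measure) measurable
  note assms(1,2)[measurable]
  show ?thesis unfolding mollify_eq
  proof (rule integral_cong_AE)
    show "AE y in cube_measure. f y * mollifier (delta m / 4) (contract m x - y)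
        = g y * mollifier (delta m / 4) (contract m x - y)"
      using assms(3) by eventually_elim simp
  qed measurable
qed

theorem mollify_tendsto:
  fixes h :: "'a::euclidean_space \<Rightarrow> real"
  assumes L: "L2 cube_measure h"
  shows "(\<lambda>m. L2_norm cube_measure (\<lambda>x. mollify m h x - h x)) \<longlonglongrightarrow> 0"
proof -
  obtain k where k: "k \<in> borel_measurable borel" and hk: "AE x in cube_measure. h x = k x"
    using borel_representative[OF L2_D1[OF L]] by blast
  note km = borel_imp_measurable_cube_measure[OF k]
  have Lk: "L2 cube_measure k" by (rule L2_cong_AE[OF L km hk])
  then have Lk': "L2 cube_borel k" using L2_cube_measure_borel[OF k] by simp
  have "L2_norm cube_measure (\<lambda>x. mollify m h x - h x) = L2_norm cube_borel (\<lambda>x. mollify m k x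
      - k x)" for m
  proof -
    have mk: "mollify m h = mollify m k"
      using mollify_cong_AE[OF L2_D1[OF L] km hk] by auto
    have b: "mollify m k \<in> borel_measurable borel"
      by (rule borel_measurable_continuous_onI[OF continuous_mollify[OF Lk' k]])
    note bm = borel_imp_measurable_cube_measure[OF b]
    have "L2_norm cube_measure (\<lambda>x. mollify m h x - h x) = L2_norm cube_measure (\<lambda>x. mollify m k x
        - k x)"
      unfolding mk
      by (rule L2_norm_cong_AE) (use bm km L2_D1[OF L] hk in \<open>auto elim: eventually_mono\<close>)
    then show ?thesis using b k by (subst (asm) (2) L2_norm_cube_measure_borel) auto
  qed
  then show ?thesis using mollify_tendsto_borel[OF k Lk'] by simp
qed

section \<open>Weak derivatives\<close>

lemma test_function_smooth: "test_function \<phi> \<Longrightarrow> smooth \<phi>"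
  by (simp add: test_function_def)

lemma test_function_boundary:
  assumes "test_function \<phi>" "i \<in> Basis" "x \<bullet> i \<le> 0 \<or> 1 \<le> x \<bullet> i"
  shows "\<phi> x = 0"
proof (rule ccontr)
  assume "\<phi> x \<noteq> 0"
  then have "x \<in> closure {x. \<phi> x \<noteq> 0}" using closure_subset[of "{x. \<phi> x \<noteq> 0}"] by auto
  then have "x \<in> interior unit_cube" using assms(1) by (auto simp: test_function_def)
  then show False using assms(2,3) by (auto simp: unit_cube_def interior_cbox mem_box)
qed

lemma test_function_L2: "test_function \<phi> \<Longrightarrow> L2 cube_measure \<phi>"
  by (intro continuous_L2_cube_measure smooth_imp_continuous test_function_smooth)

lemma test_function_pderiv_L2: "test_function \<phi> \<Longrightarrow> i \<in> Basis \<Longrightarrow> L2 cube_measure (pderiv_at i \<phi>)"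
  by (intro continuous_L2_cube_measure smooth_imp_continuous smooth_pderiv_at test_function_smooth)

text \<open>On the cube, mollified values are pairings of g with test functions, so they all vanish.
  The approximation error is then constantly the norm of g, yet it tends to zero.\<close>

lemma orthogonal_test_functions_imp_0:
  assumes g: "L2 cube_measure g" and orth: "\<And>\<phi>. test_function \<phi> \<Longrightarrow> L2_inner cube_measure g \<phi> = 0"
  shows "AE x in cube_measure. g x = 0"
proof (rule L2_norm_eq_0_AE[OF g])
  have "L2_norm cube_measure (\<lambda>x. mollify m g x - g x) = L2_norm cube_measure g" for m
  proof -
    have "mollify m g x = 0" if "x \<in> unit_cube" for x
      using orth[OF test_function_mollifier[OF that, of m]] by (simp add: mollify_eq L2_inner_def)
    then have "(LINT x|cube_measure. (norm (mollify m g x - g x))\<^sup>2)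
        = (LINT x|cube_measure. (norm (g x))\<^sup>2)"
      by (intro Bochner_Integration.integral_cong) auto
    then show ?thesis by (simp only: L2_norm_def)
  qed
  then have "(\<lambda>m :: nat. L2_norm cube_measure g) \<longlonglongrightarrow> 0" using mollify_tendsto[OF g] by simp
  then show "L2_norm cube_measure g = 0" using LIMSEQ_const_iff by blast
qed

lemma test_functions_separate:
  assumes "L2 cube_measure g" "L2 cube_measure h"
    and eq: "\<And>\<phi>. test_function \<phi> \<Longrightarrow> L2_inner cube_measure g \<phi> = L2_inner cube_measure h \<phi>"
  shows "AE x in cube_measure. g x = h x"
proof -
  have "AE x in cube_measure. g x - h x = 0"
    using assms by (intro orthogonal_test_functions_imp_0 L2_diff)
      (simp_all add: L2_inner_diff_left test_function_L2)
  then show ?thesis by simp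
qed

lemma has_weak_pderiv_unique:
  "has_weak_pderiv i f g \<Longrightarrow> has_weak_pderiv i f h \<Longrightarrow> AE x in cube_measure. g x = h x"
  unfolding has_weak_pderiv_def by (intro test_functions_separate) auto

lemma has_weak_pderiv_weak_pderiv: "has_weak_pderiv i f g \<Longrightarrow> has_weak_pderiv i f (weak_pderiv i f)"
  unfolding weak_pderiv_def by (rule someI[of "has_weak_pderiv i f"])

lemma weak_pderiv_unique:
  "has_weak_pderiv i f g \<Longrightarrow> AE x in cube_measure. weak_pderiv i f x = g x"
  using has_weak_pderiv_unique has_weak_pderiv_weak_pderiv by blast

lemma has_weak_pderiv_L2: "has_weak_pderiv i f g \<Longrightarrow> L2 cube_measure g"
  by (simp add: has_weak_pderiv_def)

text \<open>Frees the norms from the choice made inside \<open>weak_pderiv\<close>: any weak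
  derivative at hand may be used to compute them.\<close>

lemma L2_norm_weak_pderiv:
  assumes "has_weak_pderiv i f g"
  shows "L2_norm cube_measure (weak_pderiv i f) = L2_norm cube_measure g"
  using has_weak_pderiv_L2[OF assms] has_weak_pderiv_L2[OF has_weak_pderiv_weak_pderiv[OF assms]]
    weak_pderiv_unique[OF assms]
  by (intro L2_norm_cong_AE) (auto dest: L2_D1)

lemma H1_L2: "H1 f \<Longrightarrow> L2 cube_measure f"
  by (simp add: H1_def)

lemma H1_has_weak_pderiv: "H1 f \<Longrightarrow> i \<in> Basis \<Longrightarrow> has_weak_pderiv i f (weak_pderiv i f)"
  unfolding H1_def using has_weak_pderiv_weak_pderiv by blast

lemma H1_weak_pderiv_L2: "H1 f \<Longrightarrow> i \<in> Basis \<Longrightarrow> L2 cube_measure (weak_pderiv i f)"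
  using H1_has_weak_pderiv has_weak_pderiv_L2 by blast

lemma has_weak_pderiv_diff:
  assumes "has_weak_pderiv i f f'" "has_weak_pderiv i g g'" "L2 cube_measure f" "L2 cube_measure g"
    and i: "i \<in> Basis"
  shows "has_weak_pderiv i (\<lambda>x. f x - g x) (\<lambda>x. f' x - g' x)"
  using assms
  by (auto simp: has_weak_pderiv_def L2_diff L2_inner_diff_left test_function_L2
      test_function_pderiv_L2)

section \<open>Smooth functions in the Sobolev space and their density\<close>

lemma smooth_C_k: "smooth f \<Longrightarrow> C_k k f"
  by (simp add: smooth_def)

lemma has_weak_pderiv_smooth:
  fixes u :: "'a::euclidean_space \<Rightarrow> real"
  assumes u: "smooth u" and i: "i \<in> Basis"
  shows "has_weak_pderiv i u (pderiv_at i u)"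
  unfolding has_weak_pderiv_def
proof (intro conjI allI impI)
  show "L2 cube_measure (pderiv_at i u)"
    by (intro continuous_L2_cube_measure smooth_imp_continuous smooth_pderiv_at u i)
  fix \<phi> :: "'a \<Rightarrow> real" assume \<phi>: "test_function \<phi>"
  note s\<phi> = test_function_smooth[OF \<phi>]
  let ?w = "\<lambda>x. u x * \<phi> x"
  have w: "C_k 1 ?w" by (intro C_k_mult smooth_C_k u s\<phi>)
  \<comment> \<open>A test function vanishes on all faces, so the divergence theorem for the product
    has no boundary contribution and becomes integration by parts.\<close>
  have face0: "(LINT x|face_measure i c. ?w x) = 0" if c: "c \<in> {0, 1}" for c
  proof -
    have "AE x in face_measure i c. ?w x = 0"
      using AE_face_normal[OF i, of c] by eventually_elim (use c test_function_boundary[OF \<phi> i] in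
          auto)
    then show ?thesis by (rule integral_eq_zero_AE)
  qed
  have cont: "continuous_on UNIV (\<lambda>x. u x * pderiv_at i \<phi> x)" "continuous_on UNIV (\<lambda>x. pderiv_at i u
      x * \<phi> x)"
    by (intro continuous_intros smooth_imp_continuous smooth_pderiv_at u s\<phi> i)+
  have "0 = (LINT x|cube_borel. pderiv_at i ?w x)"
    unfolding divergence_cube[OF w i] by (simp add: face0)
  also have "\<dots> = (LINT x|cube_borel. u x * pderiv_at i \<phi> x + pderiv_at i u x * \<phi> x)"
    by (simp add: pderiv_at_mult smooth_differentiable u s\<phi>)
  also have "\<dots> = (LINT x|cube_borel. u x * pderiv_at i \<phi> x)
      + (LINT x|cube_borel. pderiv_at i u x * \<phi> x)"
    by (intro Bochner_Integration.integral_add continuous_integrable_cube cont)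
  also have "\<dots> = L2_inner cube_measure u (pderiv_at i \<phi>) + L2_inner cube_measure (pderiv_at i u) \<phi>"
    unfolding L2_inner_def
    by (simp only: integral_cube_measure_borel[OF borel_measurable_continuous_onI[OF cont(1)]]
        integral_cube_measure_borel[OF borel_measurable_continuous_onI[OF cont(2)]])
  finally show "L2_inner cube_measure u (pderiv_at i \<phi>) = - L2_inner cube_measure (pderiv_at i u) \<phi>"
      by simp
qed

lemma smooth_L2: "smooth u \<Longrightarrow> L2 cube_measure u"
  by (intro continuous_L2_cube_measure smooth_imp_continuous)

lemma H1_norm_nonneg: "H1_norm f \<ge> 0"
  unfolding H1_norm_def by (intro real_sqrt_ge_zero add_nonneg_nonneg sum_nonneg) auto

lemma H1_norm_sq:
  "(H1_norm f)\<^sup>2 = (L2_norm cube_measure f)\<^sup>2 + (\<Sum>i\<in>Basis. (L2_norm cube_measure (weak_pderiv i f))\<^sup>2)"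
  unfolding H1_norm_def by (intro real_sqrt_pow2 add_nonneg_nonneg sum_nonneg) auto

text \<open>The weak derivative of a difference is chosen afresh and is only almost everywhere the
  difference of the derivatives; norms do not see this.\<close>

lemma H1_norm_smooth_diff_sq:
  assumes "smooth u" "H1 f"
  shows "(H1_norm (\<lambda>x. u x - f x))\<^sup>2 = (L2_norm cube_measure (\<lambda>x. u x - f x))\<^sup>2
    + (\<Sum>i\<in>Basis. (L2_norm cube_measure (\<lambda>x. pderiv_at i u x - weak_pderiv i f x))\<^sup>2)"
  unfolding H1_norm_sq
  by (intro arg_cong2[where f = "(+)"] sum.cong refl arg_cong[where f
      = "\<lambda>t. t\<^sup>2"] L2_norm_weak_pderiv
      has_weak_pderiv_diff has_weak_pderiv_smooth H1_has_weak_pderiv smooth_L2 H1_L2 assms)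

lemma H1_norm_smooth_tendsto_iff:
  assumes u: "\<And>m. smooth (u m)" and f: "H1 f"
  shows "(\<lambda>m. H1_norm (\<lambda>x. u m x - f x)) \<longlonglongrightarrow> 0 \<longleftrightarrow>
    (\<lambda>m. L2_norm cube_measure (\<lambda>x. u m x - f x)) \<longlonglongrightarrow> 0 \<and>
    (\<forall>i\<in>Basis. (\<lambda>m. L2_norm cube_measure (\<lambda>x. pderiv_at i (u m) x - weak_pderiv i f x)) \<longlonglongrightarrow> 0)"
    (is "?L \<longleftrightarrow> ?Q \<and> (\<forall>i\<in>Basis. ?R i)")
proof
  assume L: ?L
  let ?N = "\<lambda>m. H1_norm (\<lambda>x. u m x - f x)"
  note sq = H1_norm_smooth_diff_sq[OF u f]
  have nn: "?N m \<ge> 0" for m by (rule H1_norm_nonneg)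
  have "L2_norm cube_measure (\<lambda>x. u m x - f x) \<le> ?N m" for m
    by (rule power2_le_imp_le[OF _ nn]) (simp add: sq sum_nonneg)
  then have ?Q by (intro Lim_null_comparison[OF _ L]) simp
  moreover have "?R i" if i: "i \<in> Basis" for i
  proof (rule Lim_null_comparison[OF _ L])
    have "L2_norm cube_measure (\<lambda>x. pderiv_at i (u m) x - weak_pderiv i f x) \<le> ?N m" for m
    proof (rule power2_le_imp_le[OF _ nn])
      have "(L2_norm cube_measure (\<lambda>x. pderiv_at i (u m) x - weak_pderiv i f x))\<^sup>2
          \<le> (\<Sum>i\<in>Basis. (L2_norm cube_measure (\<lambda>x. pderiv_at i (u m) x - weak_pderiv i f x))\<^sup>2)"
        using i by (intro member_le_sum) auto
      then show "(L2_norm cube_measure (\<lambda>x. pderiv_at i (u m) x - weak_pderiv i f x))\<^sup>2 \<le> (?N m)\<^sup>2"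
        unfolding sq by (simp add: add_increasing)
    qed
    then show "\<forall>\<^sub>F m in sequentially.
        norm (L2_norm cube_measure (\<lambda>x. pderiv_at i (u m) x - weak_pderiv i f x)) \<le> ?N m" by simp
  qed
  ultimately show "?Q \<and> (\<forall>i\<in>Basis. ?R i)" by blast
next
  assume R: "?Q \<and> (\<forall>i\<in>Basis. ?R i)"
  have "(\<lambda>m. sqrt ((H1_norm (\<lambda>x. u m x - f x))\<^sup>2)) \<longlonglongrightarrow> sqrt (0\<^sup>2 + (\<Sum>i\<in>(Basis :: 'a set). 0\<^sup>2))"
    unfolding H1_norm_smooth_diff_sq[OF u f] using R by (intro tendsto_intros) auto
  then show ?L by (simp add: H1_norm_nonneg)
qed

text \<open>The kernel depends on the contracted x minus y, so an x-derivative is -(1 - delta) times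
  a y-derivative, and the latter is moved onto f by the definition of the weak derivative. This
  works for x in the cube, where the kernel is a test function.\<close>

lemma pderiv_at_mollify:
  fixes f :: "'a::euclidean_space \<Rightarrow> real"
  assumes f: "L2 cube_measure f" and g: "has_weak_pderiv i f g" and i: "i \<in> Basis"
      and x: "x \<in> unit_cube"
  shows "pderiv_at i (mollify m f) x = (1 - delta m) * mollify m g x"
proof -
  let ?\<phi> = "\<lambda>y. mollifier (delta m / 4) (contract m x - y)"
  note s = smooth_cpt_smooth[OF smooth_cpt_mollifier]
  have "pderiv_at i (mollify m f) x
      = (1 - delta m) * conv f (pderiv_at i (mollifier (delta m / 4))) (1
          - delta m) ((delta m / 2) *\<^sub>R One) x"
    unfolding mollify_def pderiv_at_conv[OF L2_integrable_cube[OF f] smooth_cpt_mollifier i] ..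
  also have "conv f (pderiv_at i (mollifier (delta m / 4))) (1 - delta m) ((delta m / 2) *\<^sub>R One) x
      = - L2_inner cube_measure f (pderiv_at i ?\<phi>)"
    by (simp add: conv_def L2_inner_def pderiv_at_reflect[OF s] contract_def)
  also have "\<dots> = L2_inner cube_measure g ?\<phi>"
    using g test_function_mollifier[OF x, of m] by (simp add: has_weak_pderiv_def)
  also have "\<dots> = mollify m g x" by (simp add: mollify_eq L2_inner_def)
  finally show ?thesis .
qed

theorem H1_smooth_approx:
  fixes f :: "'a::euclidean_space \<Rightarrow> real"
  assumes f: "H1 f"
  shows "(\<lambda>m. H1_norm (\<lambda>x. mollify m f x - f x)) \<longlonglongrightarrow> 0"
proof -
  note Lf = H1_L2[OF f]
  have sm: "smooth (mollify m f)" for m by (rule smooth_mollify[OF Lf])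
  have "(\<lambda>m. L2_norm cube_measure (\<lambda>x. pderiv_at i (mollify m f) x - weak_pderiv i f x)) \<longlonglongrightarrow> 0"
    if i: "i \<in> Basis" for i
  proof -
    let ?g = "weak_pderiv i f"
    note Lg = H1_weak_pderiv_L2[OF f i]
    note Lm = smooth_L2[OF smooth_mollify[OF Lg]]
    let ?r = "\<lambda>m. L2_norm cube_measure (\<lambda>x. mollify m ?g x - ?g x)"
    \<comment> \<open>The error splits into the scaled mollification error of the weak derivative
      and the term -delta times that derivative, caused by the contraction.\<close>
    have "L2_norm cube_measure (\<lambda>x. pderiv_at i (mollify m f) x - ?g x)
        \<le> \<bar>1 - delta m\<bar> * ?r m + \<bar>- delta m\<bar> * L2_norm cube_measure ?g" for m
    proof -
      have "L2_norm cube_measure (\<lambda>x. pderiv_at i (mollify m f) x - ?g x)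
          = L2_norm cube_measure (\<lambda>x. (1 - delta m) * (mollify m ?g x - ?g x) + (- delta m) * ?g x)"
        unfolding L2_norm_def
      proof (intro arg_cong[where f = sqrt] Bochner_Integration.integral_cong refl)
        fix x :: 'a assume "x \<in> space cube_measure"
        then have "pderiv_at i (mollify m f) x = (1 - delta m) * mollify m ?g x"
          by (intro pderiv_at_mollify[OF Lf H1_has_weak_pderiv[OF f i] i]) simp
        then have "pderiv_at i (mollify m f) x - ?g x
            = (1 - delta m) * (mollify m ?g x - ?g x) + (- delta m) * ?g x"
          by (simp add: algebra_simps)
        then show "(norm (pderiv_at i (mollify m f) x - ?g x))\<^sup>2
            = (norm ((1 - delta m) * (mollify m ?g x - ?g x) + (- delta m) * ?g x))\<^sup>2"
          by (simp only:)
      qed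
      also have "\<dots> \<le> L2_norm cube_measure (\<lambda>x. (1 - delta m) * (mollify m ?g x - ?g x))
          + L2_norm cube_measure (\<lambda>x. (- delta m) * ?g x)"
        by (intro L2_norm_triangle L2_scale L2_diff Lm Lg)
      finally show ?thesis by (simp only: L2_norm_scale)
    qed
    then have "\<forall>\<^sub>F m in sequentially. norm (L2_norm cube_measure (\<lambda>x. pderiv_at i (mollify m f) x
        - ?g x))
        \<le> \<bar>1 - delta m\<bar> * ?r m + \<bar>- delta m\<bar> * L2_norm cube_measure ?g"
      by simp
    then show ?thesis
    proof (rule Lim_null_comparison)
      have "(\<lambda>m. \<bar>1 - delta m\<bar> * ?r m + \<bar>- delta m\<bar> * L2_norm cube_measure ?g)
          \<longlonglongrightarrow> \<bar>1 - 0\<bar> * 0 + \<bar>- 0\<bar> * L2_norm cube_measure ?g"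
        by (intro tendsto_intros delta_tendsto mollify_tendsto[OF Lg])
      then show "(\<lambda>m. \<bar>1 - delta m\<bar> * ?r m + \<bar>- delta m\<bar> * L2_norm cube_measure ?g) \<longlonglongrightarrow> 0" by simp
    qed
  qed
  then show ?thesis
    unfolding H1_norm_smooth_tendsto_iff[OF sm f] using mollify_tendsto[OF Lf] by blast
qed

section \<open>Completeness of the space of square integrable functions\<close>

lemma L2_nn_integral: "L2 M f \<Longrightarrow> (\<integral>\<^sup>+x. ennreal ((f x)\<^sup>2) \<partial>M) = ennreal ((L2_norm M f)\<^sup>2)"
  by (simp add: nn_integral_eq_integral L2_norm_sq_eq L2_D2)

text \<open>Because of the weights \<open>4 ^ k\<close>, integrability of the sum of squares already forces the
  increments to decay geometrically at almost every point.\<close>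

lemma L2_Cauchy_AE_convergent:
  fixes u :: "nat \<Rightarrow> 'a \<Rightarrow> real"
  assumes u: "\<And>k. L2 M (u k)"
    and fast: "\<And>k. L2_norm M (\<lambda>x. u (Suc k) x - u k x) \<le> (1 / 4) ^ k"
  shows "AE x in M. convergent (\<lambda>k. u k x)"
proof -
  note u[THEN L2_D1, measurable]
  let ?d = "\<lambda>k x. u (Suc k) x - u k x"
  have "(\<integral>\<^sup>+x. (\<Sum>k. ennreal (4 ^ k * (?d k x)\<^sup>2)) \<partial>M) = (\<Sum>k. \<integral>\<^sup>+x. ennreal (4 ^ k * (?d k x)\<^sup>2) \<partial>M)"
    by (rule nn_integral_suminf) measurable
  \<comment> \<open>The weight 4^k meets a squared norm of at most 16^(-k), leaving a geometric
    series.\<close>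
  also have "\<dots> \<le> (\<Sum>k. ennreal ((1 / 4) ^ k))"
  proof (intro suminf_le summableI)
    fix k
    have "(\<integral>\<^sup>+x. ennreal (4 ^ k * (?d k x)\<^sup>2) \<partial>M) = ennreal (4 ^ k) * ennreal ((L2_norm M (?d k))\<^sup>2)"
      by (simp add: ennreal_mult nn_integral_cmult L2_nn_integral L2_diff u)
    also have "\<dots> \<le> ennreal (4 ^ k) * ennreal (((1 / 4) ^ k)\<^sup>2)"
      by (intro mult_left_mono ennreal_leI power_mono fast) auto
    also have "\<dots> = ennreal ((1 / 4) ^ k)"
      by (simp add: ennreal_mult[symmetric] power2_eq_square power_divide)
    finally show "(\<integral>\<^sup>+x. ennreal (4 ^ k * (?d k x)\<^sup>2) \<partial>M) \<le> ennreal ((1 / 4) ^ k)" .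
  qed
  also have "\<dots> < \<infinity>"
    by (subst suminf_ennreal_eq[OF _ geometric_sums]) auto
  finally have "AE x in M. (\<Sum>k. ennreal (4 ^ k * (?d k x)\<^sup>2)) \<noteq> \<infinity>"
    by (intro nn_integral_noteq_infinite) auto
  then show ?thesis
  proof eventually_elim
    case (elim x)
    then have "summable (\<lambda>k. 4 ^ k * (?d k x)\<^sup>2)"
      by (intro summable_suminf_not_top) auto
    then have "Bseq (\<lambda>k. 4 ^ k * (?d k x)\<^sup>2)"
      by (intro convergent_imp_Bseq) (auto simp: convergent_def dest: summable_LIMSEQ_zero)
    then obtain B where B: "B > 0" "\<And>k. 4 ^ k * (?d k x)\<^sup>2 \<le> B"
      by (auto simp: Bseq_def abs_mult)
    have "norm (?d k x) \<le> sqrt B * (1 / 2) ^ k" for k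
    proof (rule power2_le_imp_le)
      have "((2 :: real) ^ k)\<^sup>2 = 4 ^ k" by (simp add: power2_eq_square flip: power_mult_distrib)
      then show "(norm (?d k x))\<^sup>2 \<le> (sqrt B * (1 / 2) ^ k)\<^sup>2"
        using B(1) B(2)[of k] by (simp add: power_mult_distrib power_divide field_simps)
    qed (use B(1) in simp)
    then have "summable (\<lambda>k. ?d k x)"
      by (intro summable_comparison_test[OF _ summable_mult[OF summable_geometric[of "1 / 2 ::
          real"]]]) auto
    then have "convergent (\<lambda>n. \<Sum>k<n. ?d k x)" by (simp add: summable_iff_convergent)
    then have "convergent (\<lambda>n. u n x - u 0 x)" by (simp add: sum_lessThan_telescope[of "\<lambda>n. u n x"])
    from convergent_add[OF this convergent_const[of "u 0 x"]] show ?case by simp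
  qed
qed

text \<open>Riesz-Fischer: a rapidly converging subsequence has a pointwise limit almost everywhere,
  and Fatou's lemma upgrades this to convergence in norm of the full sequence.\<close>

theorem L2_complete:
  fixes u :: "nat \<Rightarrow> 'a \<Rightarrow> real"
  assumes u: "\<And>m. L2 M (u m)"
    and cauchy: "\<And>e. e > 0 \<Longrightarrow> \<exists>N. \<forall>m\<ge>N. \<forall>n\<ge>N. L2_norm M (\<lambda>x. u m x - u n x) < e"
  shows "\<exists>g. L2 M g \<and> (\<lambda>m. L2_norm M (\<lambda>x. u m x - g x)) \<longlonglongrightarrow> 0"
proof -
  note u[THEN L2_D1, measurable]
  have "\<forall>k. \<exists>N. \<forall>m\<ge>N. \<forall>n\<ge>N. L2_norm M (\<lambda>x. u m x - u n x) < (1 / 4) ^ k"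
    by (intro allI cauchy) simp
  then obtain N where N: "\<And>k m n. m \<ge> N k \<Longrightarrow> n \<ge> N k \<Longrightarrow> L2_norm M (\<lambda>x. u m x - u n x) < (1 / 4) ^ k"
    by metis
  \<comment> \<open>Summing the thresholds makes both \<open>r k\<close> and
    \<open>r (Suc k)\<close> at least \<open>N k\<close>; the added k forces r to infinity.\<close>
  define r where "r k = (\<Sum>j\<le>k. N j) + k" for k
  have "N k \<le> (\<Sum>j\<le>k. N j)" for k by (rule member_le_sum) auto
  then have r: "r k \<ge> N k" "r (Suc k) \<ge> N k" "r k \<ge> k" for k
    by (auto simp: r_def intro: trans_le_add1 le_SucI)
  have conv: "AE x in M. convergent (\<lambda>k. u (r k) x)"
    by (intro L2_Cauchy_AE_convergent u less_imp_le N r)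
  define g where "g x = lim (\<lambda>k. u (r k) x)" for x
  have [measurable]: "g \<in> borel_measurable M"
    unfolding g_def[abs_def] by measurable
  have close: "(\<integral>\<^sup>+x. ennreal ((u m x - g x)\<^sup>2) \<partial>M) \<le> ennreal (e\<^sup>2)"
    if e: "e > 0" and n0: "\<forall>m\<ge>n0. \<forall>n\<ge>n0. L2_norm M (\<lambda>x. u m x - u n x) < e" and m: "m \<ge> n0"
        for e n0 m
  proof -
    have "(\<integral>\<^sup>+x. ennreal ((u m x - g x)\<^sup>2) \<partial>M)
        = (\<integral>\<^sup>+x. liminf (\<lambda>k. ennreal ((u m x - u (r k) x)\<^sup>2)) \<partial>M)"
    proof (rule nn_integral_cong_AE)
      show "AE x in M. ennreal ((u m x - g x)\<^sup>2) = liminf (\<lambda>k. ennreal ((u m x - u (r k) x)\<^sup>2))"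
        using conv
      proof eventually_elim
        case (elim x)
        then have "(\<lambda>k. u (r k) x) \<longlonglongrightarrow> g x" by (simp add: convergent_LIMSEQ_iff g_def)
        then have "(\<lambda>k. ennreal ((u m x - u (r k) x)\<^sup>2)) \<longlonglongrightarrow> ennreal ((u m x - g x)\<^sup>2)"
          by (intro tendsto_intros)
        then show ?case by (intro lim_imp_Liminf[symmetric]) auto
      qed
    qed
    \<comment> \<open>Fatou's lemma; for large k the index \<open>r k\<close> passes the Cauchy
      threshold.\<close>
    also have "\<dots> \<le> liminf (\<lambda>k. \<integral>\<^sup>+x. ennreal ((u m x - u (r k) x)\<^sup>2) \<partial>M)"
      by (rule nn_integral_liminf) measurable
    also have "\<dots> \<le> liminf (\<lambda>k :: nat. ennreal (e\<^sup>2))"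
    proof (rule Liminf_mono)
      show "\<forall>\<^sub>F k in sequentially. (\<integral>\<^sup>+x. ennreal ((u m x - u (r k) x)\<^sup>2) \<partial>M) \<le> ennreal (e\<^sup>2)"
        using eventually_ge_at_top[of n0]
      proof eventually_elim
        case (elim k)
        then have "r k \<ge> n0" using r(3)[of k] by linarith
        then have "L2_norm M (\<lambda>x. u m x - u (r k) x) \<le> e" using n0 m by (simp add: less_imp_le)
        then show ?case by (simp add: L2_nn_integral L2_diff u power_mono ennreal_leI)
      qed
    qed
    also have "\<dots> = ennreal (e\<^sup>2)" by (simp add: Liminf_const)
    finally show ?thesis .
  qed
  have Lum: "L2 M (\<lambda>x. u m x - g x) \<and> L2_norm M (\<lambda>x. u m x - g x) \<le> e"
    if "e > 0" "\<forall>m\<ge>n0. \<forall>n\<ge>n0. L2_norm M (\<lambda>x. u m x - u n x) < e" "m \<ge> n0" for e n0 m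
  proof
    note c = close[OF that]
    show L: "L2 M (\<lambda>x. u m x - g x)"
      unfolding L2_def
      using le_less_trans[OF c ennreal_less_top] by (auto simp: integrable_iff_bounded)
    have "(L2_norm M (\<lambda>x. u m x - g x))\<^sup>2 \<le> e\<^sup>2"
      using c unfolding L2_nn_integral[OF L] by (subst (asm) ennreal_le_iff) auto
    then show "L2_norm M (\<lambda>x. u m x - g x) \<le> e"
      using that(1) by (rule power2_le_imp_le[OF _ less_imp_le])
  qed
  obtain n1 where n1: "\<forall>m\<ge>n1. \<forall>n\<ge>n1. L2_norm M (\<lambda>x. u m x - u n x) < 1"
    using cauchy[of 1] by auto
  have "L2 M (\<lambda>x. u n1 x - (u n1 x - g x))"
    by (rule L2_diff[OF u]) (use Lum[OF _ n1, of n1] in simp)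
  then have "L2 M g" by simp
  moreover have "(\<lambda>m. L2_norm M (\<lambda>x. u m x - g x)) \<longlonglongrightarrow> 0"
  proof (rule LIMSEQ_I)
    fix e :: real assume e: "e > 0"
    then obtain n0 where n0: "\<forall>m\<ge>n0. \<forall>n\<ge>n0. L2_norm M (\<lambda>x. u m x - u n x) < e / 2"
      using cauchy[of "e / 2"] by auto
    have "norm (L2_norm M (\<lambda>x. u m x - g x) - 0) < e" if "m \<ge> n0" for m
      using Lum[OF _ n0 that] e by simp
    then show "\<exists>n0. \<forall>m\<ge>n0. norm (L2_norm M (\<lambda>x. u m x - g x) - 0) < e" by blast
  qed
  ultimately show ?thesis by blast
qed

section \<open>Traces\<close>

lemma smooth_norms_borel:
  fixes u :: "'a::euclidean_space \<Rightarrow> real"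
  assumes "continuous_on UNIV u"
  shows "(L2_norm cube_measure u)\<^sup>2 = (LINT x|cube_borel. (u x)\<^sup>2)"
  using L2_norm_cube_measure_borel[OF borel_measurable_continuous_onI[OF assms]]
  by (simp add: L2_norm_sq_eq)

lemma bdry_norm_sq:
  fixes u :: "'a::euclidean_space \<Rightarrow> real"
  assumes "continuous_on UNIV u"
  shows "(L2_norm bdry_measure u)\<^sup>2 = (\<Sum>i\<in>Basis. \<Sum>c\<in>{0, 1}. LINT x|face_measure i c. (u x)\<^sup>2)"
  unfolding L2_norm_sq_eq
  by (intro integral_bdry_measure continuous_integrable_bdry continuous_on_power assms)

text \<open>There are 2 d faces, and each contributes at most twice the squared Sobolev
  norm.\<close>

lemma smooth_trace_le:
  fixes u :: "'a::euclidean_space \<Rightarrow> real"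
  assumes u: "smooth u"
  shows "(L2_norm bdry_measure u)\<^sup>2 \<le> 4 * real DIM('a) *
    ((L2_norm cube_measure u)\<^sup>2 + (\<Sum>i\<in>Basis. (L2_norm cube_measure (pderiv_at i u))\<^sup>2))" (is "_
        \<le> 4 * _ * ?N")
proof -
  have c: "continuous_on UNIV u" "\<And>i. i \<in> Basis \<Longrightarrow> continuous_on UNIV (pderiv_at i u)"
    by (intro smooth_imp_continuous smooth_pderiv_at u; assumption)+
  have "(LINT x|face_measure i c. (u x)\<^sup>2) \<le> 2 * ?N" if i: "i \<in> Basis" and c01: "c \<in> {0, 1}" for i c
  proof -
    have "(L2_norm cube_measure (pderiv_at i u))\<^sup>2 \<le> (\<Sum>i\<in>Basis. (L2_norm cube_measure (pderiv_at i
        u))\<^sup>2)"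
      using i by (intro member_le_sum) auto
    then show ?thesis
      using face_trace_le[OF smooth_C_k[OF u] i c01]
      by (simp add: smooth_norms_borel c i)
  qed
  then have "(\<Sum>i\<in>(Basis :: 'a set). \<Sum>c\<in>{0, 1}. LINT x|face_measure i c. (u x)\<^sup>2)
      \<le> (\<Sum>i\<in>(Basis :: 'a set). \<Sum>c\<in>{0, 1 :: real}. 2 * ?N)"
    by (intro sum_mono) blast
  then show ?thesis unfolding bdry_norm_sq[OF c(1)] by (simp add: algebra_simps)
qed

lemma smooth_diff: "smooth u \<Longrightarrow> smooth w \<Longrightarrow> smooth (\<lambda>x. u x - w x)"
  unfolding smooth_def using C_k_add[of _ u "\<lambda>x. (-1) * w x"] C_k_cmult[of _ w "-1"] by simp

lemma pderiv_at_diff: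
  assumes "smooth u" "smooth w"
  shows "pderiv_at i (\<lambda>x. u x - w x) x = pderiv_at i u x - pderiv_at i w x"
  using pderiv_at_eqI[OF has_derivative_diff[OF smooth_differentiable[OF assms(1), unfolded
      frechet_derivative_works]
        smooth_differentiable[OF assms(2), unfolded frechet_derivative_works]]]
  by (simp add: pderiv_at_def)

lemma L2_norm_via_limit:
  assumes "L2 M u" "L2 M w" "L2 M f"
  shows "L2_norm M (\<lambda>x. u x - w x) \<le> L2_norm M (\<lambda>x. u x - f x) + L2_norm M (\<lambda>x. w x - f x)"
  using L2_norm_triangle_diff[OF L2_diff[OF assms(1,3)] L2_diff[OF assms(2,3)]] by simp

lemma smooth_L2_bdry: "smooth u \<Longrightarrow> L2 bdry_measure u"
  by (intro continuous_L2_bdry smooth_imp_continuous)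

text \<open>The mollifications of f are Cauchy in the Sobolev norm. The trace inequality for smooth
  functions, applied to their differences, makes them Cauchy on the boundary, and completeness
  yields the trace.\<close>

theorem has_bdry_trace_exists:
  fixes f :: "'a::euclidean_space \<Rightarrow> real"
  assumes f: "H1 f"
  shows "\<exists>g. has_bdry_trace f g"
proof -
  let ?u = "\<lambda>m. mollify m f"
  have s: "smooth (?u m)" for m by (rule smooth_mollify[OF H1_L2[OF f]])
  have conv: "(\<lambda>m. L2_norm cube_measure (\<lambda>x. ?u m x - f x)) \<longlonglongrightarrow> 0"
    "\<And>i. i \<in> Basis \<Longrightarrow> (\<lambda>m. L2_norm cube_measure (\<lambda>x. pderiv_at i (?u m) x - weak_pderiv i f x)) \<longlonglongrightarrow> 0"
    using H1_smooth_approx[OF f] H1_norm_smooth_tendsto_iff[of ?u, OF s f] by auto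
  \<comment> \<open>A sum of norms serves as error measure in place of \<open>H1_norm\<close>, so
    that each part of the triangle inequality is that of \<open>L2_norm\<close>.\<close>
  define a where "a m = L2_norm cube_measure (\<lambda>x. ?u m x - f x)
    + (\<Sum>i\<in>Basis. L2_norm cube_measure (\<lambda>x. pderiv_at i (?u m) x - weak_pderiv i f x))" for m
  have "a \<longlonglongrightarrow> 0 + (\<Sum>i\<in>(Basis :: 'a set). 0)"
    unfolding a_def by (intro tendsto_add tendsto_sum conv)
  then have a0: "a \<longlonglongrightarrow> 0" by simp
  have a_nn: "a m \<ge> 0" for m by (simp add: a_def sum_nonneg)
  define D where "D = real DIM('a)"
  have D: "D \<ge> 1" by (simp add: D_def Suc_leI)
  have est: "L2_norm bdry_measure (\<lambda>x. ?u m x - ?u n x) \<le> 3 * D * (a m + a n)" for m n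
  proof (rule power2_le_imp_le)
    let ?s = "a m + a n"
    have 0: "L2_norm cube_measure (\<lambda>x. ?u m x - ?u n x) \<le> ?s"
    proof -
      have "L2_norm cube_measure (\<lambda>x. ?u m x - f x) \<le> a m" for m
        by (simp add: a_def sum_nonneg)
      then show ?thesis
        using L2_norm_via_limit[OF smooth_L2[OF s] smooth_L2[OF s] H1_L2[OF f]]
        by (meson add_mono order.trans)
    qed
    have 1: "L2_norm cube_measure (pderiv_at i (\<lambda>x. ?u m x - ?u n x)) \<le> ?s" if i: "i \<in> Basis" for i
    proof -
      have "L2_norm cube_measure (\<lambda>x. pderiv_at i (?u m) x - weak_pderiv i f x) \<le> a m" for m
      proof -
        have "L2_norm cube_measure (\<lambda>x. pderiv_at i (?u m) x - weak_pderiv i f x)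
          \<le> (\<Sum>i\<in>Basis. L2_norm cube_measure (\<lambda>x. pderiv_at i (?u m) x - weak_pderiv i f x))"
          using i by (intro member_le_sum) auto
        then show ?thesis unfolding a_def using L2_norm_nonneg
            by (rule order.trans[OF _ le_add_same_cancel2[THEN iffD2]])
      qed
      then show ?thesis
        unfolding pderiv_at_diff[OF s s, abs_def]
        using L2_norm_via_limit[OF smooth_L2[OF smooth_pderiv_at[OF s i]] smooth_L2[OF
            smooth_pderiv_at[OF s i]] H1_weak_pderiv_L2[OF f i]]
        by (meson add_mono order.trans)
    qed
    have "(L2_norm bdry_measure (\<lambda>x. ?u m x - ?u n x))\<^sup>2 \<le> 4 * D *
        ((L2_norm cube_measure (\<lambda>x. ?u m x - ?u n x))\<^sup>2
          + (\<Sum>i\<in>Basis. (L2_norm cube_measure (pderiv_at i (\<lambda>x. ?u m x - ?u n x)))\<^sup>2))"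
      unfolding D_def by (rule smooth_trace_le[OF smooth_diff[OF s s]])
    also have "\<dots> \<le> 4 * D * (?s\<^sup>2 + (\<Sum>i\<in>(Basis :: 'a set). ?s\<^sup>2))"
      using D by (intro mult_left_mono add_mono sum_mono power_mono 0 1) auto
    also have "\<dots> = (4 * D + 4 * D * D) * ?s\<^sup>2" by (simp add: D_def algebra_simps)
    \<comment> \<open>Since D is at least 1, 4 D + 4 D^2 is at most 8 D^2; rounding up to 9 gives a
      perfect square.\<close>
    also have "\<dots> \<le> (9 * D * D) * ?s\<^sup>2"
      using mult_left_mono[OF D, of D] D by (intro mult_right_mono) auto
    also have "\<dots> = (3 * D * ?s)\<^sup>2" by (simp add: power2_eq_square)
    finally show "(L2_norm bdry_measure (\<lambda>x. ?u m x - ?u n x))\<^sup>2 \<le> (3 * D * ?s)\<^sup>2" .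
    show "0 \<le> 3 * D * ?s" using D a_nn[of m] a_nn[of n] by simp
  qed
  have "\<exists>g. L2 bdry_measure g \<and> (\<lambda>m. L2_norm bdry_measure (\<lambda>x. ?u m x - g x)) \<longlonglongrightarrow> 0"
  proof (rule L2_complete[OF smooth_L2_bdry[OF s]])
    fix e :: real assume e: "e > 0"
    then have "e / (6 * D) > 0" using D by simp
    with a0 have "\<forall>\<^sub>F m in sequentially. a m < e / (6 * D)" by (rule order_tendstoD(2))
    then obtain N where N: "\<And>m. m \<ge> N \<Longrightarrow> a m < e / (6 * D)" by (auto simp: eventually_sequentially)
    have "L2_norm bdry_measure (\<lambda>x. ?u m x - ?u n x) < e" if "m \<ge> N" "n \<ge> N" for m n
    proof -
      have "3 * D * (a m + a n) < 3 * D * (e / (6 * D) + e / (6 * D))"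
        using N[OF that(1)] N[OF that(2)] D by (intro mult_strict_left_mono) auto
      also have "\<dots> = e" using D by (simp add: field_simps)
      finally show ?thesis using est[of m n] by linarith
    qed
    then show "\<exists>N. \<forall>m\<ge>N. \<forall>n\<ge>N. L2_norm bdry_measure (\<lambda>x. ?u m x - ?u n x) < e" by blast
  qed
  then obtain g where "L2 bdry_measure g" "(\<lambda>m. L2_norm bdry_measure (\<lambda>x. ?u m x - g x)) \<longlonglongrightarrow> 0"
    by blast
  then show ?thesis
    unfolding has_bdry_trace_def using s H1_smooth_approx[OF f]
    by (intro exI[of _ g] conjI exI[of _ ?u] allI)
qed

text \<open>Everything later said about \<open>bdry_trace\<close> comes from this sequence, which
  belongs to the very representative that was chosen.\<close>

lemma H1_smooth_approx_trace:
  fixes f :: "'a::euclidean_space \<Rightarrow> real"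
  assumes f: "H1 f"
  obtains u :: "nat \<Rightarrow> 'a \<Rightarrow> real" where "\<And>m. smooth (u m)"
    "(\<lambda>m. L2_norm cube_measure (\<lambda>x. u m x - f x)) \<longlonglongrightarrow> 0"
    "\<And>i. i \<in> Basis \<Longrightarrow> (\<lambda>m. L2_norm cube_measure (\<lambda>x. pderiv_at i (u m) x - weak_pderiv i f x)) \<longlonglongrightarrow> 0"
    "L2 bdry_measure (bdry_trace f)"
    "(\<lambda>m. L2_norm bdry_measure (\<lambda>x. u m x - bdry_trace f x)) \<longlonglongrightarrow> 0"
proof -
  have "has_bdry_trace f (bdry_trace f)"
    unfolding bdry_trace_def using has_bdry_trace_exists[OF f] by (rule someI_ex)
  then obtain u where L: "L2 bdry_measure (bdry_trace f)" and u: "\<And>m. smooth (u m)"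
      "(\<lambda>m. H1_norm (\<lambda>x. u m x - f x)) \<longlonglongrightarrow> 0"
      "(\<lambda>m. L2_norm bdry_measure (\<lambda>x. u m x - bdry_trace f x)) \<longlonglongrightarrow> 0"
    unfolding has_bdry_trace_def by blast
  have c: "(\<lambda>m. L2_norm cube_measure (\<lambda>x. u m x - f x)) \<longlonglongrightarrow> 0"
    "\<And>i. i \<in> Basis \<Longrightarrow> (\<lambda>m. L2_norm cube_measure (\<lambda>x. pderiv_at i (u m) x - weak_pderiv i f x)) \<longlonglongrightarrow> 0"
    using u(2) unfolding H1_norm_smooth_tendsto_iff[OF u(1) f] by auto
  show ?thesis by (rule that[OF u(1) c L u(3)])
qed

lemma bdry_trace_L2: "H1 f \<Longrightarrow> L2 bdry_measure (bdry_trace f)"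
  by (rule H1_smooth_approx_trace) auto

section \<open>Inequalities in the Sobolev space\<close>

abbreviation grad_sq :: "('a::euclidean_space \<Rightarrow> real) \<Rightarrow> real" where
  "grad_sq f \<equiv> (\<Sum>i\<in>Basis. (L2_norm cube_measure (weak_pderiv i f))\<^sup>2)"

text \<open>One sequence along which every quantity of the trace, Friedrichs and Poincare
  inequalities converges; these inequalities are closed under limits.\<close>

lemma H1_limits:
  fixes f :: "'a::euclidean_space \<Rightarrow> real"
  assumes f: "H1 f"
  obtains u :: "nat \<Rightarrow> 'a \<Rightarrow> real" where "\<And>m. smooth (u m)"
    "(\<lambda>m. (L2_norm cube_measure (u m))\<^sup>2) \<longlonglongrightarrow> (L2_norm cube_measure f)\<^sup>2"
    "(\<lambda>m. \<Sum>i\<in>Basis. (L2_norm cube_measure (pderiv_at i (u m)))\<^sup>2) \<longlonglongrightarrow> grad_sq f"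
    "(\<lambda>m. (L2_norm bdry_measure (u m))\<^sup>2) \<longlonglongrightarrow> (L2_norm bdry_measure (bdry_trace f))\<^sup>2"
    "(\<lambda>m. LINT x|cube_measure. u m x) \<longlonglongrightarrow> (LINT x|cube_measure. f x)"
proof -
  obtain u :: "nat \<Rightarrow> 'a \<Rightarrow> real" where u: "\<And>m. smooth (u m)"
    "(\<lambda>m. L2_norm cube_measure (\<lambda>x. u m x - f x)) \<longlonglongrightarrow> 0"
    "\<And>i. i \<in> Basis \<Longrightarrow> (\<lambda>m. L2_norm cube_measure (\<lambda>x. pderiv_at i (u m) x - weak_pderiv i f x)) \<longlonglongrightarrow> 0"
    "L2 bdry_measure (bdry_trace f)"
    "(\<lambda>m. L2_norm bdry_measure (\<lambda>x. u m x - bdry_trace f x)) \<longlonglongrightarrow> 0"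
    using H1_smooth_approx_trace[OF f] by blast
  have one: "L2 cube_measure (\<lambda>x :: 'a. 1)" by (rule continuous_L2_cube_measure) simp
  show ?thesis
  proof (rule that[OF u(1)])
    show "(\<lambda>m. (L2_norm cube_measure (u m))\<^sup>2) \<longlonglongrightarrow> (L2_norm cube_measure f)\<^sup>2"
      by (intro tendsto_power tendsto_L2_norm[OF smooth_L2[OF u(1)] H1_L2[OF f] u(2)])
    show "(\<lambda>m. \<Sum>i\<in>Basis. (L2_norm cube_measure (pderiv_at i (u m)))\<^sup>2) \<longlonglongrightarrow> grad_sq f"
      by (intro tendsto_sum tendsto_power
          tendsto_L2_norm[OF smooth_L2[OF smooth_pderiv_at[OF u(1)]] H1_weak_pderiv_L2[OF f] u(3)])
    show "(\<lambda>m. (L2_norm bdry_measure (u m))\<^sup>2) \<longlonglongrightarrow> (L2_norm bdry_measure (bdry_trace f))\<^sup>2"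
      by (intro tendsto_power tendsto_L2_norm[OF smooth_L2_bdry[OF u(1)] u(4,5)])
    have "(\<lambda>m. L2_inner cube_measure (u m) (\<lambda>x. 1)) \<longlonglongrightarrow> L2_inner cube_measure f (\<lambda>x. 1)"
      by (rule tendsto_L2_inner[OF smooth_L2[OF u(1)] H1_L2[OF f] u(2) one one]) simp
    then show "(\<lambda>m. LINT x|cube_measure. u m x) \<longlonglongrightarrow> (LINT x|cube_measure. f x)"
      by (simp add: L2_inner_def)
  qed
qed

theorem H1_trace_le:
  fixes f :: "'a::euclidean_space \<Rightarrow> real"
  assumes f: "H1 f"
  shows "(L2_norm bdry_measure (bdry_trace f))\<^sup>2 \<le> 4 * real DIM('a) * (H1_norm f)\<^sup>2"
proof -
  obtain u :: "nat \<Rightarrow> 'a \<Rightarrow> real" where u: "\<And>m. smooth (u m)"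
    "(\<lambda>m. (L2_norm cube_measure (u m))\<^sup>2) \<longlonglongrightarrow> (L2_norm cube_measure f)\<^sup>2"
    "(\<lambda>m. \<Sum>i\<in>Basis. (L2_norm cube_measure (pderiv_at i (u m)))\<^sup>2) \<longlonglongrightarrow> grad_sq f"
    "(\<lambda>m. (L2_norm bdry_measure (u m))\<^sup>2) \<longlonglongrightarrow> (L2_norm bdry_measure (bdry_trace f))\<^sup>2"
    using H1_limits[OF f] by metis
  show ?thesis
    unfolding H1_norm_sq
    by (rule tendsto_le[OF _ _ u(4)])
      (auto intro!: tendsto_mult tendsto_add u(2,3) always_eventually smooth_trace_le u(1))
qed

theorem H1_friedrichs:
  fixes f :: "'a::euclidean_space \<Rightarrow> real"
  assumes f: "H1 f"
  shows "(L2_norm cube_measure f)\<^sup>2 \<le> 2 * (L2_norm bdry_measure (bdry_trace f))\<^sup>2 + 2 * grad_sq f"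
proof -
  obtain u :: "nat \<Rightarrow> 'a \<Rightarrow> real" where u: "\<And>m. smooth (u m)"
    "(\<lambda>m. (L2_norm cube_measure (u m))\<^sup>2) \<longlonglongrightarrow> (L2_norm cube_measure f)\<^sup>2"
    "(\<lambda>m. \<Sum>i\<in>Basis. (L2_norm cube_measure (pderiv_at i (u m)))\<^sup>2) \<longlonglongrightarrow> grad_sq f"
    "(\<lambda>m. (L2_norm bdry_measure (u m))\<^sup>2) \<longlonglongrightarrow> (L2_norm bdry_measure (bdry_trace f))\<^sup>2"
    using H1_limits[OF f] by metis
  have "(L2_norm cube_measure (u m))\<^sup>2 \<le> 2 * (L2_norm bdry_measure (u m))\<^sup>2
      + 2 * (\<Sum>i\<in>Basis. (L2_norm cube_measure (pderiv_at i (u m)))\<^sup>2)" for m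
  proof -
    \<comment> \<open>Any direction will do: the face at 0 and the i-th derivative are each a single
      summand of the right-hand side.\<close>
    obtain i :: 'a where i: "i \<in> Basis" using nonempty_Basis by blast
    have c: "continuous_on UNIV (u m)" "continuous_on UNIV (pderiv_at i (u m))"
      by (intro smooth_imp_continuous smooth_pderiv_at u(1) i)+
    have nn: "0 \<le> (LINT x|face_measure j c. (u m x)\<^sup>2)" for j c by simp
    have "(LINT x|face_measure i 0. (u m x)\<^sup>2) \<le> (\<Sum>c\<in>{0, 1}. LINT x|face_measure i c. (u m x)\<^sup>2)"
      using nn by simp
    also have "\<dots> \<le> (L2_norm bdry_measure (u m))\<^sup>2"
      unfolding bdry_norm_sq[OF c(1)]
      using i by (intro member_le_sum[where f = "\<lambda>i. \<Sum>c\<in>{0, 1}. LINT x|face_measure i c. (u m x)\<^sup>2"]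
          sum_nonneg nn) auto
    finally have "(LINT x|face_measure i 0. (u m x)\<^sup>2) \<le> (L2_norm bdry_measure (u m))\<^sup>2" .
    moreover have "(L2_norm cube_measure (pderiv_at i (u m)))\<^sup>2
        \<le> (\<Sum>i\<in>Basis. (L2_norm cube_measure (pderiv_at i (u m)))\<^sup>2)"
      using i by (intro member_le_sum) auto
    ultimately show ?thesis
      using cube_friedrichs[OF smooth_C_k[OF u(1)] i, of m]
      unfolding smooth_norms_borel[OF c(1)] smooth_norms_borel[OF c(2), symmetric] by linarith
  qed
  moreover have "(\<lambda>m. 2 * (L2_norm bdry_measure (u m))\<^sup>2
      + 2 * (\<Sum>i\<in>Basis. (L2_norm cube_measure (pderiv_at i (u m)))\<^sup>2))
      \<longlonglongrightarrow> 2 * (L2_norm bdry_measure (bdry_trace f))\<^sup>2 + 2 * grad_sq f"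
    by (intro tendsto_add tendsto_mult tendsto_const u(3,4))
  ultimately show ?thesis by (intro LIMSEQ_le[OF u(2)]) blast+
qed

theorem H1_poincare:
  fixes f :: "'a::euclidean_space \<Rightarrow> real"
  assumes f: "H1 f"
  shows "(L2_norm cube_measure f)\<^sup>2 \<le> (LINT x|cube_measure. f x)\<^sup>2
      + 2 ^ DIM('a) * real DIM('a) * grad_sq f"
proof -
  obtain u :: "nat \<Rightarrow> 'a \<Rightarrow> real" where u: "\<And>m. smooth (u m)"
    "(\<lambda>m. (L2_norm cube_measure (u m))\<^sup>2) \<longlonglongrightarrow> (L2_norm cube_measure f)\<^sup>2"
    "(\<lambda>m. \<Sum>i\<in>Basis. (L2_norm cube_measure (pderiv_at i (u m)))\<^sup>2) \<longlonglongrightarrow> grad_sq f"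
    "(\<lambda>m. LINT x|cube_measure. u m x) \<longlonglongrightarrow> (LINT x|cube_measure. f x)"
    using H1_limits[OF f] by metis
  have "(L2_norm cube_measure (u m))\<^sup>2 \<le> (LINT x|cube_measure. u m x)\<^sup>2
      + 2 ^ DIM('a) * real DIM('a) * (\<Sum>i\<in>Basis. (L2_norm cube_measure (pderiv_at i (u m)))\<^sup>2)" for m
  proof -
    have c: "continuous_on UNIV (u m)" "\<And>i. i \<in> Basis \<Longrightarrow> continuous_on UNIV (pderiv_at i (u m))"
      by (intro smooth_imp_continuous smooth_pderiv_at u(1); assumption)+
    show ?thesis
      using cube_poincare[OF smooth_C_k[OF u(1)], of m]
        integral_cube_measure_borel[OF borel_measurable_continuous_onI[OF c(1)]]
      by (simp add: smooth_norms_borel c)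
  qed
  moreover have "(\<lambda>m. (LINT x|cube_measure. u m x)\<^sup>2
      + 2 ^ DIM('a) * real DIM('a) * (\<Sum>i\<in>Basis. (L2_norm cube_measure (pderiv_at i (u m)))\<^sup>2))
      \<longlonglongrightarrow> (LINT x|cube_measure. f x)\<^sup>2 + 2 ^ DIM('a) * real DIM('a) * grad_sq f"
    by (intro tendsto_add tendsto_mult tendsto_power tendsto_const u(3,4))
  ultimately show ?thesis by (intro LIMSEQ_le[OF u(2)]) blast+
qed

subsection \<open>Green's formula\<close>

abbreviation normal_comp :: "'a::euclidean_space \<Rightarrow> 'a \<Rightarrow> real" where
  "normal_comp i x \<equiv> of_bool (x \<bullet> i = 1) - of_bool (x \<bullet> i = 0)"

lemma normal_comp_measurable [measurable]: "normal_comp i \<in> borel_measurable borel"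
  by (simp add: of_bool_def) measurable

lemma normal_comp_le: "\<bar>normal_comp i x\<bar> \<le> 1"
  by auto

lemma outer_normal_inner: "i \<in> Basis \<Longrightarrow> outer_normal x \<bullet> i = normal_comp i x"
  by (simp add: outer_normal_def)

text \<open>Rewrites the difference over two opposite faces as one integral over the boundary: the
  i-th normal component is 1 and -1 there and vanishes almost everywhere on the other faces.\<close>

lemma integral_bdry_normal_comp:
  fixes w :: "'a::euclidean_space \<Rightarrow> real"
  assumes w: "continuous_on UNIV w" and i: "i \<in> Basis"
  shows "(LINT x|bdry_measure. normal_comp i x * w x) = (LINT x|face_measure i 1. w x)
      - (LINT x|face_measure i 0. w x)"
proof -
  have [measurable]: "w \<in> borel_measurable borel" by (rule borel_measurable_continuous_onI[OF w])
  have val: "(LINT x|face_measure j c. normal_comp i x * w x) =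
      (if j = i then (of_bool (c = 1) - of_bool (c = 0)) * (LINT x|face_measure i c. w x) else 0)"
    if j: "j \<in> Basis" for j c
  proof (cases "j = i")
    case True
    have "(LINT x|face_measure i c. normal_comp i x * w x)
        = (LINT x|face_measure i c. (of_bool (c = 1) - of_bool (c = 0)) * w x)"
    proof (rule integral_cong_AE)
      show "AE x in face_measure i c. normal_comp i x * w x = (of_bool (c = 1) - of_bool (c
          = 0)) * w x"
        using AE_face_normal[OF i, of c] by eventually_elim simp
    qed measurable
    then show ?thesis using True by simp
  next
    \<comment> \<open>On the other faces coordinate i lies strictly between 0 and 1 almost
      everywhere.\<close>
    case False
    have "AE x in face_measure j c. normal_comp i x * w x = 0"
      using AE_face_tangential[OF j i False[symmetric], of c] by eventually_elim simp
    then show ?thesis using False by (simp add: integral_eq_zero_AE)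
  qed
  have "integrable bdry_measure (\<lambda>x. w x * normal_comp i x)"
    by (intro integrable_mult_bounded[of _ _ _ 1] continuous_integrable_bdry w normal_comp_le)
      (simp cong: measurable_cong_sets)
  then have "integrable bdry_measure (\<lambda>x. normal_comp i x * w x)" by (simp add: mult.commute)
  then have "(LINT x|bdry_measure. normal_comp i x * w x)
      = (\<Sum>j\<in>Basis. \<Sum>c\<in>{0, 1}. LINT x|face_measure j c. normal_comp i x * w x)"
    by (rule integral_bdry_measure)
  also have "\<dots> = (\<Sum>j\<in>Basis. if j = i then (LINT x|face_measure i 1. w x)
      - (LINT x|face_measure i 0. w x) else 0)"
    by (intro sum.cong refl) (simp add: val)
  also have "\<dots> = (LINT x|face_measure i 1. w x) - (LINT x|face_measure i 0. w x)"
    using i by simp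
  finally show ?thesis .
qed

lemma smooth_green:
  fixes p q :: "'a::euclidean_space \<Rightarrow> real"
  assumes p: "smooth p" and q: "smooth q" and i: "i \<in> Basis"
  shows "L2_inner cube_measure (pderiv_at i p) q + L2_inner cube_measure p (pderiv_at i q)
    = L2_inner bdry_measure (\<lambda>x. normal_comp i x * p x) q"
proof -
  have w: "C_k 1 (\<lambda>x. p x * q x)" by (intro C_k_mult smooth_C_k p q)
  have cont: "continuous_on UNIV (\<lambda>x. p x * pderiv_at i q x)" "continuous_on UNIV (\<lambda>x. pderiv_at i p
      x * q x)"
    by (intro continuous_intros smooth_imp_continuous smooth_pderiv_at p q i)+
  have "L2_inner cube_measure (pderiv_at i p) q + L2_inner cube_measure p (pderiv_at i q)
      = (LINT x|cube_borel. p x * pderiv_at i q x) + (LINT x|cube_borel. pderiv_at i p x * q x)"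
    unfolding L2_inner_def
    by (simp only: integral_cube_measure_borel[OF borel_measurable_continuous_onI[OF cont(1)]]
        integral_cube_measure_borel[OF borel_measurable_continuous_onI[OF cont(2)]] add.commute)
  also have "\<dots> = (LINT x|cube_borel. p x * pderiv_at i q x + pderiv_at i p x * q x)"
    by (intro Bochner_Integration.integral_add[symmetric] continuous_integrable_cube cont)
  also have "\<dots> = (LINT x|cube_borel. pderiv_at i (\<lambda>x. p x * q x) x)"
    by (simp add: pderiv_at_mult smooth_differentiable p q)
  also have "\<dots> = (LINT x|bdry_measure. normal_comp i x * (p x * q x))"
    unfolding divergence_cube[OF w i]
    by (intro integral_bdry_normal_comp[symmetric] i continuous_intros smooth_imp_continuous p q)
  finally show ?thesis by (simp add: L2_inner_def mult.assoc)
qed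

lemma normal_comp_mult_L2:
  fixes g :: "'a::euclidean_space \<Rightarrow> real"
  assumes "L2 bdry_measure g"
  shows "L2 bdry_measure (\<lambda>x. normal_comp i x * g x)"
    "L2_norm bdry_measure (\<lambda>x. normal_comp i x * g x) \<le> L2_norm bdry_measure g"
  by (intro L2_mult_bounded assms normal_comp_le; simp cong: measurable_cong_sets)+

text \<open>Both sides are continuous along the approximating sequences, in the interior by
  convergence of values and derivatives, on the boundary by convergence to the traces.\<close>

theorem H1_green:
  fixes p q :: "'a::euclidean_space \<Rightarrow> real"
  assumes p: "H1 p" and q: "H1 q" and i: "i \<in> Basis"
  shows "L2_inner cube_measure (weak_pderiv i p) q + L2_inner cube_measure p (weak_pderiv i q)
    = L2_inner bdry_measure (\<lambda>x. normal_comp i x * bdry_trace p x) (bdry_trace q)"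
proof -
  obtain u :: "nat \<Rightarrow> 'a \<Rightarrow> real" where u: "\<And>m. smooth (u m)"
    "(\<lambda>m. L2_norm cube_measure (\<lambda>x. u m x - p x)) \<longlonglongrightarrow> 0"
    "\<And>i. i \<in> Basis \<Longrightarrow> (\<lambda>m. L2_norm cube_measure (\<lambda>x. pderiv_at i (u m) x - weak_pderiv i p x)) \<longlonglongrightarrow> 0"
    "L2 bdry_measure (bdry_trace p)"
    "(\<lambda>m. L2_norm bdry_measure (\<lambda>x. u m x - bdry_trace p x)) \<longlonglongrightarrow> 0"
    using H1_smooth_approx_trace[OF p] by blast
  obtain w :: "nat \<Rightarrow> 'a \<Rightarrow> real" where w: "\<And>m. smooth (w m)"
    "(\<lambda>m. L2_norm cube_measure (\<lambda>x. w m x - q x)) \<longlonglongrightarrow> 0"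
    "\<And>i. i \<in> Basis \<Longrightarrow> (\<lambda>m. L2_norm cube_measure (\<lambda>x. pderiv_at i (w m) x - weak_pderiv i q x)) \<longlonglongrightarrow> 0"
    "L2 bdry_measure (bdry_trace q)"
    "(\<lambda>m. L2_norm bdry_measure (\<lambda>x. w m x - bdry_trace q x)) \<longlonglongrightarrow> 0"
    using H1_smooth_approx_trace[OF q] by blast
  have nu: "(\<lambda>m. L2_norm bdry_measure (\<lambda>x. normal_comp i x * u m x
      - normal_comp i x * bdry_trace p x)) \<longlonglongrightarrow> 0"
  proof (rule Lim_null_comparison[OF _ u(5)])
    show "\<forall>\<^sub>F m in sequentially. norm (L2_norm bdry_measure (\<lambda>x. normal_comp i x * u m x
        - normal_comp i x * bdry_trace p x))
        \<le> L2_norm bdry_measure (\<lambda>x. u m x - bdry_trace p x)"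
      using normal_comp_mult_L2(2)[OF L2_diff[OF smooth_L2_bdry[OF u(1)] u(4)], of i]
      by (simp only: right_diff_distrib real_norm_def abs_of_nonneg[OF L2_norm_nonneg]
          eventually_sequentially) simp
  qed
  have "(\<lambda>m. L2_inner cube_measure (pderiv_at i (u m)) (w m)
      + L2_inner cube_measure (u m) (pderiv_at i (w m)))
      \<longlonglongrightarrow> L2_inner cube_measure (weak_pderiv i p) q + L2_inner cube_measure p (weak_pderiv i q)"
    by (intro tendsto_add tendsto_L2_inner smooth_L2 smooth_pderiv_at u w H1_L2 H1_weak_pderiv_L2 p
        q i)
  moreover have "(\<lambda>m. L2_inner bdry_measure (\<lambda>x. normal_comp i x * u m x) (w m))
      \<longlonglongrightarrow> L2_inner bdry_measure (\<lambda>x. normal_comp i x * bdry_trace p x) (bdry_trace q)"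
    by (intro tendsto_L2_inner[OF _ _ nu] normal_comp_mult_L2 smooth_L2_bdry u w)
  ultimately show ?thesis
    unfolding smooth_green[OF u(1) w(1) i] by (rule LIMSEQ_unique)
qed

section \<open>Estimates in the second-order Sobolev space\<close>

text \<open>Green's formula with second factor 1, used for the smooth approximants: there the
  constant stays literally 1 on the boundary, whereas \<open>bdry_trace\<close> of a constant is a
  chosen representative.\<close>

lemma H1_divergence:
  fixes p :: "'a::euclidean_space \<Rightarrow> real"
  assumes p: "H1 p" and i: "i \<in> Basis"
  shows "(LINT x|cube_measure. weak_pderiv i p x) = (LINT x|bdry_measure. normal_comp i x *
      bdry_trace p x)"
proof -
  obtain u :: "nat \<Rightarrow> 'a \<Rightarrow> real" where u: "\<And>m. smooth (u m)"
    "(\<lambda>m. L2_norm cube_measure (\<lambda>x. u m x - p x)) \<longlonglongrightarrow> 0"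
    "\<And>i. i \<in> Basis \<Longrightarrow> (\<lambda>m. L2_norm cube_measure (\<lambda>x. pderiv_at i (u m) x - weak_pderiv i p x)) \<longlonglongrightarrow> 0"
    "L2 bdry_measure (bdry_trace p)"
    "(\<lambda>m. L2_norm bdry_measure (\<lambda>x. u m x - bdry_trace p x)) \<longlonglongrightarrow> 0"
    using H1_smooth_approx_trace[OF p] by blast
  have one: "smooth (\<lambda>x :: 'a. 1)" unfolding smooth_def by (simp add: C_k_const)
  have pd1: "pderiv_at i (\<lambda>x :: 'a. 1) = (\<lambda>x. 0)"
    by (rule ext) (simp add: pderiv_at_eqI[OF has_derivative_const])
  have green: "L2_inner cube_measure (pderiv_at i (u m)) (\<lambda>x. 1)
      = L2_inner bdry_measure (u m) (normal_comp i)" for m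
    using smooth_green[OF u(1) one i, of m] unfolding pd1 by (simp add: L2_inner_def mult.commute)
  have n: "L2 bdry_measure (normal_comp i)"
    using normal_comp_mult_L2(1)[OF smooth_L2_bdry[OF one], of i] by simp
  have "(\<lambda>m. L2_inner cube_measure (pderiv_at i (u m)) (\<lambda>x. 1))
      \<longlonglongrightarrow> L2_inner cube_measure (weak_pderiv i p) (\<lambda>x. 1)"
    by (intro tendsto_L2_inner smooth_L2 smooth_pderiv_at u one H1_weak_pderiv_L2 p i) simp
  moreover have "(\<lambda>m. L2_inner bdry_measure (u m) (normal_comp i))
      \<longlonglongrightarrow> L2_inner bdry_measure (bdry_trace p) (normal_comp i)"
    by (intro tendsto_L2_inner smooth_L2_bdry u n) simp
  ultimately have "L2_inner cube_measure (weak_pderiv i p) (\<lambda>x. 1)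
      = L2_inner bdry_measure (bdry_trace p) (normal_comp i)"
    unfolding green by (rule LIMSEQ_unique)
  then show ?thesis by (simp add: L2_inner_def mult.commute)
qed

lemma H2_H1: "H2 f \<Longrightarrow> H1 f" "H2 f \<Longrightarrow> i \<in> Basis \<Longrightarrow> H1 (weak_pderiv i f)"
  by (auto simp: H2_def)

lemma laplace_eq: "laplace f = (\<lambda>x. \<Sum>i\<in>Basis. weak_pderiv i (weak_pderiv i f) x)"
  by (simp add: laplace_def fun_eq_iff)

lemma laplace_L2: "H2 f \<Longrightarrow> L2 cube_measure (laplace f)"
  unfolding laplace_eq by (intro L2_sum H1_weak_pderiv_L2 H2_H1)

lemma normal_deriv_eq: "normal_deriv f = (\<lambda>x. \<Sum>i\<in>Basis. normal_comp i x * bdry_trace (weak_pderiv i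
    f) x)"
  by (rule ext) (simp add: normal_deriv_def inner_sum_right outer_normal_inner mult.commute)

lemma normal_deriv_L2: "H2 f \<Longrightarrow> L2 bdry_measure (normal_deriv f)"
  unfolding normal_deriv_eq by (intro L2_sum normal_comp_mult_L2 bdry_trace_L2 H2_H1)

text \<open>Green's formula for the pair \<open>weak_pderiv i f\<close> and f, summed over i.
  Second-order regularity gives the components of the gradient their traces.\<close>

theorem H2_green:
  fixes f :: "'a::euclidean_space \<Rightarrow> real"
  assumes f: "H2 f"
  shows "grad_sq f + L2_inner cube_measure (laplace f) f
      = L2_inner bdry_measure (normal_deriv f) (bdry_trace f)"
proof -
  note H = H2_H1(1)[OF f] H2_H1(2)[OF f]
  have "L2_inner cube_measure (laplace f) f + grad_sq f
      = (\<Sum>i\<in>Basis. L2_inner cube_measure (weak_pderiv i (weak_pderiv i f)) f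
          + L2_inner cube_measure (weak_pderiv i f) (weak_pderiv i f))"
    unfolding laplace_eq
    by (simp add: L2_inner_sum_left H1_weak_pderiv_L2 H H1_L2 sum.distrib L2_norm_sq)
  also have "\<dots> = (\<Sum>i\<in>Basis. L2_inner bdry_measure (\<lambda>x. normal_comp i x * bdry_trace (weak_pderiv i
      f) x) (bdry_trace f))"
    by (intro sum.cong refl H1_green H)
  also have "\<dots> = L2_inner bdry_measure (normal_deriv f) (bdry_trace f)"
    unfolding normal_deriv_eq
    by (intro L2_inner_sum_left[symmetric] normal_comp_mult_L2 bdry_trace_L2 H)
  finally show ?thesis by simp
qed

lemma L2_integrable_bdry: "L2 bdry_measure f \<Longrightarrow> integrable bdry_measure f"
  using L2_mult_integrable[of bdry_measure f "\<lambda>x. 1"] continuous_L2_bdry[of "\<lambda>x. 1"] by simp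

text \<open>The flux identity through which Neumann data control the means of the higher
  components.\<close>

lemma integral_laplace:
  fixes f :: "'a::euclidean_space \<Rightarrow> real"
  assumes f: "H2 f"
  shows "(LINT x|cube_measure. laplace f x) = (LINT x|bdry_measure. normal_deriv f x)"
  unfolding laplace_eq normal_deriv_eq
  by (simp add: L2_integrable_cube H1_weak_pderiv_L2 H2_H1[OF f] H1_divergence
      L2_integrable_bdry normal_comp_mult_L2 bdry_trace_L2 Bochner_Integration.integral_sum
      del: of_bool_eq_0_iff)

text \<open>Testing with \<phi> shows that \<open>laplace f\<close> is a weak divergence of the
  gradient, hence almost everywhere equal to the chosen one. Coercivity is thus reduced to bounding
  \<open>H1_norm\<close> and the Laplacian.\<close>

lemma Hdiv_norm_weak_grad:
  fixes f :: "'a::euclidean_space \<Rightarrow> real"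
  assumes f: "H2 f"
  shows "(Hdiv_norm (weak_grad f))\<^sup>2 = grad_sq f + (L2_norm cube_measure (laplace f))\<^sup>2"
proof -
  note H = H2_H1(1)[OF f] H2_H1(2)[OF f]
  have norm: "(norm (weak_grad f x))\<^sup>2 = (\<Sum>i\<in>Basis. (weak_pderiv i f x)\<^sup>2)" for x
    unfolding power2_norm_eq_inner
    by (subst euclidean_inner) (simp add: weak_grad_def inner_sum_left inner_Basis power2_eq_square
        if_distrib[of "\<lambda>a. _ * a"] cong: if_cong)
  have g: "(L2_norm cube_measure (weak_grad f))\<^sup>2 = grad_sq f"
    unfolding L2_norm_def[of _ "weak_grad f"] norm
    by (simp add: L2_norm_sq_eq L2_D2 H1_weak_pderiv_L2 H sum_nonneg)
  have "has_weak_div (weak_grad f) (laplace f)"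
    unfolding has_weak_div_def
  proof (intro conjI allI impI laplace_L2 f)
    fix \<phi> :: "'a \<Rightarrow> real" assume \<phi>: "test_function \<phi>"
    have "weak_grad f x \<bullet> (\<Sum>i\<in>Basis. pderiv_at i \<phi> x *\<^sub>R i)
        = (\<Sum>i\<in>Basis. weak_pderiv i f x * pderiv_at i \<phi> x)" for x
      unfolding weak_grad_def
      by (subst euclidean_inner) (simp add: inner_sum_left inner_Basis if_distrib[of "\<lambda>a. _ * a"]
          cong: if_cong)
    then have "(LINT x|cube_measure. weak_grad f x \<bullet> (\<Sum>i\<in>Basis. pderiv_at i \<phi> x *\<^sub>R i))
        = (\<Sum>i\<in>Basis. L2_inner cube_measure (weak_pderiv i f) (pderiv_at i \<phi>))"
      by (simp add: L2_inner_def L2_mult_integrable H1_weak_pderiv_L2 H test_function_pderiv_L2 \<phi>)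
    also have "\<dots> = (\<Sum>i\<in>Basis. - L2_inner cube_measure (weak_pderiv i (weak_pderiv i f)) \<phi>)"
      using H1_has_weak_pderiv[OF H(2)] \<phi> by (intro sum.cong refl) (simp add: has_weak_pderiv_def)
    also have "\<dots> = - L2_inner cube_measure (laplace f) \<phi>"
      unfolding laplace_eq
      by (simp add: L2_inner_sum_left H1_weak_pderiv_L2 H test_function_L2 \<phi> sum_negf)
    finally show "(LINT x|cube_measure. weak_grad f x \<bullet> (\<Sum>i\<in>Basis. pderiv_at i \<phi> x *\<^sub>R i))
        = - L2_inner cube_measure (laplace f) \<phi>" .
  qed
  then have "has_weak_div (weak_grad f) (weak_div (weak_grad f))" "has_weak_div (weak_grad f)
      (laplace f)"
    unfolding weak_div_def by (auto intro: someI[of "has_weak_div (weak_grad f)"])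
  then have L: "L2 cube_measure (weak_div (weak_grad f))"
    and AE: "AE x in cube_measure. weak_div (weak_grad f) x = laplace f x"
    unfolding has_weak_div_def by (auto intro!: test_functions_separate)
  have "L2_norm cube_measure (weak_div (weak_grad f)) = L2_norm cube_measure (laplace f)"
    using L laplace_L2[OF f] AE by (intro L2_norm_cong_AE) (auto dest: L2_D1)
  then show ?thesis using g by (simp add: Hdiv_norm_def sum_nonneg)
qed

section \<open>Bounds by the first- and second-order Sobolev norms\<close>

lemma H2_norm_nonneg: "H2_norm f \<ge> 0"
  unfolding H2_norm_def by (intro real_sqrt_ge_zero add_nonneg_nonneg sum_nonneg) auto

lemma H2_norm_sq: "(H2_norm f)\<^sup>2 = (H1_norm f)\<^sup>2
    + (\<Sum>i\<in>Basis. \<Sum>j\<in>Basis. (L2_norm cube_measure (weak_pderiv j (weak_pderiv i f)))\<^sup>2)"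
  unfolding H2_norm_def H1_norm_sq by (intro real_sqrt_pow2 add_nonneg_nonneg sum_nonneg) auto

lemma H1_norm_le_H2_norm: "H1_norm f \<le> H2_norm f"
  by (rule power2_le_imp_le[OF _ H2_norm_nonneg]) (simp add: H2_norm_sq sum_nonneg)

lemma L2_norm_le_H1_norm: "L2_norm cube_measure f \<le> H1_norm f"
  by (rule power2_le_imp_le[OF _ H1_norm_nonneg]) (simp add: H1_norm_sq sum_nonneg)

lemma L2_norm_pderiv_le_H1_norm:
  assumes "i \<in> Basis"
  shows "L2_norm cube_measure (weak_pderiv i f) \<le> H1_norm f"
proof (rule power2_le_imp_le[OF _ H1_norm_nonneg])
  have "(L2_norm cube_measure (weak_pderiv i f))\<^sup>2 \<le> grad_sq f"
    using assms by (intro member_le_sum) auto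
  then show "(L2_norm cube_measure (weak_pderiv i f))\<^sup>2 \<le> (H1_norm f)\<^sup>2"
    unfolding H1_norm_sq by (simp add: add_increasing)
qed

lemma H1_norm_pderiv_le_H2_norm:
  fixes f :: "'a::euclidean_space \<Rightarrow> real"
  assumes i: "i \<in> Basis"
  shows "H1_norm (weak_pderiv i f) \<le> H2_norm f"
proof (rule power2_le_imp_le[OF _ H2_norm_nonneg])
  let ?s = "\<lambda>i. \<Sum>j\<in>Basis. (L2_norm cube_measure (weak_pderiv j (weak_pderiv i f)))\<^sup>2"
  have "(L2_norm cube_measure (weak_pderiv i f))\<^sup>2 \<le> (H1_norm f)\<^sup>2"
    by (intro power_mono L2_norm_pderiv_le_H1_norm i L2_norm_nonneg)
  moreover have "?s i \<le> (\<Sum>i\<in>Basis. ?s i)"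
    using i by (intro member_le_sum[where f = ?s] sum_nonneg) auto
  ultimately show "(H1_norm (weak_pderiv i f))\<^sup>2 \<le> (H2_norm f)\<^sup>2"
    unfolding H2_norm_sq H1_norm_sq[of "weak_pderiv i f"] by linarith
qed

lemma laplace_le:
  fixes f :: "'a::euclidean_space \<Rightarrow> real"
  assumes f: "H2 f"
  shows "L2_norm cube_measure (laplace f) \<le> real DIM('a) * H2_norm f"
proof -
  have "L2_norm cube_measure (laplace f) \<le> (\<Sum>i\<in>(Basis :: 'a set). L2_norm cube_measure (weak_pderiv
      i (weak_pderiv i f)))"
    unfolding laplace_eq by (intro L2_norm_sum_le H1_weak_pderiv_L2 H2_H1 f)
  also have "\<dots> \<le> (\<Sum>i\<in>(Basis :: 'a set). H2_norm f)"
    by (intro sum_mono order.trans[OF L2_norm_pderiv_le_H1_norm H1_norm_pderiv_le_H2_norm])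
  finally show ?thesis by simp
qed

lemma DIM_ge_1: "real DIM('a::euclidean_space) \<ge> 1"
  by (simp add: Suc_leI)

lemma trace_le:
  fixes f :: "'a::euclidean_space \<Rightarrow> real"
  assumes f: "H1 f"
  shows "L2_norm bdry_measure (bdry_trace f) \<le> 2 * real DIM('a) * H1_norm f"
proof (rule power2_le_imp_le)
  note H1_trace_le[OF f]
  also have "4 * real DIM('a) * (H1_norm f)\<^sup>2 \<le> (4 * (real DIM('a) * real DIM('a))) * (H1_norm f)\<^sup>2"
    using mult_left_mono[OF DIM_ge_1[where 'a = 'a], of "real DIM('a)"]
        by (intro mult_right_mono) auto
  finally show "(L2_norm bdry_measure (bdry_trace f))\<^sup>2 \<le> (2 * real DIM('a) * H1_norm f)\<^sup>2"
    by (simp add: power2_eq_square mult_ac)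
qed (simp add: H1_norm_nonneg)

text \<open>The normal derivative is a sum of d traces of first derivatives, each with trace
  constant 2 d.\<close>

lemma normal_deriv_le:
  fixes f :: "'a::euclidean_space \<Rightarrow> real"
  assumes f: "H2 f"
  shows "L2_norm bdry_measure (normal_deriv f) \<le> 2 * (real DIM('a))\<^sup>2 * H2_norm f"
proof -
  have "L2_norm bdry_measure (normal_deriv f)
      \<le> (\<Sum>i\<in>(Basis :: 'a set). L2_norm bdry_measure (\<lambda>x. normal_comp i x * bdry_trace (weak_pderiv i
          f) x))"
    unfolding normal_deriv_eq by (intro L2_norm_sum_le normal_comp_mult_L2 bdry_trace_L2 H2_H1 f)
  also have "\<dots> \<le> (\<Sum>i\<in>(Basis :: 'a set). 2 * real DIM('a) * H2_norm f)"
  proof (rule sum_mono)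
    fix i :: 'a assume i: "i \<in> Basis"
    have "L2_norm bdry_measure (\<lambda>x. normal_comp i x * bdry_trace (weak_pderiv i f) x)
        \<le> L2_norm bdry_measure (bdry_trace (weak_pderiv i f))"
      by (intro normal_comp_mult_L2 bdry_trace_L2 H2_H1 f i)
    also have "\<dots> \<le> 2 * real DIM('a) * H1_norm (weak_pderiv i f)" by (intro trace_le H2_H1 f i)
    also have "\<dots> \<le> 2 * real DIM('a) * H2_norm f"
      by (intro mult_left_mono H1_norm_pderiv_le_H2_norm i) simp
    finally show "L2_norm bdry_measure (\<lambda>x. normal_comp i x * bdry_trace (weak_pderiv i f) x)
        \<le> 2 * real DIM('a) * H2_norm f" .
  qed
  finally show ?thesis by (simp add: power2_eq_square mult_ac)
qed

lemma integral_cube_le: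
  fixes f :: "'a::euclidean_space \<Rightarrow> real"
  assumes f: "L2 cube_measure f"
  shows "\<bar>LINT x|cube_measure. f x\<bar> \<le> L2_norm cube_measure f"
proof -
  have one: "L2 cube_measure (\<lambda>x :: 'a. 1)" by (rule continuous_L2_cube_measure) simp
  have "L2_norm cube_measure (\<lambda>x :: 'a. 1 :: real) = 1"
    by (subst L2_norm_cube_measure_borel) (simp_all add: L2_norm_def measure_cube_borel_UNIV)
  then show ?thesis using L2_Cauchy_Schwarz[OF f one] by (simp add: L2_inner_def)
qed

lemma integral_bdry_le:
  fixes f :: "'a::euclidean_space \<Rightarrow> real"
  assumes f: "L2 bdry_measure f"
  shows "\<bar>LINT x|bdry_measure. f x\<bar> \<le> L2_norm bdry_measure f * L2_norm bdry_measure (\<lambda>x :: 'a. 1 ::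
      real)"
proof -
  have one: "L2 bdry_measure (\<lambda>x :: 'a. 1)" by (rule continuous_L2_bdry) simp
  show ?thesis using L2_Cauchy_Schwarz[OF f one] by (simp add: L2_inner_def)
qed

subsection \<open>Coercivity for a single equation\<close>

text \<open>Young's inequality: 2 b h is at most h^2 + b^2, and the h^2 is moved to the left. It
  ends all three single-equation estimates.\<close>

lemma absorb_linear: "h\<^sup>2 \<le> a + b * h \<Longrightarrow> h\<^sup>2 \<le> 2 * a + b\<^sup>2" for h a b :: real
  using zero_le_power2[of "h - b"] by (simp add: power2_diff mult_ac)

lemma energy_identity:
  fixes f :: "'a::euclidean_space \<Rightarrow> real"
  assumes f: "H2 f"
  shows "grad_sq f \<le> L2_inner bdry_measure (normal_deriv f) (bdry_trace f)
      + L2_norm cube_measure (laplace f) * H1_norm f"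
proof -
  have "\<bar>L2_inner cube_measure (laplace f) f\<bar> \<le> L2_norm cube_measure (laplace f) * L2_norm
      cube_measure f"
    by (intro L2_Cauchy_Schwarz laplace_L2 f H1_L2 H2_H1)
  also have "\<dots> \<le> L2_norm cube_measure (laplace f) * H1_norm f"
    by (intro mult_left_mono L2_norm_le_H1_norm) simp
  finally show ?thesis using H2_green[OF f] by linarith
qed

lemma inner_trace_le:
  fixes f :: "'a::euclidean_space \<Rightarrow> real"
  assumes f: "H1 f" and s: "L2 bdry_measure s"
  shows "L2_inner bdry_measure s (bdry_trace f) \<le> (2 * real DIM('a) * L2_norm bdry_measure s) *
      H1_norm f"
proof -
  have "L2_inner bdry_measure s (bdry_trace f) \<le> L2_norm bdry_measure s * L2_norm bdry_measure
      (bdry_trace f)"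
    using L2_Cauchy_Schwarz[OF s bdry_trace_L2[OF f]] by simp
  also have "\<dots> \<le> L2_norm bdry_measure s * (2 * real DIM('a) * H1_norm f)"
    by (intro mult_left_mono trace_le f) simp
  finally show ?thesis by (simp add: mult_ac)
qed

lemma square_sum_le: "(2 * d * g + l)\<^sup>2 \<le> (8 * d\<^sup>2 + 2) * (l\<^sup>2 + g\<^sup>2)" for d g l :: real
proof -
  have "(2 * d * g + l)\<^sup>2 \<le> 2 * (2 * d * g)\<^sup>2 + 2 * l\<^sup>2" by (rule two_squares)
  also have "\<dots> = 8 * d\<^sup>2 * g\<^sup>2 + 2 * l\<^sup>2" by (simp add: power_mult_distrib)
  also have "\<dots> \<le> (8 * d\<^sup>2 * g\<^sup>2 + 2 * l\<^sup>2) + (8 * d\<^sup>2 * l\<^sup>2 + 2 * g\<^sup>2)" by simp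
  also have "\<dots> = (8 * d\<^sup>2 + 2) * (l\<^sup>2 + g\<^sup>2)" by (simp add: algebra_simps)
  finally show ?thesis .
qed

lemma coercive_Neumann:
  fixes f :: "'a::euclidean_space \<Rightarrow> real"
  defines "C \<equiv> (2 ^ DIM('a) * real DIM('a) + 1)\<^sup>2 * (8 * (real DIM('a))\<^sup>2 + 2) + 2"
  assumes f: "H2 f"
  shows "(H1_norm f)\<^sup>2 \<le> C * ((L2_norm cube_measure (laplace f))\<^sup>2
    + ((L2_norm bdry_measure (normal_deriv f))\<^sup>2 + (LINT x|cube_measure. f x)\<^sup>2))"
proof -
  \<comment> \<open>The Poincare constant, plus 1 for the gradient contained in
    \<open>H1_norm\<close>.\<close>
  define P where "P = 2 ^ DIM('a) * real DIM('a) + 1"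
  define K where "K = 8 * (real DIM('a))\<^sup>2 + 2"
  define l g m where "l = L2_norm cube_measure (laplace f)" and "g
      = L2_norm bdry_measure (normal_deriv f)"
    and "m = (LINT x|cube_measure. f x)"
  define b where "b = 2 * real DIM('a) * g + l"
  have P: "P \<ge> 0" and K: "K \<ge> 0" by (simp_all add: P_def K_def)
  have "grad_sq f \<le> b * H1_norm f"
    using energy_identity[OF f] inner_trace_le[OF H2_H1(1)[OF f] normal_deriv_L2[OF f]]
    by (simp add: b_def l_def g_def algebra_simps)
  then have "P * grad_sq f \<le> P * (b * H1_norm f)" using P by (rule mult_left_mono)
  moreover have "(H1_norm f)\<^sup>2 \<le> m\<^sup>2 + P * grad_sq f"
    using H1_poincare[OF H2_H1(1)[OF f]] unfolding H1_norm_sq m_def P_def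
        by (simp add: algebra_simps)
  ultimately have "(H1_norm f)\<^sup>2 \<le> m\<^sup>2 + (P * b) * H1_norm f" by (simp add: mult.assoc)
  then have "(H1_norm f)\<^sup>2 \<le> 2 * m\<^sup>2 + (P * b)\<^sup>2" by (rule absorb_linear)
  also have "\<dots> \<le> 2 * m\<^sup>2 + P\<^sup>2 * (K * (l\<^sup>2 + g\<^sup>2))"
    unfolding power_mult_distrib K_def b_def by (intro add_left_mono mult_left_mono square_sum_le)
        simp
  \<comment> \<open>Surplus terms are added so that all three data carry the same constant.\<close>
  also have "\<dots> \<le> (2 * m\<^sup>2 + P\<^sup>2 * (K * (l\<^sup>2 + g\<^sup>2))) + (P\<^sup>2 * K * m\<^sup>2 + 2 * (l\<^sup>2 + g\<^sup>2))"
    using K by simp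
  also have "\<dots> = (P\<^sup>2 * K + 2) * (l\<^sup>2 + (g\<^sup>2 + m\<^sup>2))" by (simp add: algebra_simps)
  finally show ?thesis by (simp add: C_def P_def K_def l_def g_def m_def)
qed

text \<open>Substituting s minus the trace for the normal derivative in Green's formula produces
  minus the squared trace norm. On the left it becomes exactly the boundary term that Friedrichs'
  inequality asks for.\<close>

lemma coercive_Robin:
  fixes f :: "'a::euclidean_space \<Rightarrow> real"
  defines "s \<equiv> \<lambda>x. bdry_trace f x + normal_deriv f x"
  assumes f: "H2 f"
  shows "(H1_norm f)\<^sup>2 \<le> (9 * (8 * (real DIM('a))\<^sup>2 + 2)) * ((L2_norm cube_measure (laplace f))\<^sup>2
      + (L2_norm bdry_measure s)\<^sup>2)"
proof -
  define K where "K = 8 * (real DIM('a))\<^sup>2 + 2"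
  define l g where "l = L2_norm cube_measure (laplace f)" and "g = L2_norm bdry_measure s"
  define b where "b = 2 * real DIM('a) * g + l"
  define t where "t = L2_norm bdry_measure (bdry_trace f)"
  note H = H2_H1(1)[OF f]
  have s: "L2 bdry_measure s" unfolding s_def by (intro L2_add bdry_trace_L2 H normal_deriv_L2 f)
  have "L2_inner bdry_measure s (bdry_trace f) = t\<^sup>2 + L2_inner bdry_measure (normal_deriv f)
      (bdry_trace f)"
    unfolding s_def t_def L2_norm_sq by (intro L2_inner_add_left bdry_trace_L2 H normal_deriv_L2 f)
  then have "grad_sq f + t\<^sup>2 \<le> b * H1_norm f"
    using energy_identity[OF f] inner_trace_le[OF H s]
    by (simp add: b_def l_def g_def algebra_simps)
  moreover have "(H1_norm f)\<^sup>2 \<le> 3 * (grad_sq f + t\<^sup>2)"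
    using H1_friedrichs[OF H] zero_le_power2[of t] unfolding H1_norm_sq t_def by argo
  ultimately have "(H1_norm f)\<^sup>2 \<le> 0 + (3 * b) * H1_norm f" by simp
  then have "(H1_norm f)\<^sup>2 \<le> 2 * 0 + (3 * b)\<^sup>2" by (rule absorb_linear)
  also have "\<dots> = 9 * b\<^sup>2" by (simp add: power_mult_distrib)
  also have "\<dots> \<le> 9 * (K * (l\<^sup>2 + g\<^sup>2))"
    unfolding K_def b_def by (intro mult_left_mono square_sum_le) simp
  finally show ?thesis unfolding K_def l_def g_def by (simp only: mult.assoc)
qed

text \<open>The trace enters linearly: its pairing with the normal derivative is bounded through E,
  and its square in Friedrichs' inequality is made linear by bounding one factor by 2 d E.\<close>

lemma coercive_Dirichlet:
  fixes f :: "'a::euclidean_space \<Rightarrow> real"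
  assumes f: "H2 f" and E: "H2_norm f \<le> E"
  shows "(H1_norm f)\<^sup>2 \<le> 9 * (L2_norm cube_measure (laplace f))\<^sup>2
    + (8 * real DIM('a) + 12 * (real DIM('a))\<^sup>2) * E * L2_norm bdry_measure (bdry_trace f)"
proof -
  define l g where "l = L2_norm cube_measure (laplace f)" and "g
      = L2_norm bdry_measure (bdry_trace f)"
  define d where "d = real DIM('a)"
  note H = H2_H1(1)[OF f]
  have g0: "g \<ge> 0" by (simp add: g_def)
  have gE: "g \<le> 2 * d * E"
  proof -
    have "2 * d * H1_norm f \<le> 2 * d * E"
      using E H1_norm_le_H2_norm[of f] by (intro mult_left_mono) (auto simp: d_def)
    then show ?thesis using trace_le[OF H] unfolding g_def d_def by linarith
  qed
  have "L2_norm bdry_measure (normal_deriv f) \<le> 2 * d\<^sup>2 * E"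
  proof -
    have "2 * d\<^sup>2 * H2_norm f \<le> 2 * d\<^sup>2 * E" using E by (intro mult_left_mono) auto
    then show ?thesis using normal_deriv_le[OF f] unfolding d_def by linarith
  qed
  then have "L2_norm bdry_measure (normal_deriv f) * g \<le> (2 * d\<^sup>2 * E) * g"
    using g0 by (rule mult_right_mono)
  then have "L2_inner bdry_measure (normal_deriv f) (bdry_trace f) \<le> (2 * d\<^sup>2 * E) * g"
    using L2_Cauchy_Schwarz[OF normal_deriv_L2[OF f] bdry_trace_L2[OF H]] unfolding g_def
        by linarith
  then have "grad_sq f \<le> (2 * d\<^sup>2 * E) * g + l * H1_norm f"
    using energy_identity[OF f] unfolding l_def by linarith
  moreover have "(H1_norm f)\<^sup>2 \<le> 2 * g\<^sup>2 + 3 * grad_sq f"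
    using H1_friedrichs[OF H] unfolding H1_norm_sq g_def by simp
  moreover have "g\<^sup>2 \<le> (2 * d * E) * g"
    unfolding power2_eq_square using gE g0 by (rule mult_right_mono)
  \<comment> \<open>4 d E g comes from twice the squared trace, 6 d^2 E g from three times the
    boundary pairing; absorption doubles both.\<close>
  ultimately have "(H1_norm f)\<^sup>2 \<le> (4 * d * E * g + 6 * d\<^sup>2 * E * g) + (3 * l) * H1_norm f"
    by simp
  then have "(H1_norm f)\<^sup>2 \<le> 2 * (4 * d * E * g + 6 * d\<^sup>2 * E * g) + (3 * l)\<^sup>2"
    by (rule absorb_linear)
  then show ?thesis by (simp add: l_def g_def d_def power_mult_distrib algebra_simps)
qed

section \<open>The second-order system\<close>

lemma P_star_L2:
  assumes v: "H2_vec n v" and k: "k < n"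
  shows "L2 cube_measure (P_star n v k)"
proof -
  have H: "H2 (v j)" if "j < n" for j using v that by (simp add: H2_vec_def)
  show ?thesis
  proof (cases "Suc k < n")
    case True
    then have "P_star n v k = (\<lambda>x. laplace (v k) x - v (Suc k) x)"
        by (simp add: P_star_def fun_eq_iff)
    then show ?thesis using L2_diff[OF laplace_L2[OF H[OF k]] H1_L2[OF H2_H1(1)[OF H[OF True]]]]
        by simp
  next
    case False
    then have "P_star n v k = laplace (v k)" by (simp add: P_star_def fun_eq_iff)
    then show ?thesis using laplace_L2[OF H[OF k]] by simp
  qed
qed

lemma S_star_L2:
  assumes v: "H2_vec n v" and k: "k < n"
  shows "L2 bdry_measure (S_star \<alpha> v k)"
proof -
  have "H2 (v k)" using v k by (simp add: H2_vec_def)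
  note L = bdry_trace_L2[OF H2_H1(1)[OF this]] normal_deriv_L2[OF this]
  have "S_star \<alpha> v k = (case \<alpha> of Dirichlet \<Rightarrow> bdry_trace (v k) | Neumann \<Rightarrow> normal_deriv (v k)
      | Robin \<Rightarrow> (\<lambda>x. bdry_trace (v k) x + normal_deriv (v k) x))"
    by (cases \<alpha>) auto
  then show ?thesis using L by (cases \<alpha>) (auto intro: L2_add)
qed

lemma H2_norm_le_vec: "k < n \<Longrightarrow> H2_norm (v k) \<le> H2_vec_norm n v"
  unfolding H2_vec_norm_def by (rule member_le_sum) (auto simp: H2_norm_nonneg)

lemma P_star_le:
  fixes v :: "nat \<Rightarrow> 'a::euclidean_space \<Rightarrow> real"
  assumes v: "H2_vec n v" and k: "k < n"
  shows "L2_norm cube_measure (P_star n v k) \<le> (real DIM('a) + 1) * H2_vec_norm n v"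
proof -
  have H: "H2 (v k)" using v k by (simp add: H2_vec_def)
  have V: "0 \<le> H2_vec_norm n v" unfolding H2_vec_norm_def by (simp add: sum_nonneg H2_norm_nonneg)
  have lap: "L2_norm cube_measure (laplace (v k)) \<le> real DIM('a) * H2_vec_norm n v"
    by (intro order.trans[OF laplace_le[OF H]] mult_left_mono H2_norm_le_vec k) simp
  show ?thesis
  proof (cases "Suc k < n")
    case True
    then have H': "H2 (v (Suc k))" using v by (simp add: H2_vec_def)
    have "L2_norm cube_measure (v (Suc k)) \<le> H2_vec_norm n v"
      using L2_norm_le_H1_norm H1_norm_le_H2_norm H2_norm_le_vec[OF True] by (meson order.trans)
    moreover have "P_star n v k = (\<lambda>x. laplace (v k) x - v (Suc k) x)"
      using True by (simp add: P_star_def fun_eq_iff)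
    ultimately show ?thesis
      using L2_norm_triangle_diff[OF laplace_L2[OF H] H1_L2[OF H2_H1(1)[OF H']]] lap
      by (simp add: distrib_right)
  next
    case False
    then have "P_star n v k = laplace (v k)" by (simp add: P_star_def fun_eq_iff)
    then show ?thesis using lap V by (simp add: distrib_right)
  qed
qed

lemma S_star_le:
  fixes v :: "nat \<Rightarrow> 'a::euclidean_space \<Rightarrow> real"
  assumes v: "H2_vec n v" and k: "k < n"
  shows "L2_norm bdry_measure (S_star \<alpha> v k) \<le> (2 * real DIM('a)
      + 2 * (real DIM('a))\<^sup>2) * H2_vec_norm n v"
proof -
  let ?d = "real DIM('a)"
  have H: "H2 (v k)" using v k by (simp add: H2_vec_def)
  have V: "0 \<le> H2_vec_norm n v" unfolding H2_vec_norm_def by (simp add: sum_nonneg H2_norm_nonneg)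
  have "2 * ?d * H1_norm (v k) \<le> 2 * ?d * H2_vec_norm n v"
    by (intro mult_left_mono order.trans[OF H1_norm_le_H2_norm H2_norm_le_vec] k) simp
  then have t: "L2_norm bdry_measure (bdry_trace (v k)) \<le> 2 * ?d * H2_vec_norm n v"
    using trace_le[OF H2_H1(1)[OF H]] by linarith
  have "2 * ?d\<^sup>2 * H2_norm (v k) \<le> 2 * ?d\<^sup>2 * H2_vec_norm n v"
    by (intro mult_left_mono H2_norm_le_vec k) simp
  then have nd: "L2_norm bdry_measure (normal_deriv (v k)) \<le> 2 * ?d\<^sup>2 * H2_vec_norm n v"
    using normal_deriv_le[OF H] by linarith
  have nn: "0 \<le> 2 * ?d * H2_vec_norm n v" "0 \<le> 2 * ?d\<^sup>2 * H2_vec_norm n v" using V by simp_all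
  show ?thesis
  proof (cases \<alpha>)
    case Dirichlet
    then have eq: "S_star \<alpha> v k = bdry_trace (v k)" by auto
    show ?thesis unfolding eq distrib_right using t nn by linarith
  next
    case Neumann
    then have eq: "S_star \<alpha> v k = normal_deriv (v k)" by auto
    show ?thesis unfolding eq distrib_right using nd nn by linarith
  next
    case Robin
    then have "S_star \<alpha> v k = (\<lambda>x. bdry_trace (v k) x + normal_deriv (v k) x)" by auto
    then show ?thesis
      using L2_norm_triangle[OF bdry_trace_L2[OF H2_H1(1)[OF H]] normal_deriv_L2[OF H]] t nd
      by (simp add: distrib_right)
  qed
qed

text \<open>Cauchy-Schwarz in each summand. The constant is uniform in the boundary condition; with
  w = v it is used again in the Dirichlet estimate.\<close>

theorem B_form_bounded:
  fixes v w :: "nat \<Rightarrow> 'a::euclidean_space \<Rightarrow> real"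
  defines "d \<equiv> real DIM('a)"
  assumes n: "n \<ge> 1" and lam: "lam > 0" and mu: "mu > 0" and v: "H2_vec n v" and w: "H2_vec n w"
  shows "B_form \<alpha> n lam mu v w
    \<le> (real n * (d + 1)\<^sup>2 + lam * (real n * (2 * d + 2 * d\<^sup>2)\<^sup>2)
        + mu) * H2_vec_norm n v * H2_vec_norm n w"
proof -
  let ?V = "H2_vec_norm n v" and ?W = "H2_vec_norm n w"
  let ?s = "2 * d + 2 * d\<^sup>2"
  have VW: "0 \<le> ?V" "0 \<le> ?W" unfolding H2_vec_norm_def by (simp_all add: sum_nonneg H2_norm_nonneg)
  have "L2_inner cube_measure (P_star n v k) (P_star n w k) \<le> (d + 1)\<^sup>2 * (?V * ?W)" if k: "k < n"
      for k
  proof -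
    have "L2_inner cube_measure (P_star n v k) (P_star n w k)
        \<le> L2_norm cube_measure (P_star n v k) * L2_norm cube_measure (P_star n w k)"
      using L2_Cauchy_Schwarz[OF P_star_L2[OF v k] P_star_L2[OF w k]] by simp
    also have "\<dots> \<le> ((d + 1) * ?V) * ((d + 1) * ?W)"
      unfolding d_def using VW by (intro mult_mono P_star_le v w k) auto
    finally show ?thesis by (simp add: power2_eq_square mult_ac)
  qed
  then have "(\<Sum>k<n. L2_inner cube_measure (P_star n v k) (P_star n w k)) \<le> (\<Sum>k<n. (d
      + 1)\<^sup>2 * (?V * ?W))"
    by (intro sum_mono) simp
  then have A: "(\<Sum>k<n. L2_inner cube_measure (P_star n v k) (P_star n w k)) \<le> real n * (d
      + 1)\<^sup>2 * (?V * ?W)"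
    by simp
  have "L2_inner bdry_measure (S_star \<alpha> v k) (S_star \<alpha> w k) \<le> ?s\<^sup>2 * (?V * ?W)" if k: "k < n" for k
  proof -
    have "L2_inner bdry_measure (S_star \<alpha> v k) (S_star \<alpha> w k)
        \<le> L2_norm bdry_measure (S_star \<alpha> v k) * L2_norm bdry_measure (S_star \<alpha> w k)"
      using L2_Cauchy_Schwarz[OF S_star_L2[OF v k] S_star_L2[OF w k]] by (meson abs_le_D1)
    also have "\<dots> \<le> (?s * ?V) * (?s * ?W)"
      unfolding d_def using VW by (intro mult_mono S_star_le v w k) auto
    finally show ?thesis by (simp add: power2_eq_square mult_ac)
  qed
  then have "(\<Sum>k<n. L2_inner bdry_measure (S_star \<alpha> v k) (S_star \<alpha> w k)) \<le> (\<Sum>k<n. ?s\<^sup>2 * (?V * ?W))"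
    by (intro sum_mono) simp
  then have "(\<Sum>k<n. L2_inner bdry_measure (S_star \<alpha> v k) (S_star \<alpha> w k)) \<le> real n * ?s\<^sup>2 * (?V * ?W)"
    by simp
  then have B: "lam * (\<Sum>k<n. L2_inner bdry_measure (S_star \<alpha> v k) (S_star \<alpha> w k))
      \<le> lam * (real n * ?s\<^sup>2 * (?V * ?W))"
    using lam by (intro mult_left_mono) auto
  have mean: "\<bar>LINT x|cube_measure. u 0 x\<bar> \<le> H2_vec_norm n u" if u: "H2_vec n u"
      for u :: "nat \<Rightarrow> 'a \<Rightarrow> real"
  proof -
    have "H2 (u 0)" using u n by (simp add: H2_vec_def)
    then have "\<bar>LINT x|cube_measure. u 0 x\<bar> \<le> L2_norm cube_measure (u 0)"
      by (intro integral_cube_le H1_L2 H2_H1)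
    also have "\<dots> \<le> H2_vec_norm n u"
      using L2_norm_le_H1_norm H1_norm_le_H2_norm H2_norm_le_vec[of 0 n u] n
          by (meson order.trans less_le_trans zero_less_one)
    finally show ?thesis .
  qed
  have "mu * (LINT x|cube_measure. v 0 x) * (LINT x|cube_measure. w 0 x) \<le> mu * (?V * ?W)"
  proof -
    have "(LINT x|cube_measure. v 0 x) * (LINT x|cube_measure. w 0 x)
        \<le> \<bar>LINT x|cube_measure. v 0 x\<bar> * \<bar>LINT x|cube_measure. w 0 x\<bar>"
      by (metis abs_ge_self abs_mult)
    also have "\<dots> \<le> ?V * ?W" using mean[OF v] mean[OF w] VW by (intro mult_mono) auto
    finally show ?thesis using mu by (simp add: mult.assoc)
  qed
  moreover have "0 \<le> mu * (?V * ?W)" using mu VW by simp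
  ultimately have "(if \<alpha> = Neumann then mu * (LINT x|cube_measure. v 0 x) * (LINT x|cube_measure. w
      0 x) else 0) \<le> mu * (?V * ?W)"
    by simp
  with A B show ?thesis unfolding B_form_def by (simp add: algebra_simps)
qed

section \<open>Passing estimates down the chain of equations\<close>

lemma B_form_self:
  "B_form \<alpha> n lam mu v v = (\<Sum>k<n. (L2_norm cube_measure (P_star n v k))\<^sup>2)
     + lam * (\<Sum>k<n. (L2_norm bdry_measure (S_star \<alpha> v k))\<^sup>2)
     + (if \<alpha> = Neumann then mu * (LINT x|cube_measure. v 0 x)\<^sup>2 else 0)"
  unfolding B_form_def L2_norm_sq by (simp add: power2_eq_square)

text \<open>On the diagonal every summand is nonnegative, so the form dominates each of them
  separately.\<close>

lemma B_form_terms: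
  assumes lam: "lam > 0" and mu: "mu > 0"
  shows "B_form \<alpha> n lam mu v v \<ge> 0"
    and "k < n \<Longrightarrow> (L2_norm cube_measure (P_star n v k))\<^sup>2 \<le> B_form \<alpha> n lam mu v v"
    and "k < n \<Longrightarrow> (L2_norm bdry_measure (S_star \<alpha> v k))\<^sup>2 \<le> B_form \<alpha> n lam mu v v / lam"
    and "\<alpha> = Neumann \<Longrightarrow> (LINT x|cube_measure. v 0 x)\<^sup>2 \<le> B_form \<alpha> n lam mu v v / mu"
proof -
  let ?A = "\<Sum>k<n. (L2_norm cube_measure (P_star n v k))\<^sup>2"
  let ?S = "\<Sum>k<n. (L2_norm bdry_measure (S_star \<alpha> v k))\<^sup>2"
  have A: "0 \<le> ?A" and S: "0 \<le> lam * ?S" using lam by (simp_all add: sum_nonneg)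
  have M: "0 \<le> (if \<alpha> = Neumann then mu * (LINT x|cube_measure. v 0 x)\<^sup>2 else 0)" using mu by simp
  show "B_form \<alpha> n lam mu v v \<ge> 0" unfolding B_form_self using A S M by linarith
  show "(L2_norm cube_measure (P_star n v k))\<^sup>2 \<le> B_form \<alpha> n lam mu v v" if "k < n"
  proof -
    have "(L2_norm cube_measure (P_star n v k))\<^sup>2 \<le> ?A" using that by (intro member_le_sum) auto
    then show ?thesis unfolding B_form_self using S M by linarith
  qed
  show "(L2_norm bdry_measure (S_star \<alpha> v k))\<^sup>2 \<le> B_form \<alpha> n lam mu v v / lam" if "k < n"
  proof -
    have "(L2_norm bdry_measure (S_star \<alpha> v k))\<^sup>2 \<le> ?S" using that by (intro member_le_sum) auto
    then have "lam * (L2_norm bdry_measure (S_star \<alpha> v k))\<^sup>2 \<le> lam * ?S" using lam by simp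
    then have "lam * (L2_norm bdry_measure (S_star \<alpha> v k))\<^sup>2 \<le> B_form \<alpha> n lam mu v v"
      unfolding B_form_self using A M by linarith
    then show ?thesis using lam by (simp add: field_simps)
  qed
  show "(LINT x|cube_measure. v 0 x)\<^sup>2 \<le> B_form \<alpha> n lam mu v v / mu" if "\<alpha> = Neumann"
  proof -
    have "mu * (LINT x|cube_measure. v 0 x)\<^sup>2 \<le> B_form \<alpha> n lam mu v v"
      unfolding B_form_self using A S that by simp
    then show ?thesis using mu by (simp add: field_simps)
  qed
qed

text \<open>Here h stands for the squared Sobolev norm and l for the squared norm of the Laplacian
  of a component. The factor 6 (C + 1) is the loss in one step from k + 1 to k.\<close>

lemma backward_recursion:
  fixes h l :: "nat \<Rightarrow> real"
  assumes C: "C \<ge> 0" and b: "b \<ge> 0" and h0: "\<And>k. h k \<ge> 0"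
    and h: "\<And>k. k < n \<Longrightarrow> h k \<le> C * (l k + b)"
    and l0: "\<And>k. l k \<ge> 0"
    and l: "\<And>k. k < n \<Longrightarrow> l k \<le> 2 * b + 2 * (if Suc k < n then h (Suc k) else 0)"
  shows "k < n \<Longrightarrow> h k + l k \<le> (6 * (C + 1)) ^ (n - k) * b"
proof (induction "n - k" arbitrary: k)
  case (Suc m)
  \<comment> \<open>The contribution of the next component; it is zero at the last index, so that
    index needs no separate start of the induction.\<close>
  define r where "r = (if Suc k < n then h (Suc k) else 0)"
  let ?M = "6 * (C + 1)"
  have "1 \<le> ?M ^ m" using C by (intro one_le_power) simp
  then have bM: "b \<le> ?M ^ m * b" using mult_right_mono[of 1 "?M ^ m" b] b by simp
  have r: "0 \<le> r" "r \<le> ?M ^ m * b"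
  proof -
    show "0 \<le> r" by (simp add: r_def h0)
    show "r \<le> ?M ^ m * b"
    proof (cases "Suc k < n")
      case True
      have m: "m = n - Suc k" using Suc.hyps(2) by simp
      have "h (Suc k) + l (Suc k) \<le> ?M ^ m * b"
        using Suc.hyps(1)[OF m True] m by simp
      then show ?thesis using True l0[of "Suc k"] by (simp add: r_def)
    next
      case False
      then show ?thesis using bM b by (simp add: r_def)
    qed
  qed
  have lk: "l k \<le> 2 * b + 2 * r" using l[OF Suc.prems] by (simp add: r_def)
  have "h k + l k \<le> (C + 1) * l k + C * b" using h[OF Suc.prems] by (simp add: algebra_simps)
  also have "\<dots> \<le> (C + 1) * (2 * b + 2 * r) + C * b"
    using lk C by (intro add_right_mono mult_left_mono) auto
  also have "\<dots> \<le> 3 * (C + 1) * (b + r)"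
    using C b r(1) by (simp add: algebra_simps)
  also have "\<dots> \<le> 3 * (C + 1) * (2 * (?M ^ m * b))"
    using bM r(2) C by (intro mult_left_mono) auto
  also have "\<dots> = ?M ^ Suc m * b" by simp
  finally show ?case using Suc.hyps(2) by simp
qed simp

lemma P_star_laplace:
  "laplace (v k) x = P_star n v k x + (if Suc k < n then v (Suc k) x else 0)"
  by (simp add: P_star_def)

lemma laplace_sq_le:
  assumes v: "H2_vec n v" and k: "k < n"
  shows "(L2_norm cube_measure (laplace (v k)))\<^sup>2 \<le> 2 * (L2_norm cube_measure (P_star n v k))\<^sup>2
    + 2 * (if Suc k < n then (H1_norm (v (Suc k)))\<^sup>2 else 0)"
proof -
  let ?w = "\<lambda>x. if Suc k < n then v (Suc k) x else 0"
  have w: "L2 cube_measure ?w"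
    using v by (cases "Suc k < n") (auto simp: H2_vec_def L2_zero intro: H1_L2 H2_H1)
  have "L2_norm cube_measure (laplace (v k)) = L2_norm cube_measure (\<lambda>x. P_star n v k x + ?w x)"
    by (intro arg_cong[where f = "L2_norm cube_measure"] ext P_star_laplace)
  also have "\<dots> \<le> L2_norm cube_measure (P_star n v k) + L2_norm cube_measure ?w"
    by (intro L2_norm_triangle P_star_L2 v k w)
  finally have "(L2_norm cube_measure (laplace (v k)))\<^sup>2
      \<le> (L2_norm cube_measure (P_star n v k) + L2_norm cube_measure ?w)\<^sup>2"
    by (intro power_mono) auto
  also have "\<dots> \<le> 2 * (L2_norm cube_measure (P_star n v k))\<^sup>2 + 2 * (L2_norm cube_measure ?w)\<^sup>2"
    by (rule two_squares)
  also have "(L2_norm cube_measure ?w)\<^sup>2 \<le> (if Suc k < n then (H1_norm (v (Suc k)))\<^sup>2 else 0)"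
    using L2_norm_le_H1_norm[of "v (Suc k)"] by (cases "Suc k < n") (auto intro: power_mono)
  finally show ?thesis by simp
qed

text \<open>The three boundary conditions differ only in the choice of b, which bounds the residuals
  as well as the boundary data and means.\<close>

lemma system_coercive:
  assumes v: "H2_vec n v" and C: "C \<ge> 0" and b: "b \<ge> 0"
    and P: "\<And>k. k < n \<Longrightarrow> (L2_norm cube_measure (P_star n v k))\<^sup>2 \<le> b"
    and H: "\<And>k. k < n \<Longrightarrow> (H1_norm (v k))\<^sup>2 \<le> C * ((L2_norm cube_measure (laplace (v k)))\<^sup>2 + b)"
  shows "(\<Sum>k<n. (H1_norm (v k))\<^sup>2 + (Hdiv_norm (weak_grad (v k)))\<^sup>2) \<le> 2 * real n * (6 * (C
      + 1)) ^ n * b"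
proof -
  have "(H1_norm (v k))\<^sup>2 + (Hdiv_norm (weak_grad (v k)))\<^sup>2 \<le> 2 * (6 * (C + 1)) ^ n * b" if k: "k < n"
      for k
  proof -
    have f: "H2 (v k)" using v k by (simp add: H2_vec_def)
    have "(H1_norm (v k))\<^sup>2 + (L2_norm cube_measure (laplace (v k)))\<^sup>2 \<le> (6 * (C + 1)) ^ (n - k) * b"
    proof (rule backward_recursion[where h = "\<lambda>k. (H1_norm (v k))\<^sup>2" and n = n, OF C b _ H _ _ k])
      fix j assume j: "j < n"
      show "(L2_norm cube_measure (laplace (v j)))\<^sup>2 \<le> 2 * b + 2 * (if Suc j
          < n then (H1_norm (v (Suc j)))\<^sup>2 else 0)"
        using laplace_sq_le[OF v j] P[OF j] by linarith
    qed simp_all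
    also have "\<dots> \<le> (6 * (C + 1)) ^ n * b"
      using C b by (intro mult_right_mono power_increasing) auto
    finally have "(H1_norm (v k))\<^sup>2 + (L2_norm cube_measure (laplace (v k)))\<^sup>2 \<le> (6 * (C
        + 1)) ^ n * b" .
    moreover have "grad_sq (v k) \<le> (H1_norm (v k))\<^sup>2" by (simp add: H1_norm_sq)
    moreover have "0 \<le> (L2_norm cube_measure (laplace (v k)))\<^sup>2" by simp
    \<comment> \<open>The squared H(div) norm adds \<open>grad_sq\<close>, already part of
      \<open>H1_norm\<close>, and the squared Laplacian; hence the factor 2.\<close>
    ultimately show ?thesis unfolding Hdiv_norm_weak_grad[OF f] mult.assoc by linarith
  qed
  then have "(\<Sum>k<n. (H1_norm (v k))\<^sup>2 + (Hdiv_norm (weak_grad (v k)))\<^sup>2) \<le> (\<Sum>k<n. 2 * (6 * (C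
      + 1)) ^ n * b)"
    by (intro sum_mono) simp
  then show ?thesis by (simp add: mult_ac)
qed

text \<open>The mean of the first component is in the form. For a later one, the preceding equation
  expresses it as the flux of the normal derivative minus the mean of the residual.\<close>

lemma mean_le:
  fixes v :: "nat \<Rightarrow> 'a::euclidean_space \<Rightarrow> real"
  defines "\<beta> \<equiv> L2_norm bdry_measure (\<lambda>x :: 'a. 1 :: real)"
  assumes lam: "lam > 0" and mu: "mu > 0" and v: "H2_vec n v" and k: "k < n"
  shows "(LINT x|cube_measure. v k x)\<^sup>2 \<le> (1 / mu + 2 * (\<beta>\<^sup>2 / lam
      + 1)) * B_form Neumann n lam mu v v"
proof -
  let ?B = "B_form Neumann n lam mu v v"
  note B = B_form_terms[OF lam mu, where \<alpha> = Neumann and n = n and v = v, simplified]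
  have pos: "0 \<le> ?B / mu" "0 \<le> 2 * (\<beta>\<^sup>2 / lam + 1) * ?B" using B(1) lam mu by simp_all
  show ?thesis
  proof (cases k)
    case 0
    then show ?thesis using B(4) pos by (simp add: distrib_right)
  next
    case (Suc j)
    then have j: "j < n" "Suc j < n" using k by simp_all
    then have f: "H2 (v j)" "H2 (v (Suc j))" using v by (simp_all add: H2_vec_def)
    define s p where "s = (LINT x|bdry_measure. normal_deriv (v j) x)" and "p
        = (LINT x|cube_measure. P_star n v j x)"
    \<comment> \<open>The j-th equation is solved for the next component, whose index lies in range
      because k = Suc j.\<close>
    have "v (Suc j) = (\<lambda>x. laplace (v j) x - P_star n v j x)"
      using j by (simp add: P_star_def fun_eq_iff)
    then have "(LINT x|cube_measure. v k x) = (LINT x|cube_measure. laplace (v j) x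
        - P_star n v j x)"
      using Suc by simp
    also have "\<dots> = s - p"
      unfolding s_def p_def integral_laplace[OF f(1), symmetric]
      by (intro Bochner_Integration.integral_diff L2_integrable_cube laplace_L2 P_star_L2 v f j)
    finally have "(LINT x|cube_measure. v k x)\<^sup>2 \<le> 2 * s\<^sup>2 + 2 * p\<^sup>2"
      using two_squares[of s "- p"] by simp
    moreover have "p\<^sup>2 \<le> ?B"
    proof -
      have "\<bar>p\<bar>\<^sup>2 \<le> (L2_norm cube_measure (P_star n v j))\<^sup>2"
        unfolding p_def by (intro power_mono integral_cube_le P_star_L2 v j) simp
      then show ?thesis using B(2)[OF j(1)] by simp
    qed
    moreover have "s\<^sup>2 \<le> \<beta>\<^sup>2 / lam * ?B"
    proof -
      have "S_star Neumann v j = normal_deriv (v j)" by auto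
      then have "(L2_norm bdry_measure (normal_deriv (v j)))\<^sup>2 \<le> ?B / lam" using B(3)[OF j(1)]
          by simp
      then have "(L2_norm bdry_measure (normal_deriv (v j)))\<^sup>2 * \<beta>\<^sup>2 \<le> ?B / lam * \<beta>\<^sup>2"
        by (rule mult_right_mono) simp
      moreover have "\<bar>s\<bar>\<^sup>2 \<le> (L2_norm bdry_measure (normal_deriv (v j)) * \<beta>)\<^sup>2"
        unfolding s_def \<beta>_def by (intro power_mono integral_bdry_le normal_deriv_L2 f) simp
      ultimately show ?thesis by (simp add: power_mult_distrib mult.commute)
    qed
    ultimately have "(LINT x|cube_measure. v k x)\<^sup>2 \<le> 2 * (\<beta>\<^sup>2 / lam * ?B) + 2 * ?B" by linarith
    then show ?thesis using pos(1) by (simp add: algebra_simps)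
  qed
qed

section \<open>Coercivity for the three boundary conditions\<close>

lemma coercive_from_bound:
  assumes "D > 0" "s \<le> D * (b :: real)"
  shows "b \<ge> (1 / D) * s"
  using assms by (simp add: field_simps)

theorem B_form_coercive_Neumann:
  assumes n: "n \<ge> 1" and lam: "lam > 0" and mu: "mu > 0"
  shows "\<exists>C>0. \<forall>v :: nat \<Rightarrow> 'a::euclidean_space \<Rightarrow> real. H2_vec n v \<longrightarrow>
    B_form Neumann n lam mu v v \<ge> C * (\<Sum>k<n. (H1_norm (v k))\<^sup>2 + (Hdiv_norm (weak_grad (v k)))\<^sup>2)"
proof -
  define \<beta> where "\<beta> = L2_norm bdry_measure (\<lambda>x :: 'a. 1 :: real)"
  \<comment> \<open>One summand each for the residuals, the normal derivatives and the
    means.\<close>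
  define \<kappa> where "\<kappa> = 1 + 1 / lam + (1 / mu + 2 * (\<beta>\<^sup>2 / lam + 1))"
  define C where "C = (2 ^ DIM('a) * real DIM('a) + 1)\<^sup>2 * (8 * (real DIM('a))\<^sup>2 + 2) + 2"
  have C: "C \<ge> 0" by (simp add: C_def)
  have \<kappa>: "\<kappa> > 0" using lam mu by (simp add: \<kappa>_def add_pos_nonneg)
  define D where "D = 2 * real n * (6 * (C + 1)) ^ n * \<kappa>"
  have D: "D > 0" using n C \<kappa> by (simp add: D_def)
  have "(\<Sum>k<n. (H1_norm (v k))\<^sup>2 + (Hdiv_norm (weak_grad (v k)))\<^sup>2) \<le> D * B_form Neumann n lam mu v v"
    if v: "H2_vec n v" for v :: "nat \<Rightarrow> 'a \<Rightarrow> real"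
  proof -
    let ?B = "B_form Neumann n lam mu v v"
    note B = B_form_terms[OF lam mu, where \<alpha> = Neumann and n = n and v = v, simplified]
    have split: "\<kappa> * ?B = ?B + (?B / lam + (1 / mu + 2 * (\<beta>\<^sup>2 / lam + 1)) * ?B)"
      by (simp add: \<kappa>_def algebra_simps)
    have pos: "0 \<le> ?B / lam" "0 \<le> (1 / mu + 2 * (\<beta>\<^sup>2 / lam + 1)) * ?B" using B(1) lam mu by simp_all
    have "(\<Sum>k<n. (H1_norm (v k))\<^sup>2 + (Hdiv_norm (weak_grad (v k)))\<^sup>2) \<le> 2 * real n * (6 * (C
        + 1)) ^ n * (\<kappa> * ?B)"
    proof (rule system_coercive[OF v C])
      show "0 \<le> \<kappa> * ?B" using \<kappa> B(1) by simp
      fix k assume k: "k < n"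
      show "(L2_norm cube_measure (P_star n v k))\<^sup>2 \<le> \<kappa> * ?B"
        using B(2)[OF k] pos unfolding split by linarith
      have f: "H2 (v k)" using v k by (simp add: H2_vec_def)
      have "S_star Neumann v k = normal_deriv (v k)" by auto
      then have "(L2_norm bdry_measure (normal_deriv (v k)))\<^sup>2 + (LINT x|cube_measure. v k x)\<^sup>2
          \<le> \<kappa> * ?B"
        using B(1) B(3)[OF k] mean_le[OF lam mu v k, folded \<beta>_def] unfolding split by simp
      then have "C * ((L2_norm cube_measure (laplace (v k)))\<^sup>2
          + ((L2_norm bdry_measure (normal_deriv (v k)))\<^sup>2 + (LINT x|cube_measure. v k x)\<^sup>2))
          \<le> C * ((L2_norm cube_measure (laplace (v k)))\<^sup>2 + \<kappa> * ?B)"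
        using C by (intro mult_left_mono) auto
      then show "(H1_norm (v k))\<^sup>2 \<le> C * ((L2_norm cube_measure (laplace (v k)))\<^sup>2 + \<kappa> * ?B)"
        using coercive_Neumann[OF f, folded C_def] by linarith
    qed
    then show ?thesis by (simp add: D_def mult.assoc)
  qed
  then show ?thesis using D by (intro exI[of _ "1 / D"] conjI allI impI coercive_from_bound) auto
qed

theorem B_form_coercive_Robin:
  assumes n: "n \<ge> 1" and lam: "lam > 0" and mu: "mu > 0"
  shows "\<exists>C>0. \<forall>v :: nat \<Rightarrow> 'a::euclidean_space \<Rightarrow> real. H2_vec n v \<longrightarrow>
    B_form Robin n lam mu v v \<ge> C * (\<Sum>k<n. (H1_norm (v k))\<^sup>2 + (Hdiv_norm (weak_grad (v k)))\<^sup>2)"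
proof -
  \<comment> \<open>The summand 1 pays for the residuals, 1 / lam for the Robin data.\<close>
  define \<kappa> where "\<kappa> = 1 + 1 / lam"
  define C where "C = 9 * (8 * (real DIM('a))\<^sup>2 + 2)"
  have C: "C \<ge> 0" by (simp add: C_def)
  have \<kappa>: "\<kappa> > 0" using lam by (simp add: \<kappa>_def add_pos_nonneg)
  define D where "D = 2 * real n * (6 * (C + 1)) ^ n * \<kappa>"
  have D: "D > 0" using n C \<kappa> by (simp add: D_def)
  have "(\<Sum>k<n. (H1_norm (v k))\<^sup>2 + (Hdiv_norm (weak_grad (v k)))\<^sup>2) \<le> D * B_form Robin n lam mu v v"
    if v: "H2_vec n v" for v :: "nat \<Rightarrow> 'a \<Rightarrow> real"
  proof -
    let ?B = "B_form Robin n lam mu v v"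
    note B = B_form_terms(1-3)[OF lam mu, where \<alpha> = Robin and n = n and v = v]
    have split: "\<kappa> * ?B = ?B + ?B / lam" by (simp add: \<kappa>_def algebra_simps)
    have pos: "0 \<le> ?B / lam" using B(1) lam by simp
    have "(\<Sum>k<n. (H1_norm (v k))\<^sup>2 + (Hdiv_norm (weak_grad (v k)))\<^sup>2) \<le> 2 * real n * (6 * (C
        + 1)) ^ n * (\<kappa> * ?B)"
    proof (rule system_coercive[OF v C])
      show "0 \<le> \<kappa> * ?B" using \<kappa> B(1) by simp
      fix k assume k: "k < n"
      show "(L2_norm cube_measure (P_star n v k))\<^sup>2 \<le> \<kappa> * ?B"
        using B(2)[OF k] pos unfolding split by linarith
      have f: "H2 (v k)" using v k by (simp add: H2_vec_def)
      have "S_star Robin v k = (\<lambda>x. bdry_trace (v k) x + normal_deriv (v k) x)" by auto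
      then have "(L2_norm bdry_measure (\<lambda>x. bdry_trace (v k) x + normal_deriv (v k) x))\<^sup>2 \<le> \<kappa> * ?B"
        using B(1) B(3)[OF k] unfolding split by simp
      then have "C * ((L2_norm cube_measure (laplace (v k)))\<^sup>2
          + (L2_norm bdry_measure (\<lambda>x. bdry_trace (v k) x + normal_deriv (v k) x))\<^sup>2)
          \<le> C * ((L2_norm cube_measure (laplace (v k)))\<^sup>2 + \<kappa> * ?B)"
        using C by (intro mult_left_mono) auto
      then show "(H1_norm (v k))\<^sup>2 \<le> C * ((L2_norm cube_measure (laplace (v k)))\<^sup>2 + \<kappa> * ?B)"
        using coercive_Robin[OF f, folded C_def] by linarith
    qed
    then show ?thesis by (simp add: D_def mult.assoc)
  qed
  then show ?thesis using D by (intro exI[of _ "1 / D"] conjI allI impI coercive_from_bound) auto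
qed

text \<open>The recursion is linear in b, so it may be run with a multiple of the square root of the
  form. The trace norm is directly of that order; the squared residuals need the bound by E.\<close>

theorem B_form_coercive_Dirichlet:
  assumes n: "n \<ge> 1" and lam: "lam > 0" and mu: "mu > 0" and E: "E > 0"
  shows "\<exists>C>0. \<forall>v :: nat \<Rightarrow> 'a::euclidean_space \<Rightarrow> real. H2_vec n v \<longrightarrow> H2_vec_norm n v \<le> E \<longrightarrow>
    sqrt (B_form Dirichlet n lam mu v v) \<ge> C * (\<Sum>k<n. (H1_norm (v k))\<^sup>2
        + (Hdiv_norm (weak_grad (v k)))\<^sup>2)"
proof -
  define d where "d = real DIM('a)"
  define A where "A = real n * (d + 1)\<^sup>2 + lam * (real n * (2 * d + 2 * d\<^sup>2)\<^sup>2) + mu"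
  define K where "K = (8 * d + 12 * d\<^sup>2) * E"
  \<comment> \<open>\<open>sqrt A * E\<close> handles the squared residuals through continuity of
    the form, \<open>K / sqrt lam\<close> the linear trace term.\<close>
  define \<kappa> where "\<kappa> = 1 + sqrt A * E + K / sqrt lam"
  have A: "A \<ge> 0" using lam mu by (simp add: A_def)
  have K: "K \<ge> 0" using E by (simp add: K_def d_def)
  have parts: "sqrt A * E \<ge> 0" "K / sqrt lam \<ge> 0" using A K E lam by simp_all
  then have \<kappa>: "\<kappa> > 0" by (simp add: \<kappa>_def)
  define D where "D = 2 * real n * (6 * (9 + 1)) ^ n * \<kappa>"
  have D: "D > 0" using n \<kappa> by (simp add: D_def)
  have "(\<Sum>k<n. (H1_norm (v k))\<^sup>2 + (Hdiv_norm (weak_grad (v k)))\<^sup>2)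
      \<le> D * sqrt (B_form Dirichlet n lam mu v v)"
    if v: "H2_vec n v" and vE: "H2_vec_norm n v \<le> E" for v :: "nat \<Rightarrow> 'a \<Rightarrow> real"
  proof -
    let ?B = "B_form Dirichlet n lam mu v v"
    note B = B_form_terms(1-3)[OF lam mu, where \<alpha> = Dirichlet and n = n and v = v]
    let ?r = "sqrt ?B"
    have r: "0 \<le> ?r" using B(1) by simp
    have V: "0 \<le> H2_vec_norm n v" unfolding H2_vec_norm_def by (simp add: sum_nonneg H2_norm_nonneg)
    have split: "\<kappa> * ?r = ?r + sqrt A * E * ?r + K / sqrt lam * ?r"
      by (simp add: \<kappa>_def distrib_right)
    have pos: "0 \<le> sqrt A * E * ?r" "0 \<le> K / sqrt lam * ?r"
      using parts r by (simp_all only: mult_nonneg_nonneg)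
    have "?B \<le> A * (H2_vec_norm n v * H2_vec_norm n v)"
      using B_form_bounded[OF n lam mu v v, of Dirichlet] by (simp add: A_def d_def mult.assoc)
    also have "\<dots> \<le> A * (E * E)" using A V vE E by (intro mult_left_mono mult_mono) auto
    finally have "?r \<le> sqrt (A * (E * E))" by simp
    then have "?r \<le> sqrt A * E" using E by (simp add: real_sqrt_mult)
    \<comment> \<open>One of the two factors is bounded through E, which turns the form into a
      multiple of its square root.\<close>
    then have "?r * ?r \<le> sqrt A * E * ?r" using r by (rule mult_right_mono)
    then have BE: "?B \<le> sqrt A * E * ?r" using B(1) by simp
    have "(\<Sum>k<n. (H1_norm (v k))\<^sup>2 + (Hdiv_norm (weak_grad (v k)))\<^sup>2) \<le> 2 * real n * (6 * (9
        + 1)) ^ n * (\<kappa> * ?r)"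
    proof (rule system_coercive[OF v])
      show "0 \<le> \<kappa> * ?r" using \<kappa> r by simp
      fix k assume k: "k < n"
      show "(L2_norm cube_measure (P_star n v k))\<^sup>2 \<le> \<kappa> * ?r"
        using B(2)[OF k] BE pos r unfolding split by linarith
      have f: "H2 (v k)" using v k by (simp add: H2_vec_def)
      have fE: "H2_norm (v k) \<le> E" using H2_norm_le_vec[OF k, of v] vE by linarith
      have "S_star Dirichlet v k = bdry_trace (v k)" by auto
      then have "(L2_norm bdry_measure (bdry_trace (v k)))\<^sup>2 \<le> ?B / lam" using B(3)[OF k] by simp
      then have "L2_norm bdry_measure (bdry_trace (v k)) \<le> ?r / sqrt lam"
        by (metis real_le_rsqrt real_sqrt_divide)
      then have "K * L2_norm bdry_measure (bdry_trace (v k)) \<le> K * (?r / sqrt lam)"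
        using K by (rule mult_left_mono)
      also have "\<dots> \<le> \<kappa> * ?r" using pos r unfolding split by simp
      \<comment> \<open>Enlarged to share the coefficient 9 of the Laplacian term.\<close>
      also have "\<dots> \<le> 9 * (\<kappa> * ?r)" using \<kappa> r by simp
      finally show "(H1_norm (v k))\<^sup>2 \<le> 9 * ((L2_norm cube_measure (laplace (v k)))\<^sup>2 + \<kappa> * ?r)"
        using coercive_Dirichlet[OF f fE] by (simp add: K_def d_def)
    qed simp
    then show ?thesis by (simp add: D_def mult.assoc)
  qed
  then show ?thesis using D by (intro exI[of _ "1 / D"] conjI allI impI coercive_from_bound) auto
qed

theorem lemma3p2:
  fixes n :: nat and lam mu :: real
  assumes "n \<ge> 1" and "lam > 0" and "mu > 0"
  shows "(\<exists>C\<^sub>B>0. \<forall>(v :: nat \<Rightarrow> 'a::euclidean_space \<Rightarrow> real) w \<alpha>. H2_vec n v \<longrightarrow> H2_vec n w \<longrightarrow>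
            B_form \<alpha> n lam mu v w \<le> C\<^sub>B * H2_vec_norm n v * H2_vec_norm n w)
    \<and> (\<forall>\<alpha>\<in>{Neumann, Robin}. \<exists>C>0. \<forall>v :: nat \<Rightarrow> 'a \<Rightarrow> real. H2_vec n v \<longrightarrow>
            B_form \<alpha> n lam mu v v
              \<ge> C * (\<Sum>k<n. (H1_norm (v k))\<^sup>2 + (Hdiv_norm (weak_grad (v k)))\<^sup>2))
    \<and> (\<forall>E>0. \<exists>C\<^sub>E>0. \<forall>v :: nat \<Rightarrow> 'a \<Rightarrow> real. H2_vec n v \<longrightarrow> H2_vec_norm n v \<le> E \<longrightarrow>
            sqrt (B_form Dirichlet n lam mu v v)
              \<ge> C\<^sub>E * (\<Sum>k<n. (H1_norm (v k))\<^sup>2 + (Hdiv_norm (weak_grad (v k)))\<^sup>2))"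
proof (intro conjI)
  let ?d = "real DIM('a)"
  \<comment> \<open>This constant involves only n, the dimension, \<open>lam\<close> and
    \<open>mu\<close>, so it can be chosen before v, w and \<alpha>.\<close>
  let ?C = "real n * (?d + 1)\<^sup>2 + lam * (real n * (2 * ?d + 2 * ?d\<^sup>2)\<^sup>2) + mu"
  have "?C > 0" using assms by (intro add_nonneg_pos add_nonneg_nonneg) auto
  then show "\<exists>C\<^sub>B>0. \<forall>(v :: nat \<Rightarrow> 'a \<Rightarrow> real) w \<alpha>. H2_vec n v \<longrightarrow> H2_vec n w \<longrightarrow>
            B_form \<alpha> n lam mu v w \<le> C\<^sub>B * H2_vec_norm n v * H2_vec_norm n w"
    using B_form_bounded[OF assms] by blast
  show "\<forall>\<alpha>\<in>{Neumann, Robin}. \<exists>C>0. \<forall>v :: nat \<Rightarrow> 'a \<Rightarrow> real. H2_vec n v \<longrightarrow>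
            B_form \<alpha> n lam mu v v
              \<ge> C * (\<Sum>k<n. (H1_norm (v k))\<^sup>2 + (Hdiv_norm (weak_grad (v k)))\<^sup>2)"
    using B_form_coercive_Neumann[OF assms, where 'a = 'a] B_form_coercive_Robin[OF assms, where 'a
        = 'a] by blast
  show "\<forall>E>0. \<exists>C\<^sub>E>0. \<forall>v :: nat \<Rightarrow> 'a \<Rightarrow> real. H2_vec n v \<longrightarrow> H2_vec_norm n v \<le> E \<longrightarrow>
            sqrt (B_form Dirichlet n lam mu v v)
              \<ge> C\<^sub>E * (\<Sum>k<n. (H1_norm (v k))\<^sup>2 + (Hdiv_norm (weak_grad (v k)))\<^sup>2)"
    using B_form_coercive_Dirichlet[OF assms, where 'a = 'a] by blast
qed

end
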